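(* Let $\mathbf X_1,\dots,\mathbf X_n$ be sampled from the mixture multi-layer Poisson block model with parameters $(\mathbf z^*,\{\mathbf B_1,\mathbf B_2\},\{\boldsymbol\sigma_1,\boldsymbol\sigma_2\})\in\boldsymbol\Theta(n,d,K,\theta_0,\alpha,\beta,\gamma)$. Let $\mathbf P_m(j_1,j_2)=\mathbf B_m(\boldsymbol\sigma_m(j_1),\boldsymbol\sigma_m(j_2))$ and $I^{*}=\sum_{\omega\in\mathcal J_d}\big(\sqrt{\mathbf P_1(\omega)}-\sqrt{\mathbf P_2(\omega)}\big)^2$. Let $\hat{\mathbf z}$ be the output of the two-stage Poisson algorithm (described in the context) run with an initialization algorithm $\mathrm{Init}$. Suppose that, for some absolute constant $C_1>0$, the event $$\mathcal E_{\rm init}=\Big\{\max_{i\in[n]}h(\tilde{\mathbf z}^{(-i)},\mathbf z^* )\le\eta_z\Big\}\cap\Big\{\max_{i\in[n],\,m\in[2]}h(\tilde{\boldsymbol\sigma}_m^{(-i)},\boldsymbol\sigma_m)\le\eta_\sigma\Big\}$$ satisfies $\mathbb P(\mathcal E_{\rm init})\ge1-C_1(n\vee d)^{-2}$, with $$\eta_\sigma\log\frac1{\eta_\sigma}=o\Big(\frac{I^{*2}}{K^2d^2\theta_0(d/n)}\Big)\quad\text{and}\quad\eta_\sigma\vee\eta_z=o\Big(\frac{I^{*}}{K^2d^2\theta_0}\Big).$$ If $\theta_0\ge C_0$ for some absolute constant $C_0>0$, $K^2\log n=o(n)$ and $I^{*}\to\infty$, then, conditioned on the event $\mathcal E_{\rm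 init}$, with probability at least $1-\exp(-(I^{*})^{1-\epsilon})$ for any $\epsilon\in(0,1)$, $$h(\hat{\mathbf z},\mathbf z^* )\le\exp\Big(-(1-o(1))\frac{I^{*}}2\Big).$$ Moreover, $$\mathbb E\,h(\hat{\mathbf z},\mathbf z^* )\le\exp\Big(-(1-o(1))\frac{I^{*}}2\Big)+O(n^{-C'})$$ for some large constant $C'>0$.
   Context: Notation: $[n]=\{1,\dots,n\}$; $\vee$ is max; $\mathfrak S_k$ permutations of $[k]$; $\mathcal J_d=\{(j_1,j_2):1\le j_1\le j_2\le d\}$; $\boldsymbol\sigma(\omega)=(\boldsymbol\sigma(j_1),\boldsymbol\sigma(j_2))$ for $\omega=(j_1,j_2)$. Asymptotics as $n,d\to\infty$; $\eta_z,\eta_\sigma\to0$. Mixture multi-layer Poisson block model: $\mathbf z^*\in[2]^n$ latent layer labels, $\mathbf B_1,\mathbf B_2\in\mathbb R_+^{K\times K}$ symmetric, $\boldsymbol\sigma_1,\boldsymbol\sigma_2:[d]\to[K]$. One observes independent symmetric $d\times d$ matrices $\mathbf X_i$, $i\in[n]$, with independent entries $\mathbf X_i(\omega)\sim\mathrm{Poisson}(\mathbf B_{z_i^*}(\boldsymbol\sigma_{z_i^*}(\omega)))$, $\omega\in\mathcal J_d$. Losses: $h(\mathbf z,\mathbf z')=\min_{\pi\in\mathfrak S_2}\frac1n\sum_i\mathbb I(z_i\ne\pi(z_i'))$; $h(\boldsymbol\sigma,\boldsymbol\sigma')=\min_{\phi\in\mathfrak S_K}\frac1d\sum_j\mathbb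 I(\boldsymbol\sigma(j)\ne\phi(\boldsymbol\sigma'(j)))$. Parameter space $\boldsymbol\Theta(n,d,K,\theta_0,\alpha,\beta,\gamma)$: for all $m\in[2],k\in[K]$, $|\{i:z_i=m\}|\in[\frac n{2\alpha},\frac{\alpha n}2]$; $|\{j:\boldsymbol\sigma_m(j)=k\}|\in[\frac d{\beta K},\frac{\beta d}K]$; $\mathbf B_m=\mathbf B_m^\top\in\mathbb R_+^{K\times K}$; $\min_m\min_{i,j}\mathbf B_m(i,j)\ge\theta_0$, $\max_m\max_{i,j}\mathbf B_m(i,j)\le\gamma\theta_0$; $\alpha,\beta,\gamma\ge1$ absolute constants. Two-stage Poisson algorithm: for each $i\in[n]$, compute $(\tilde{\mathbf z}^{(-i)},\tilde{\boldsymbol\sigma}_1^{(-i)},\tilde{\boldsymbol\sigma}_2^{(-i)})=\mathrm{Init}(\{\mathbf X_{i'}\}_{i'\ne i})$, where $\tilde{\mathbf z}^{(-i)}\in[2]^{n-1}$ is viewed as an $n$-vector by adding the dummy entry $\tilde z_i^{(-i)}=0$. For $m\in[2]$, $k,l\in[K]$, $$\hat{\mathbf B}^{(-i)}_m(k,l)=\frac{\sum_{i'\ne i}\mathbb I(\tilde z_{i'}^{(-i)}=m)\sum_{\omega\in\mathcal J_d}\mathbf X_{i'}(\omega)\mathbb I(\tilde{\boldsymbol\sigma}_m^{(-i)}(\omega)=(k,l))}{\sum_{i'\ne i}\mathbb I(\tilde z_{i'}^{(-i)}=m)\sum_{\omega\in\mathcal J_d}\mathbb I(\tilde{\boldsymbol\sigma}_m^{(-i)}(\omega)=(k,l))},\quad\hat{\mathbf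 P}_m^{(-i)}(\omega)=\hat{\mathbf B}_m^{(-i)}(\tilde{\boldsymbol\sigma}_m^{(-i)}(\omega)).$$ Set $\hat z_j^{(-i)}=\tilde z_j^{(-i)}$ for $j\ne i$ and $\hat z_i^{(-i)}=\arg\max_{m\in[2]}\sum_{\omega\in\mathcal J_d}\big(-\hat{\mathbf P}_m^{(-i)}(\omega)+\mathbf X_i(\omega)\log\hat{\mathbf P}_m^{(-i)}(\omega)\big)$. Finally $\hat z_1=\hat z_1^{(-1)}$ and for $i=2,\dots,n$, $\hat z_i=\arg\max_{m\in\{1,2\}}|\{j\in[n]:\hat z_j^{(-1)}=m\}\cap\{j\in[n]:\hat z_j^{(-i)}=\hat z_i^{(-i)}\}|$.
   Formalization: In the initialization event one common permutation of the two layer classes must match both the layer labels and the pair of node labellings; with independent matching, swapped layer labels paired with unswapped node labellings falsify the claim. The undefined log 0 is read as 0. *)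

theory Defs
  imports "HOL-Probability.Probability" "HOL-Combinatorics.Permutations"
    "HOL-Library.Landau_Symbols"
begin

text \<open>
  Layers are numbered \<open>1..n\<close>, nodes \<open>1..d\<close>, layer classes \<open>1, 2\<close> and communities \<open>1..K\<close>.
  A \<open>d \<times> d\<close> matrix of counts is a function on pairs, of which only the values on
  \<open>{1..d} \<times> {1..d}\<close> matter; a data set \<open>x\<close> assigns such a matrix \<open>x i\<close> to every layer \<open>i\<close>.
\<close>

type_synonym layers = "nat \<Rightarrow> nat \<times> nat \<Rightarrow> nat"

definition J :: "nat \<Rightarrow> (nat \<times> nat) set" where
  "J d = {(j1, j2). 1 \<le> j1 \<and> j1 \<le> j2 \<and> j2 \<le> d}"

definition mean :: "(nat \<Rightarrow> nat \<Rightarrow> real) \<Rightarrow> (nat \<Rightarrow> nat) \<Rightarrow> nat \<times> nat \<Rightarrow> real" where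
  "mean B \<sigma> \<omega> = B (\<sigma> (fst \<omega>)) (\<sigma> (snd \<omega>))"

definition info :: "nat \<Rightarrow> (nat \<Rightarrow> nat \<Rightarrow> nat \<Rightarrow> real) \<Rightarrow> (nat \<Rightarrow> nat \<Rightarrow> nat) \<Rightarrow> real" where
  "info d B \<sigma> = (\<Sum>\<omega>\<in>J d. (sqrt (mean (B 1) (\<sigma> 1) \<omega>) - sqrt (mean (B 2) (\<sigma> 2) \<omega>))\<^sup>2)"

definition mismatch :: "nat \<Rightarrow> (nat \<Rightarrow> nat) \<Rightarrow> (nat \<Rightarrow> nat) \<Rightarrow> real" where
  "mismatch N a b = (\<Sum>i=1..N. of_bool (a i \<noteq> b i)) / real N"

definition hloss :: "nat \<Rightarrow> nat \<Rightarrow> (nat \<Rightarrow> nat) \<Rightarrow> (nat \<Rightarrow> nat) \<Rightarrow> real" where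
  "hloss N k a b = Min ((\<lambda>\<pi>. mismatch N a (\<pi> \<circ> b)) ` {\<pi>. \<pi> permutes {1..k}})"

definition Theta ::
  "nat \<Rightarrow> nat \<Rightarrow> nat \<Rightarrow> real \<Rightarrow> real \<Rightarrow> real \<Rightarrow> real \<Rightarrow>
   ((nat \<Rightarrow> nat) \<times> (nat \<Rightarrow> nat \<Rightarrow> nat \<Rightarrow> real) \<times> (nat \<Rightarrow> nat \<Rightarrow> nat)) set" where
  "Theta n d K \<theta>0 \<alpha> \<beta> \<gamma> = {(z, B, \<sigma>).
     (\<forall>i\<in>{1..n}. z i \<in> {1, 2}) \<and>
     (\<forall>m\<in>{1, 2}. \<forall>j\<in>{1..d}. \<sigma> m j \<in> {1..K}) \<and>
     (\<forall>m\<in>{1, 2}. real (card {i \<in> {1..n}. z i = m}) \<in> {real n / (2 * \<alpha>) .. \<alpha> * real n / 2}) \<and>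
     (\<forall>m\<in>{1, 2}. \<forall>k\<in>{1..K}.
        real (card {j \<in> {1..d}. \<sigma> m j = k}) \<in> {real d / (\<beta> * real K) .. \<beta> * real d / real K}) \<and>
     (\<forall>m\<in>{1, 2}. \<forall>k\<in>{1..K}. \<forall>l\<in>{1..K}.
        B m k l = B m l k \<and> 0 \<le> B m k l \<and> \<theta>0 \<le> B m k l \<and> B m k l \<le> \<gamma> * \<theta>0)}"

text \<open>The random matrices are \<open>X i \<omega> :: 'w \<Rightarrow> nat\<close> on the probability space \<open>M\<close>.\<close>

definition poisson_block_model ::
  "nat \<Rightarrow> nat \<Rightarrow> (nat \<Rightarrow> nat) \<Rightarrow> (nat \<Rightarrow> nat \<Rightarrow> nat \<Rightarrow> real) \<Rightarrow> (nat \<Rightarrow> nat \<Rightarrow> nat) \<Rightarrow>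
   'w measure \<Rightarrow> (nat \<Rightarrow> nat \<times> nat \<Rightarrow> 'w \<Rightarrow> nat) \<Rightarrow> bool" where
  "poisson_block_model n d z B \<sigma> M X \<longleftrightarrow>
     prob_space M \<and>
     prob_space.indep_vars M (\<lambda>_. count_space UNIV) (\<lambda>(i, \<omega>). X i \<omega>) ({1..n} \<times> J d) \<and>
     (\<forall>i\<in>{1..n}. \<forall>\<omega>\<in>J d. distr M (count_space UNIV) (X i \<omega>) =
        measure_pmf (poisson_pmf (mean (B (z i)) (\<sigma> (z i)) \<omega>))) \<and>
     (\<forall>i\<in>{1..n}. \<forall>j1\<in>{1..d}. \<forall>j2\<in>{1..d}. \<forall>w\<in>space M. X i (j1, j2) w = X i (j2, j1) w)"

text \<open>
  An initialization maps an index set of layers and the matrices of these layers to layer labels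
  and to the pair of node labellings \<open>(\<sigma> 1, \<sigma> 2)\<close>.  It only sees the data it is given, because
  the data are cut off to the index set and to \<open>{1..d} \<times> {1..d}\<close>.
\<close>

type_synonym init_alg = "nat set \<Rightarrow> layers \<Rightarrow> (nat \<Rightarrow> nat) \<times> (nat \<Rightarrow> nat \<Rightarrow> nat)"

definition valid_init :: "nat \<Rightarrow> nat \<Rightarrow> init_alg \<Rightarrow> bool" where
  "valid_init d K Init \<longleftrightarrow> (\<forall>S x.
     (\<forall>i\<in>S. fst (Init S x) i \<in> {1, 2}) \<and>
     (\<forall>m\<in>{1, 2}. \<forall>j\<in>{1..d}. snd (Init S x) m j \<in> {1..K}))"

definition init_without ::
  "nat \<Rightarrow> nat \<Rightarrow> init_alg \<Rightarrow> layers \<Rightarrow> nat \<Rightarrow> (nat \<Rightarrow> nat) \<times> (nat \<Rightarrow> nat \<Rightarrow> nat)" where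
  "init_without n d Init x i =
     Init ({1..n} - {i}) (\<lambda>i'\<in>{1..n} - {i}. \<lambda>\<omega>\<in>{1..d} \<times> {1..d}. x i' \<omega>)"

definition ztil :: "nat \<Rightarrow> nat \<Rightarrow> init_alg \<Rightarrow> layers \<Rightarrow> nat \<Rightarrow> nat \<Rightarrow> nat" where
  "ztil n d Init x i j = (if j = i then 0 else fst (init_without n d Init x i) j)"

definition sigtil :: "nat \<Rightarrow> nat \<Rightarrow> init_alg \<Rightarrow> layers \<Rightarrow> nat \<Rightarrow> nat \<Rightarrow> nat \<Rightarrow> nat" where
  "sigtil n d Init x i m = snd (init_without n d Init x i) m"

definition Bhat :: "nat \<Rightarrow> nat \<Rightarrow> init_alg \<Rightarrow> layers \<Rightarrow> nat \<Rightarrow> nat \<Rightarrow> nat \<Rightarrow> nat \<Rightarrow> real" where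
  "Bhat n d Init x i m k l =
     (let z = ztil n d Init x i; s = sigtil n d Init x i m in
      (\<Sum>i'\<in>{1..n} - {i}. of_bool (z i' = m) *
         (\<Sum>\<omega>\<in>J d. real (x i' \<omega>) * of_bool ((s (fst \<omega>), s (snd \<omega>)) = (k, l)))) /
      (\<Sum>i'\<in>{1..n} - {i}. of_bool (z i' = m) *
         (\<Sum>\<omega>\<in>J d. of_bool ((s (fst \<omega>), s (snd \<omega>)) = (k, l)))))"

definition Phat :: "nat \<Rightarrow> nat \<Rightarrow> init_alg \<Rightarrow> layers \<Rightarrow> nat \<Rightarrow> nat \<Rightarrow> nat \<times> nat \<Rightarrow> real" where
  "Phat n d Init x i m = mean (Bhat n d Init x i m) (sigtil n d Init x i m)"

text \<open>
  \<open>Phat\<close> vanishes where all relevant counts are zero; there \<open>ln 0 = 0\<close>, so that the summand is \<open>0\<close>.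
  A quotient \<open>0 / 0\<close> in \<open>Bhat\<close> can enter \<open>Phat\<close> only if no layer is assigned to class \<open>m\<close>.
\<close>

definition loglik :: "nat \<Rightarrow> nat \<Rightarrow> init_alg \<Rightarrow> layers \<Rightarrow> nat \<Rightarrow> nat \<Rightarrow> real" where
  "loglik n d Init x i m =
     (\<Sum>\<omega>\<in>J d. - Phat n d Init x i m \<omega> + real (x i \<omega>) * ln (Phat n d Init x i m \<omega>))"

text \<open>
  \<open>zhat\<close> is a possible output of the two-stage algorithm on the data \<open>x\<close>; ties in either
  \<open>arg max\<close> may be broken arbitrarily.  Here \<open>c i\<close> is the label given to layer \<open>i\<close> by
  the \<open>i\<close>-th leave-one-out run, and \<open>zloo i\<close> is the full label vector of that run.
\<close>

definition two_stage_output ::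
  "nat \<Rightarrow> nat \<Rightarrow> init_alg \<Rightarrow> layers \<Rightarrow> (nat \<Rightarrow> nat) \<Rightarrow> bool" where
  "two_stage_output n d Init x zhat \<longleftrightarrow> (\<exists>c.
     let zloo = (\<lambda>i j. if j = i then c i else ztil n d Init x i j) in
     (\<forall>i\<in>{1..n}. is_arg_max (loglik n d Init x i) (\<lambda>m. m \<in> {1, 2}) (c i)) \<and>
     zhat 1 = zloo 1 1 \<and>
     (\<forall>i\<in>{2..n}. is_arg_max
        (\<lambda>m. card ({j \<in> {1..n}. zloo 1 j = m} \<inter> {j \<in> {1..n}. zloo i j = zloo i i}))
        (\<lambda>m. m \<in> {1, 2}) (zhat i)))"

text \<open>
  Quality of the initialization.  The classes of the layers are identified only up to a
  relabelling, and the label \<open>m\<close> of the estimate of \<open>\<sigma> m\<close> is the label \<open>m\<close> of the estimated layer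
  classes; hence one and the same \<open>\<pi>\<close> matches the layer classes and the two node labellings.
  Independent relabellings would admit initializations that pair each estimated layer class with
  the node labelling of the other class.
\<close>

definition good_init ::
  "nat \<Rightarrow> nat \<Rightarrow> nat \<Rightarrow> (nat \<Rightarrow> nat) \<Rightarrow> (nat \<Rightarrow> nat \<Rightarrow> nat) \<Rightarrow> real \<Rightarrow> real \<Rightarrow>
   init_alg \<Rightarrow> layers \<Rightarrow> bool" where
  "good_init n d K z \<sigma> \<eta>z \<eta>\<sigma> Init x \<longleftrightarrow>
     (\<forall>i\<in>{1..n}. \<exists>\<pi>. \<pi> permutes {1, 2} \<and>
        mismatch n (ztil n d Init x i) (\<pi> \<circ> z) \<le> \<eta>z \<and>
        (\<forall>m\<in>{1, 2}. hloss d K (sigtil n d Init x i (\<pi> m)) (\<sigma> m) \<le> \<eta>\<sigma>))"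

end

theory Submission
  imports Defs "HOL-Real_Asymp.Real_Asymp"
begin

text \<open>
  Conditionally on the other layers, the label given to layer \<open>i\<close> by the \<open>i\<close>-th run is a plug-in
  likelihood ratio test.  Chernoff's bound at exponent \<open>1/2\<close> gives \<open>exp (- I / 2)\<close> for the true means,
  and plugging in estimates costs a factor \<open>1 - o(1)\<close> in the exponent as long as their squared
  Hellinger distance to the truth is \<open>o(I)\<close> and no estimated mean is far below the truth.
  The estimated means are block averages of independent Poisson counts.  For a Poisson variable \<open>T\<close> of
  mean \<open>\<mu>\<close>, the variable \<open>(sqrt T - sqrt \<mu>)\<^sup>2\<close> has exponential tails uniformly in \<open>\<mu>\<close>, so that the Hellinger
  deviation can be controlled even for tiny blocks, simultaneously for all labellings close to the truth.
  The bias is harmless because a block average is the best approximation among the functions that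
  are constant on blocks.

  Means far below the truth have to be excluded or made harmless.  If \<open>I\<close> is at most a constant times \<open>n \<theta>0\<close>,
  they do not occur up to probability \<open>exp (- I)\<close>.  Otherwise \<open>n\<close>, \<open>d\<close> and \<open>\<theta>0\<close> are polynomially bounded
  in \<open>I\<close>; the Chernoff bound with an exponent of order \<open>1 / ln I\<close> then tolerates them and still
  yields an error probability of at most \<open>exp (- c I / (ln I)\<^sup>2)\<close>, which is smaller than both
  \<open>exp (- (I powr (1 - \<epsilon>)))\<close> and \<open>n powr (- 2)\<close>.
\<close>

section \<open>Concentration of independent Poisson counts\<close>

text \<open>The initialization is an arbitrary function of the other layers, so its labellings
  depend on the very counts that are averaged. The deviation bound therefore has to hold for all
  candidate labellings with error rate at most \<open>\<eta>\<close> at once. Their logarithmic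
  number is of order (n + K d) sqrt \<eta>, and it has to be beaten by the deviation level; this is
  possible because \<eta> n >= 1 turns the smallness of \<eta> into largeness of n. Each run fixes
  its labels only up to a swap that may vary with the run; comparison with run 1 removes the swap,
  and the loss is then at most the fraction of misled layers, whose mean is bounded layer by layer.
  If n \<theta> is small against I, the error probability exp (- c I / (ln I)^2) exceeds the target
  exp (- I / 2), and Markov's inequality at the target level says nothing. But the fraction is a
  multiple of 1 / n and n = O(I), so with the required probability no layer is misled at all. In the
  other regime a summand 1 / ln I in the o(1) of the rate pays for constants and for Markov's
  inequality.\<close>

lemma nn_integral_exp_poisson:
  assumes "0 < \<mu>"
  shows "(\<integral>\<^sup>+x. ennreal (exp (c * real x)) \<partial>poisson_pmf \<mu>) = ennreal (exp (\<mu> * (exp c - 1)))"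
proof -
  have sums: "(\<lambda>k. \<mu> ^ k / fact k * exp (- \<mu>) * exp (c * real k)) sums (exp (\<mu> * exp c) * exp (- \<mu>))"
    using sums_mult2[OF exp_converges[of "\<mu> * exp c"], of "exp (- \<mu>)"]
    by (simp add: scaleR_conv_of_real power_mult_distrib exp_of_nat_mult[symmetric] mult_ac divide_inverse)
  have "(\<integral>\<^sup>+x. ennreal (exp (c * real x)) \<partial>poisson_pmf \<mu>)
      = (\<Sum>k. ennreal (\<mu> ^ k / fact k * exp (- \<mu>) * exp (c * real k)))"
    using assms by (simp add: nn_integral_measure_pmf nn_integral_count_space_nat ennreal_mult'[symmetric])
  also have "\<dots> = ennreal (exp (\<mu> * exp c) * exp (- \<mu>))"
    using assms sums by (intro suminf_ennreal_eq) auto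
  finally show ?thesis
    by (simp add: mult_exp_exp algebra_simps)
qed

abbreviation poisson_prod :: "'a set \<Rightarrow> ('a \<Rightarrow> real) \<Rightarrow> ('a \<Rightarrow> nat) pmf" where
  "poisson_prod A r \<equiv> Pi_pmf A 0 (\<lambda>x. poisson_pmf (r x))"

lemma nn_integral_exp_Pi_poisson:
  assumes "finite A" "\<And>x. x \<in> A \<Longrightarrow> 0 < r x"
  shows "(\<integral>\<^sup>+f. ennreal (exp (\<Sum>x\<in>A. c x * real (f x))) \<partial>poisson_prod A r)
    = ennreal (exp (\<Sum>x\<in>A. r x * (exp (c x) - 1)))"
proof -
  have "(\<integral>\<^sup>+f. ennreal (exp (\<Sum>x\<in>A. c x * real (f x))) \<partial>poisson_prod A r)
     = (\<integral>\<^sup>+f. (\<Prod>x\<in>A. ennreal (exp (c x * real (f x)))) \<partial>poisson_prod A r)"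
    using assms by (simp add: exp_sum prod_ennreal)
  also have "\<dots> = (\<Prod>x\<in>A. \<integral>\<^sup>+y. ennreal (exp (c x * real y)) \<partial>poisson_pmf (r x))"
    using assms(1) by (rule nn_integral_prod_Pi_pmf)
  also have "\<dots> = (\<Prod>x\<in>A. ennreal (exp (r x * (exp (c x) - 1))))"
    using assms by (intro prod.cong refl nn_integral_exp_poisson) auto
  finally show ?thesis
    using assms by (simp add: exp_sum prod_ennreal)
qed

lemma measure_pmf_le_nn_integral:
  assumes "(\<integral>\<^sup>+f. ennreal (G f) \<partial>measure_pmf p) \<le> ennreal c" "0 \<le> c"
  shows "measure_pmf.prob p {f. 1 \<le> G f} \<le> c"
proof -
  have "ennreal (measure_pmf.prob p {f. 1 \<le> G f}) = (\<integral>\<^sup>+f. indicator {f. 1 \<le> G f} f \<partial>measure_pmf p)"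
    by (simp add: measure_pmf.emeasure_eq_measure)
  also have "\<dots> \<le> (\<integral>\<^sup>+f. ennreal (G f) \<partial>measure_pmf p)"
    by (intro nn_integral_mono) (auto simp: indicator_def)
  finally show ?thesis
    using assms by (meson ennreal_le_iff order_trans)
qed

text \<open>Exponential Markov inequality with the Chernoff parameter absorbed into \<open>c\<close>
  and \<open>v\<close>. As the coefficients may have either sign, it serves both tails of a total as
  well as log-likelihood ratios, whose coefficients are differences of logarithms.\<close>

lemma Pi_poisson_chernoff:
  assumes "finite A" "\<And>x. x \<in> A \<Longrightarrow> 0 < r x"
  shows "measure_pmf.prob (poisson_prod A r) {f. v \<le> (\<Sum>x\<in>A. c x * real (f x))}
    \<le> exp ((\<Sum>x\<in>A. r x * (exp (c x) - 1)) - v)"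
proof -
  have "(\<integral>\<^sup>+f. ennreal (exp ((\<Sum>x\<in>A. c x * real (f x)) - v)) \<partial>poisson_prod A r)
     = (\<integral>\<^sup>+f. ennreal (exp (- v)) * ennreal (exp (\<Sum>x\<in>A. c x * real (f x)))
          \<partial>poisson_prod A r)"
    by (simp add: ennreal_mult''[symmetric] mult_exp_exp)
  also have "\<dots> = ennreal (exp (- v)) * ennreal (exp (\<Sum>x\<in>A. r x * (exp (c x) - 1)))"
    using assms by (simp add: nn_integral_cmult nn_integral_exp_Pi_poisson)
  also have "\<dots> = ennreal (exp ((\<Sum>x\<in>A. r x * (exp (c x) - 1)) - v))"
    by (simp add: ennreal_mult''[symmetric] mult_exp_exp)
  finally have "measure_pmf.prob (poisson_prod A r)
      {f. 1 \<le> exp ((\<Sum>x\<in>A. c x * real (f x)) - v)} \<le> exp ((\<Sum>x\<in>A. r x * (exp (c x) - 1)) - v)"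
    by (intro measure_pmf_le_nn_integral) auto
  then show ?thesis by simp
qed

text \<open>The square root stabilizes the variance of a Poisson total: at distance sqrt y on this
  scale both Chernoff exponents are free of \<mu>. The upper tail yields exp (- y), the lower one
  exp (- y / 2), which is weaker and determines the bound.\<close>

lemma Pi_poisson_hellinger_tail:
  fixes r :: "'a \<Rightarrow> real"
  assumes A: "finite A" "\<And>x. x \<in> A \<Longrightarrow> 0 < r x" and y: "0 \<le> y"
  defines "\<mu> \<equiv> \<Sum>x\<in>A. r x"
  defines "p \<equiv> poisson_prod A r"
  shows "measure_pmf.prob p {f. y \<le> (sqrt (\<Sum>x\<in>A. real (f x)) - sqrt \<mu>)\<^sup>2} \<le> 2 * exp (- y / 2)"
proof (cases "A = {} \<or> y = 0")
  case True
  then show ?thesis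
  proof
    assume "A = {}"
    show ?thesis
    proof (cases "y = 0")
      case True
      then show ?thesis using measure_pmf.prob_le_1[of p] by (simp add: order_trans[of _ 1])
    next
      case False
      then show ?thesis using y \<open>A = {}\<close> by (simp add: \<mu>_def)
    qed
  next
    assume "y = 0"
    then show ?thesis using measure_pmf.prob_le_1[of p] by (simp add: order_trans[of _ 1])
  qed
next
  case False
  then have "A \<noteq> {}" and y: "y > 0" using y by auto
  have \<mu>: "0 < \<mu>" unfolding \<mu>_def using A \<open>A \<noteq> {}\<close> by (intro sum_pos) auto
  define T where "T f = (\<Sum>x\<in>A. real (f x))" for f
  have T0: "0 \<le> T f" for f unfolding T_def by (intro sum_nonneg) auto
  define t where "t = (sqrt \<mu> + sqrt y)\<^sup>2"
  \<comment> \<open>On the lower side sqrt T <= sqrt \<mu> - sqrt y gives T <= (sqrt \<mu> - sqrt y)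
    sqrt \<mu> = \<mu> - u. This cruder threshold suits a quadratic bound on the exponent.\<close>
  define u where "u = sqrt y * sqrt \<mu>"
  have "{f. y \<le> (sqrt (T f) - sqrt \<mu>)\<^sup>2} \<subseteq> {f. t \<le> T f} \<union> {f. T f \<le> \<mu> - u}"
  proof safe
    fix f assume *: "y \<le> (sqrt (T f) - sqrt \<mu>)\<^sup>2" and "\<not> T f \<le> \<mu> - u"
    from * have **: "sqrt y \<le> \<bar>sqrt (T f) - sqrt \<mu>\<bar>"
      using real_sqrt_le_mono by fastforce
    show "t \<le> T f"
    proof (cases "sqrt (T f) \<le> sqrt \<mu>")
      case True
      then have le: "sqrt (T f) \<le> sqrt \<mu> - sqrt y" using ** by linarith
      have "T f = sqrt (T f) * sqrt (T f)" using T0 by simp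
      also have "\<dots> \<le> (sqrt \<mu> - sqrt y) * sqrt \<mu>"
        using le True order_trans[OF real_sqrt_ge_zero[OF T0[of f]] le] T0[of f]
        by (intro mult_mono) auto
      also have "\<dots> = \<mu> - u" using \<mu> by (simp add: u_def algebra_simps)
      finally show ?thesis using \<open>\<not> T f \<le> \<mu> - u\<close> by simp
    next
      case False
      then have "sqrt \<mu> + sqrt y \<le> sqrt (T f)" using ** by linarith
      then have "t \<le> (sqrt (T f))\<^sup>2" unfolding t_def using \<mu> y by (intro power_mono) auto
      then show ?thesis using T0 by simp
    qed
  qed
  then have "measure_pmf.prob p {f. y \<le> (sqrt (T f) - sqrt \<mu>)\<^sup>2}
      \<le> measure_pmf.prob p {f. t \<le> T f} + measure_pmf.prob p {f. T f \<le> \<mu> - u}"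
    by (intro order_trans[OF measure_pmf.finite_measure_mono measure_Un_le]) auto
  moreover have "measure_pmf.prob p {f. t \<le> T f} \<le> exp (- y)"
  proof -
    define s where "s = sqrt (t / \<mu>)"
    have st: "sqrt t = sqrt \<mu> + sqrt y" using \<mu> y by (simp add: t_def)
    have t: "t > 0" unfolding t_def using \<mu> y by (intro zero_less_power add_pos_pos) auto
    have s0: "s > 1" unfolding s_def real_sqrt_divide using st \<mu> y by (simp add: divide_simps)
    have tm: "t = s\<^sup>2 * \<mu>" using \<mu> t by (simp add: s_def)
    \<comment> \<open>The optimal Chernoff parameter ln (t / \<mu>); the exponent t - \<mu> - c t is
      then at most - \<mu> (s - 1)^2 = - y.\<close>
    define c where "c = 2 * ln s"
    have c: "c > 0" "exp c = s\<^sup>2" using s0 by (auto simp: c_def exp_double)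
    have "{f. t \<le> T f} = {f. c * t \<le> (\<Sum>x\<in>A. c * real (f x))}"
      using c by (simp add: T_def sum_distrib_left[symmetric])
    then have "measure_pmf.prob p {f. t \<le> T f} \<le> exp ((\<Sum>x\<in>A. r x * (exp c - 1)) - c * t)"
      unfolding p_def using Pi_poisson_chernoff[of A r "c * t" "\<lambda>_. c"] A by simp
    also have "(\<Sum>x\<in>A. r x * (exp c - 1)) - c * t = t - \<mu> - c * t"
      unfolding sum_distrib_right[symmetric] c(2) tm \<mu>_def[symmetric] by (simp add: algebra_simps)
    also have "\<dots> \<le> - y"
    proof -
      have "ln (1 / s) \<le> 1 / s - 1" using s0 by (intro ln_le_minus_one) auto
      then have "c \<ge> 2 * (1 - 1 / s)" using s0 by (simp add: c_def ln_div)
      then have "c * t \<ge> 2 * (1 - 1 / s) * t" using t by (intro mult_right_mono) auto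
      also have "2 * (1 - 1 / s) * t = 2 * s\<^sup>2 * \<mu> - 2 * s * \<mu>"
        using s0 by (simp add: tm field_simps power2_eq_square)
      finally have "t - \<mu> - c * t \<le> - (\<mu> * (s - 1)\<^sup>2)"
        by (simp add: tm power2_eq_square algebra_simps)
      also have "\<mu> * (s - 1)\<^sup>2 = (sqrt \<mu> * s - sqrt \<mu>)\<^sup>2"
        using \<mu> by (simp add: power2_eq_square algebra_simps)
      also have "sqrt \<mu> * s = sqrt t" using \<mu> t by (simp add: s_def real_sqrt_divide)
      finally show ?thesis using st y by simp
    qed
    finally show ?thesis by simp
  qed
  moreover have "measure_pmf.prob p {f. T f \<le> \<mu> - u} \<le> exp (- y / 2)"
  proof -
    \<comment> \<open>Minimizer of \<mu> c^2 / 2 - c u; the minimum - u^2 / (2 \<mu>) is - y /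
      2.\<close>
    define c where "c = u / \<mu>"
    have c: "c > 0" using \<mu> y by (simp add: c_def u_def)
    have "{f. T f \<le> \<mu> - u} = {f. - c * (\<mu> - u) \<le> (\<Sum>x\<in>A. - c * real (f x))}"
      using c unfolding T_def sum_distrib_left[symmetric] by simp
    then have "measure_pmf.prob p {f. T f \<le> \<mu> - u} \<le> exp ((\<Sum>x\<in>A. r x * (exp (- c) - 1)) - (- c * (\<mu> - u)))"
      unfolding p_def using Pi_poisson_chernoff[of A r "- c * (\<mu> - u)" "\<lambda>_. - c"] A by simp
    also have "(\<Sum>x\<in>A. r x * (exp (- c) - 1)) - (- c * (\<mu> - u)) = \<mu> * (exp (- c) - 1) + c * (\<mu> - u)"
      by (simp add: \<mu>_def sum_distrib_right[symmetric])
    \<comment> \<open>Reciprocal of the Taylor lower bound for exp c: the product of 1 - c + c^2 / 2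
      and 1 + c + c^2 / 2 is 1 + c^4 / 4.\<close>
    also have "exp (- c) \<le> 1 - c + c\<^sup>2 / 2"
    proof -
      have "1 + c + c\<^sup>2 / 2 \<le> exp c" using exp_lower_Taylor_quadratic[of c] c by simp
      then have "exp (- c) \<le> 1 / (1 + c + c\<^sup>2 / 2)"
        using c by (simp add: exp_minus divide_simps add_pos_pos)
      also have "\<dots> \<le> 1 - c + c\<^sup>2 / 2"
      proof -
        have "(1 - c + c\<^sup>2 / 2) * (1 + c + c\<^sup>2 / 2) = 1 + c ^ 4 / 4"
          by (simp add: power2_eq_square power4_eq_xxxx algebra_simps)
        then have "1 \<le> (1 - c + c\<^sup>2 / 2) * (1 + c + c\<^sup>2 / 2)" by simp
        then show ?thesis using c by (simp add: pos_divide_le_eq add_pos_pos)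
      qed
      finally show ?thesis .
    qed
    then have "\<mu> * (exp (- c) - 1) + c * (\<mu> - u) \<le> \<mu> * ((1 - c + c\<^sup>2 / 2) - 1) + c * (\<mu> - u)"
      using \<mu> by simp
    also have "\<dots> = - y / 2"
      using \<mu> y by (simp add: c_def u_def power2_eq_square field_simps)
    finally show ?thesis by simp
  qed
  moreover have "exp (- y) \<le> exp (- y / 2)" using y by simp
  ultimately show ?thesis unfolding T_def by linarith
qed

text \<open>The tail exp (- y / 2) beats the growth exp (y / 4), so the moment has a bound
  independent of the rates and of the size of \<open>A\<close>.\<close>

lemma Pi_poisson_hellinger_exp_moment:
  fixes r :: "'a \<Rightarrow> real"
  assumes A: "finite A" "\<And>x. x \<in> A \<Longrightarrow> 0 < r x"
  shows "(\<integral>\<^sup>+f. ennreal (exp ((sqrt (\<Sum>x\<in>A. real (f x)) - sqrt (\<Sum>x\<in>A. r x))\<^sup>2 / 4))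
    \<partial>poisson_prod A r) \<le> ennreal (exp 3)"
proof -
  define p where "p = poisson_prod A r"
  define Y where "Y f = (sqrt (\<Sum>x\<in>A. real (f x)) - sqrt (\<Sum>x\<in>A. r x))\<^sup>2" for f
  have Y0: "Y f \<ge> 0" for f by (simp add: Y_def)
  have "(\<integral>\<^sup>+f. ennreal (exp (Y f / 4)) \<partial>p)
     \<le> (\<integral>\<^sup>+f. (\<Sum>j. ennreal (exp ((real j + 1) / 4)) * indicator {f. real j \<le> Y f} f) \<partial>p)"
  proof (intro nn_integral_mono)
    fix f
    \<comment> \<open>The summand of level floor (Y f) alone dominates exp (Y f / 4); the series
      over integer levels replaces a tail integral.\<close>
    define j where "j = nat \<lfloor>Y f\<rfloor>"
    have j: "real j \<le> Y f" "Y f \<le> real j + 1"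
      unfolding j_def using Y0[of f] by linarith+
    have "ennreal (exp (Y f / 4)) \<le> ennreal (exp ((real j + 1) / 4))"
      using j by (intro ennreal_leI) simp
    also have "\<dots> = (\<Sum>i\<in>{j}. ennreal (exp ((real i + 1) / 4)) * indicator {f. real i \<le> Y f} f)"
      using j by simp
    also have "\<dots> \<le> (\<Sum>i. ennreal (exp ((real i + 1) / 4)) * indicator {f. real i \<le> Y f} f)"
      by (intro sum_le_suminf) auto
    finally show "ennreal (exp (Y f / 4))
      \<le> (\<Sum>i. ennreal (exp ((real i + 1) / 4)) * indicator {f. real i \<le> Y f} f)" .
  qed
  also have "\<dots> = (\<Sum>j. ennreal (exp ((real j + 1) / 4)) * emeasure p {f. real j \<le> Y f})"
    by (subst nn_integral_suminf) (auto simp: nn_integral_cmult_indicator)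
  also have "\<dots> \<le> (\<Sum>j. ennreal (2 * exp (1 / 4) * exp (- 1 / 4) ^ j))"
  proof (intro suminf_le allI)
    fix j :: nat
    have "measure_pmf.prob p {f. real j \<le> Y f} \<le> 2 * exp (- real j / 2)"
      unfolding p_def Y_def using A by (intro Pi_poisson_hellinger_tail) auto
    then have "ennreal (exp ((real j + 1) / 4)) * emeasure p {f. real j \<le> Y f}
       \<le> ennreal (exp ((real j + 1) / 4)) * ennreal (2 * exp (- real j / 2))"
      by (intro mult_left_mono) (auto simp: measure_pmf.emeasure_eq_measure intro!: ennreal_leI)
    also have "\<dots> = ennreal (2 * exp (1 / 4) * exp (- 1 / 4) ^ j)"
      by (simp add: ennreal_mult''[symmetric] exp_of_nat_mult[symmetric] mult_exp_exp field_simps)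
    finally show "ennreal (exp ((real j + 1) / 4)) * emeasure p {f. real j \<le> Y f}
       \<le> ennreal (2 * exp (1 / 4) * exp (- 1 / 4) ^ j)" .
  qed auto
  also have "\<dots> = ennreal (2 * exp (1 / 4) * (1 / (1 - exp (- 1 / 4))))"
    by (intro suminf_ennreal_eq sums_mult geometric_sums) auto
  also have "\<dots> \<le> ennreal (exp 3)"
  proof (intro ennreal_leI)
    have "exp (1/4 :: real) \<ge> 1 + 1/4" by (rule exp_ge_add_one_self)
    then have "exp (- 1/4 :: real) \<le> 4/5" by (simp add: exp_minus field_simps)
    then have "2 * exp (1 / 4) * (1 / (1 - exp (- 1 / 4))) \<le> 2 * exp (1 / 4) * (1 / (1 - 4/5 :: real))"
      by (intro mult_left_mono divide_left_mono) auto
    also have "\<dots> = 10 * exp (1/4 :: real)" by simp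
    also have "10 \<le> exp (11/4 :: real)"
    proof -
      \<comment> \<open>The quadratic Taylor bound at 11/4 itself gives only about 7.5; with the
        exponent split into ten equal parts it exceeds 10.\<close>
      have "(1 + 11/40 + (11/40)\<^sup>2/2 :: real) ^ 10 \<le> exp (11/40) ^ 10"
        using exp_lower_Taylor_quadratic[of "11/40"] by (intro power_mono) auto
      also have "\<dots> = exp (11/4 :: real)" by (simp add: exp_of_nat_mult[symmetric])
      finally show ?thesis by (rule order_trans[rotated]) (simp add: power_numeral_reduce)
    qed
    then have "10 * exp (1/4 :: real) \<le> exp (11/4) * exp (1/4)" by simp
    also have "\<dots> = exp 3" by (simp add: mult_exp_exp)
    finally show "2 * exp (1 / 4) * (1 / (1 - exp (- 1 / 4))) \<le> exp (3 :: real)" by simp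
  qed
  finally show ?thesis unfolding p_def Y_def .
qed

section \<open>Product laws: marginals, conditioning and independent blocks\<close>

lemma nn_integral_Pi_pmf_mono_index:
  assumes "finite U" "A \<subseteq> U" "\<And>f g. (\<And>x. x \<in> A \<Longrightarrow> f x = g x) \<Longrightarrow> h f = h g"
  shows "nn_integral (Pi_pmf U dflt p) h = nn_integral (Pi_pmf A dflt p) h"
proof -
  have "nn_integral (Pi_pmf A dflt p) h
      = nn_integral (map_pmf (\<lambda>f x. if x \<in> A then f x else dflt) (Pi_pmf U dflt p)) h"
    using Pi_pmf_subset[OF assms(1,2)] by metis
  also have "\<dots> = nn_integral (Pi_pmf U dflt p) h"
    by (auto intro!: nn_integral_cong assms(3))
  finally show ?thesis ..
qed

lemma nn_integral_Pi_pmf_split: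
  assumes "finite A" "finite B" "A \<inter> B = {}"
  shows "nn_integral (Pi_pmf (A \<union> B) dflt p) h =
    (\<integral>\<^sup>+g. \<integral>\<^sup>+f. h (\<lambda>x. if x \<in> A then f x else g x) \<partial>Pi_pmf A dflt p \<partial>Pi_pmf B dflt p)"
proof -
  have "Pi_pmf (A \<union> B) dflt p = map_pmf (\<lambda>(g, f) x. if x \<in> A then f x else g x)
      (pair_pmf (Pi_pmf B dflt p) (Pi_pmf A dflt p))"
    using assms by (subst Pi_pmf_union, simp_all, subst pair_commute_pmf)
      (simp add: pmf.map_comp o_def case_prod_unfold cong: if_cong)
  then show ?thesis
    by (simp add: nn_integral_pair_pmf' case_prod_beta cong: if_cong)
qed

lemma nn_integral_Pi_pmf_blocks:
  fixes h :: "'b \<Rightarrow> ('a \<Rightarrow> 'c) \<Rightarrow> ennreal"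
  assumes "finite F" "\<And>b. b \<in> F \<Longrightarrow> finite (A b)" "disjoint_family_on A F"
    "\<And>b f g. b \<in> F \<Longrightarrow> (\<And>x. x \<in> A b \<Longrightarrow> f x = g x) \<Longrightarrow> h b f = h b g"
  shows "(\<integral>\<^sup>+f. (\<Prod>b\<in>F. h b f) \<partial>Pi_pmf (\<Union>b\<in>F. A b) dflt p)
    = (\<Prod>b\<in>F. nn_integral (Pi_pmf (A b) dflt p) (h b))"
  using assms
proof (induction F rule: finite_induct)
  case empty
  then show ?case by simp
next
  case (insert b F)
  have disj: "A b \<inter> (\<Union>b\<in>F. A b) = {}"
    using insert.prems(2) insert.hyps by (fastforce simp: disjoint_family_on_def)
  have 1: "h b (\<lambda>x. if x \<in> A b then f x else g x) = h b f" for f g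
    by (rule insert.prems(3)) auto
  have 2: "(\<Prod>b\<in>F. h b (\<lambda>x. if x \<in> A b' then f x else g x)) = (\<Prod>b\<in>F. h b g)"
    if "b' = b" for f g b'
  proof (rule prod.cong[OF refl])
    fix b'' assume b'': "b'' \<in> F"
    show "h b'' (\<lambda>x. if x \<in> A b' then f x else g x) = h b'' g"
      using disj b'' that by (intro insert.prems(3)) auto
  qed
  have "(\<integral>\<^sup>+f. (\<Prod>b\<in>insert b F. h b f) \<partial>Pi_pmf (\<Union>b\<in>insert b F. A b) dflt p)
     = (\<integral>\<^sup>+g. \<integral>\<^sup>+f. h b f * (\<Prod>b\<in>F. h b g) \<partial>Pi_pmf (A b) dflt p \<partial>Pi_pmf (\<Union>b\<in>F. A b) dflt p)"
    using insert.hyps insert.prems(1)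
    by (simp only: UN_insert, subst nn_integral_Pi_pmf_split[OF _ _ disj]) (simp_all add: 1 2)
  also have "\<dots> = nn_integral (Pi_pmf (A b) dflt p) (h b) * 
      (\<integral>\<^sup>+g. (\<Prod>b\<in>F. h b g) \<partial>Pi_pmf (\<Union>b\<in>F. A b) dflt p)"
    by (simp add: nn_integral_multc nn_integral_cmult)
  also have "(\<integral>\<^sup>+g. (\<Prod>b\<in>F. h b g) \<partial>Pi_pmf (\<Union>b\<in>F. A b) dflt p)
      = (\<Prod>b\<in>F. nn_integral (Pi_pmf (A b) dflt p) (h b))"
  proof (rule insert.IH)
    show "disjoint_family_on A F" using insert.prems(2) by (auto simp: disjoint_family_on_def)
    show "finite (A b)" if "b \<in> F" for b using that by (intro insert.prems(1)) auto
    show "h b f = h b g" if "b \<in> F" "\<And>x. x \<in> A b \<Longrightarrow> f x = g x" for b f g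
      using that by (intro insert.prems(3)) auto
  qed
  finally show ?case using insert.hyps by simp
qed

text \<open>Each block contributes a factor of at most exp 3 to the exponential moment at exponent
  1/4, whatever its size and rates. So only the number of blocks enters, and blocks with few entries
  do no harm.\<close>

lemma Pi_poisson_block_tail:
  fixes r :: "'a \<Rightarrow> real"
  assumes U: "finite U" "\<And>x. x \<in> U \<Longrightarrow> 0 < r x"
    and F: "finite F" "\<And>b. b \<in> F \<Longrightarrow> A b \<subseteq> U" "disjoint_family_on A F"
  shows "measure_pmf.prob (poisson_prod U r)
    {f. v \<le> (\<Sum>b\<in>F. (sqrt (\<Sum>x\<in>A b. real (f x)) - sqrt (\<Sum>x\<in>A b. r x))\<^sup>2)}
    \<le> exp (3 * real (card F) - v / 4)"
proof -
  define Y where "Y b f = (sqrt (\<Sum>x\<in>A b. real (f x)) - sqrt (\<Sum>x\<in>A b. r x))\<^sup>2" for b f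
  define G where "G f = exp ((\<Sum>b\<in>F. Y b f) / 4 - v / 4)" for f
  have Yc: "Y b f = Y b g" if "\<And>x. x \<in> A b \<Longrightarrow> f x = g x" for b f g
    using that by (simp add: Y_def cong: sum.cong)
  have fA: "finite (A b)" if "b \<in> F" for b using F(2)[OF that] U(1) by (rule finite_subset)
  have "(\<integral>\<^sup>+f. ennreal (G f) \<partial>poisson_prod U r)
    = (\<integral>\<^sup>+f. ennreal (G f) \<partial>poisson_prod (\<Union>b\<in>F. A b) r)"
    using U(1) F(2) by (intro nn_integral_Pi_pmf_mono_index)
      (auto simp: G_def intro!: arg_cong[of _ _ ennreal] sum.cong Yc)
  also have "\<dots> = (\<integral>\<^sup>+f. ennreal (exp (- v / 4)) * (\<Prod>b\<in>F. ennreal (exp (Y b f / 4)))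
      \<partial>poisson_prod (\<Union>b\<in>F. A b) r)"
  proof (intro nn_integral_cong)
    fix f
    have "G f = exp (- v / 4) * (\<Prod>b\<in>F. exp (Y b f / 4))"
      using F(1) by (simp add: G_def exp_sum[symmetric] sum_divide_distrib mult_exp_exp)
    then show "ennreal (G f) = ennreal (exp (- v / 4)) * (\<Prod>b\<in>F. ennreal (exp (Y b f / 4)))"
      by (simp add: ennreal_mult'' prod_ennreal prod_nonneg)
  qed
  also have "\<dots> = ennreal (exp (- v / 4)) *
      (\<Prod>b\<in>F. \<integral>\<^sup>+f. ennreal (exp (Y b f / 4)) \<partial>poisson_prod (A b) r)"
    using F(1,3) fA
    by (subst nn_integral_cmult, simp, subst nn_integral_Pi_pmf_blocks)
      (auto intro!: arg_cong[of _ _ ennreal] Yc)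
  also have "\<dots> \<le> ennreal (exp (- v / 4)) * (\<Prod>b\<in>F. ennreal (exp 3))"
    using F U fA unfolding Y_def
    by (intro mult_left_mono prod_mono_ennreal Pi_poisson_hellinger_exp_moment) auto
  also have "\<dots> = ennreal (exp (3 * real (card F) - v / 4))"
    by (simp add: ennreal_power exp_of_nat_mult[symmetric] ennreal_mult''[symmetric] mult_exp_exp mult.commute)
  finally have "measure_pmf.prob (poisson_prod U r) {f. 1 \<le> G f}
      \<le> exp (3 * real (card F) - v / 4)"
    by (intro measure_pmf_le_nn_integral) auto
  then show ?thesis by (simp add: G_def Y_def)
qed

text \<open>The set \<open>H\<close> is arbitrary: finitely many countable-valued variables have
  countably many joint outcomes, so every event is a countable union of fibres. Hence the
  initialization needs no measurability, and probabilities can be computed under a discrete product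
  law.\<close>

lemma prob_eq_Pi_pmf:
  fixes X :: "'a \<Rightarrow> 'w \<Rightarrow> 'c :: countable"
  assumes "prob_space M" and A: "finite A"
    and indep: "prob_space.indep_vars M (\<lambda>_. count_space UNIV) X A"
    and distr: "\<And>a. a \<in> A \<Longrightarrow> distr M (count_space UNIV) (X a) = measure_pmf (q a)"
  shows "{w \<in> space M. (\<lambda>a. if a \<in> A then X a w else dflt) \<in> H} \<in> sets M"
    and "measure M {w \<in> space M. (\<lambda>a. if a \<in> A then X a w else dflt) \<in> H}
      = measure_pmf.prob (Pi_pmf A dflt q) H"
proof -
  interpret prob_space M by fact
  have X: "X a \<in> measurable M (count_space UNIV)" if "a \<in> A" for a
    using indep that unfolding indep_vars_def2 by auto
  define S where "S = PiE_dflt A dflt (\<lambda>_. UNIV :: 'c set)"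
  define W where "W f = {w \<in> space M. \<forall>a\<in>A. X a w = f a}" for f
  have S: "countable S"
    using A unfolding S_def dflt_image_PiE[symmetric] by (intro countable_image countable_PiE) auto
  have eqW: "{w \<in> space M. (\<lambda>a. if a \<in> A then X a w else dflt) \<in> H} = (\<Union>f\<in>S \<inter> H. W f)"
  proof safe
    fix w assume "w \<in> space M" "(\<lambda>a. if a \<in> A then X a w else dflt) \<in> H"
    then show "w \<in> (\<Union>f\<in>S \<inter> H. W f)"
      by (intro UN_I[of "\<lambda>a. if a \<in> A then X a w else dflt"]) (auto simp: S_def W_def PiE_dflt_def)
  next
    fix w f assume *: "w \<in> W f" "f \<in> S" "f \<in> H"
    then have "(\<lambda>a. if a \<in> A then X a w else dflt) = f"
      by (auto simp: S_def W_def PiE_dflt_def)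
    then show "(\<lambda>a. if a \<in> A then X a w else dflt) \<in> H" using * by simp
  qed (auto simp: W_def)
  have W: "W f \<in> sets M" for f
  proof -
    have "W f = space M \<inter> (\<Inter>a\<in>A. X a -` {f a} \<inter> space M)" if "A \<noteq> {}" 
      using that by (auto simp: W_def)
    then show ?thesis
      using A X by (cases "A = {}") (auto simp: W_def[of f] intro!: sets.Int sets.finite_INT measurable_sets)
  qed
  show "{w \<in> space M. (\<lambda>a. if a \<in> A then X a w else dflt) \<in> H} \<in> sets M"
    unfolding eqW using S W by (intro sets.countable_UN') auto
  have pW: "emeasure M (W f) = pmf (Pi_pmf A dflt q) f" if "f \<in> S" for f
  proof -
    have q: "prob (X a -` {f a} \<inter> space M) = pmf (q a) (f a)" if "a \<in> A" for a
    proof -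
      have "prob (X a -` {f a} \<inter> space M) = measure (distr M (count_space UNIV) (X a)) {f a}"
        using X[OF that] by (simp add: measure_distr)
      then show ?thesis using distr[OF that] by (simp add: measure_pmf_single)
    qed
    have "prob (W f) = (\<Prod>a\<in>A. pmf (q a) (f a))"
    proof (cases "A = {}")
      case True
      then show ?thesis by (simp add: W_def prob_space)
    next
      case False
      then have "W f = (\<Inter>a\<in>A. X a -` {f a} \<inter> space M)" by (auto simp: W_def)
      then show ?thesis using indep_varsD_finite[OF indep False A, of "\<lambda>a. {f a}"] q by simp
    qed
    also have "\<dots> = pmf (Pi_pmf A dflt q) f"
      using that A by (subst pmf_Pi') (auto simp: S_def PiE_dflt_def)
    finally show ?thesis by (simp add: emeasure_eq_measure)
  qed
  have "emeasure M (\<Union>f\<in>S \<inter> H. W f) = (\<integral>\<^sup>+f. emeasure M (W f) \<partial>count_space (S \<inter> H))"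
  proof (rule emeasure_UN_countable)
    show "disjoint_family_on W (S \<inter> H)"
      unfolding disjoint_family_on_def
    proof (intro ballI impI)
      fix f g assume fg: "f \<in> S \<inter> H" "g \<in> S \<inter> H" "f \<noteq> g"
      then obtain a where "f a \<noteq> g a" by auto
      moreover from this have "a \<in> A" using fg by (auto simp: S_def PiE_dflt_def)
      ultimately show "W f \<inter> W g = {}" by (auto simp: W_def)
    qed
  qed (use S W in auto)
  also have "\<dots> = (\<integral>\<^sup>+f. pmf (Pi_pmf A dflt q) f \<partial>count_space (S \<inter> H))"
    by (intro nn_integral_cong) (simp add: pW)
  also have "\<dots> = emeasure (measure_pmf (Pi_pmf A dflt q)) (S \<inter> H)"
    by (rule nn_integral_pmf)
  also have "\<dots> = emeasure (measure_pmf (Pi_pmf A dflt q)) H"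
    using set_Pi_pmf_subset'[OF A, of dflt q]
    by (intro emeasure_eq_AE) (fastforce simp: AE_measure_pmf_iff S_def PiE_dflt_def)+
  finally show "measure M {w \<in> space M. (\<lambda>a. if a \<in> A then X a w else dflt) \<in> H}
      = measure_pmf.prob (Pi_pmf A dflt q) H"
    unfolding eqW by (simp add: measure_def)
qed

lemma prob_Pi_pmf_split_le:
  assumes "finite A" "finite B" "A \<inter> B = {}" "0 \<le> c"
    and le: "\<And>g. measure_pmf.prob (Pi_pmf A dflt p) {f. (\<lambda>x. if x \<in> A then f x else g x) \<in> H} \<le> c"
  shows "measure_pmf.prob (Pi_pmf (A \<union> B) dflt p) H \<le> c"
proof -
  have "emeasure (Pi_pmf (A \<union> B) dflt p) H = (\<integral>\<^sup>+f. indicator H f \<partial>Pi_pmf (A \<union> B) dflt p)"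
    by simp
  also have "\<dots> = (\<integral>\<^sup>+g. \<integral>\<^sup>+f. indicator H (\<lambda>x. if x \<in> A then f x else g x)
      \<partial>Pi_pmf A dflt p \<partial>Pi_pmf B dflt p)"
    using assms(1-3) by (rule nn_integral_Pi_pmf_split)
  also have "\<dots> = (\<integral>\<^sup>+g. emeasure (Pi_pmf A dflt p) {f. (\<lambda>x. if x \<in> A then f x else g x) \<in> H}
      \<partial>Pi_pmf B dflt p)"
  proof (intro nn_integral_cong)
    fix g
    have "(\<integral>\<^sup>+f. indicator H (\<lambda>x. if x \<in> A then f x else g x) \<partial>Pi_pmf A dflt p)
        = (\<integral>\<^sup>+f. indicator {f. (\<lambda>x. if x \<in> A then f x else g x) \<in> H} f \<partial>Pi_pmf A dflt p)"
      by (intro nn_integral_cong) (simp add: indicator_def)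
    then show "(\<integral>\<^sup>+f. indicator H (\<lambda>x. if x \<in> A then f x else g x) \<partial>Pi_pmf A dflt p)
        = emeasure (Pi_pmf A dflt p) {f. (\<lambda>x. if x \<in> A then f x else g x) \<in> H}"
      by simp
  qed
  also have "\<dots> \<le> (\<integral>\<^sup>+g. ennreal c \<partial>Pi_pmf B dflt p)"
    using le by (intro nn_integral_mono) (auto simp: measure_pmf.emeasure_eq_measure intro!: ennreal_leI)
  also have "\<dots> = ennreal c"
    by (simp add: measure_pmf.emeasure_space_1[simplified])
  finally show ?thesis using \<open>0 \<le> c\<close> by (simp add: measure_pmf.emeasure_eq_measure)
qed

text \<open>Generating function argument: a labelling is weighted by x to the number of its errors.
  The total weight factorizes over the nodes, and every labelling to be counted has weight at least
  x to the power \<eta> |U|.\<close>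

lemma card_labellings_near_le:
  assumes U: "finite U" and B: "finite B" and \<eta>: "0 < \<eta>" "\<eta> \<le> 1"
  shows "real (card {s \<in> PiE U (\<lambda>_. B). real (card {j \<in> U. s j \<noteq> \<sigma> j}) \<le> \<eta> * real (card U)})
    \<le> exp ((real (card B) + 1) * real (card U) * sqrt \<eta>)"
proof -
  \<comment> \<open>Balances the two costs per node: |B| x from the total weight, and - \<eta> ln x
    <= \<eta> / x = x from the lower bound on the weights.\<close>
  define x where "x = sqrt \<eta>"
  have x: "0 < x" "x \<le> 1" using \<eta> by (auto simp: x_def)
  define S where "S = {s \<in> PiE U (\<lambda>_. B). real (card {j \<in> U. s j \<noteq> \<sigma> j}) \<le> \<eta> * real (card U)}"
  have fin: "finite (PiE U (\<lambda>_. B))" using U B by (intro finite_PiE) auto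
  have "real (card S) * x powr (\<eta> * real (card U)) = (\<Sum>s\<in>S. x powr (\<eta> * real (card U)))"
    by simp
  also have "\<dots> \<le> (\<Sum>s\<in>S. x ^ card {j \<in> U. s j \<noteq> \<sigma> j})"
  proof (rule sum_mono)
    fix s assume "s \<in> S"
    then have "x powr (\<eta> * real (card U)) \<le> x powr real (card {j \<in> U. s j \<noteq> \<sigma> j})"
      using x by (intro powr_mono') (auto simp: S_def)
    then show "x powr (\<eta> * real (card U)) \<le> x ^ card {j \<in> U. s j \<noteq> \<sigma> j}"
      using x by (simp add: powr_realpow)
  qed
  also have "\<dots> \<le> (\<Sum>s\<in>PiE U (\<lambda>_. B). x ^ card {j \<in> U. s j \<noteq> \<sigma> j})"
    using fin x by (intro sum_mono2) (auto simp: S_def)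
  also have "\<dots> = (\<Sum>s\<in>PiE U (\<lambda>_. B). \<Prod>j\<in>U. if s j \<noteq> \<sigma> j then x else 1)"
    using U by (intro sum.cong refl) (simp add: prod.If_cases Int_def)
  also have "\<dots> = (\<Prod>j\<in>U. \<Sum>k\<in>B. if k \<noteq> \<sigma> j then x else 1)"
    using U B by (subst prod_sum_PiE) auto
  also have "\<dots> \<le> (\<Prod>j\<in>U. 1 + real (card B) * x)"
  proof (intro prod_mono conjI)
    fix j
    show "0 \<le> (\<Sum>k\<in>B. if k \<noteq> \<sigma> j then x else 1)" using x by (intro sum_nonneg) auto
    have "(\<Sum>k\<in>B. if k \<noteq> \<sigma> j then x else 1) \<le> (\<Sum>k\<in>B. x + (if k = \<sigma> j then 1 else 0))"
      using x by (intro sum_mono) auto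
    also have "\<dots> \<le> 1 + real (card B) * x" using B by (simp add: sum.distrib sum.delta)
    finally show "(\<Sum>k\<in>B. if k \<noteq> \<sigma> j then x else 1) \<le> 1 + real (card B) * x" .
  qed
  also have "\<dots> \<le> exp (real (card B) * x) ^ card U"
    using x by (simp add: power_mono exp_ge_add_one_self add_nonneg_nonneg)
  also have "\<dots> = exp (real (card B) * real (card U) * x)"
    by (simp add: exp_of_nat_mult[symmetric] mult_ac)
  finally have "real (card S) * x powr (\<eta> * real (card U)) \<le> exp (real (card B) * real (card U) * x)" .
  moreover have "exp (- (real (card U) * x)) \<le> x powr (\<eta> * real (card U))"
  proof -
    have "- ln x = ln (1 / x)" using x by (simp add: ln_div)
    also have "\<dots> \<le> 1 / x" using x ln_le_minus_one[of "1/x"] by simp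
    finally have "- ln x * x\<^sup>2 \<le> 1 / x * x\<^sup>2" using x by (intro mult_right_mono) auto
    then have "- ln x * \<eta> \<le> x" using x \<eta> by (simp add: x_def power2_eq_square real_div_sqrt)
    then have "- ln x * \<eta> * real (card U) \<le> x * real (card U)" by (intro mult_right_mono) auto
    then show ?thesis using x by (simp add: powr_def mult_ac)
  qed
  ultimately have "real (card S) * exp (- (real (card U) * x)) \<le> exp (real (card B) * real (card U) * x)"
    by (meson mult_left_mono of_nat_0_le_iff order_trans)
  then have "real (card S) \<le> exp (real (card B) * real (card U) * x) * exp (real (card U) * x)"
    by (simp add: exp_minus field_simps)
  also have "\<dots> = exp ((real (card B) + 1) * real (card U) * x)"
    by (simp add: mult_exp_exp algebra_simps)
  finally show ?thesis by (simp add: S_def x_def)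
qed

section \<open>Block averages\<close>

definition key :: "(nat \<Rightarrow> nat) \<Rightarrow> nat \<times> nat \<Rightarrow> nat \<times> nat" where
  "key s \<omega> = (s (fst \<omega>), s (snd \<omega>))"

definition cell :: "nat \<Rightarrow> (nat \<Rightarrow> nat) \<Rightarrow> nat \<times> nat \<Rightarrow> (nat \<times> nat) set" where
  "cell d s \<omega> = {\<omega>' \<in> J d. key s \<omega>' = key s \<omega>}"

text \<open>Indexed by the entry and not by a pair of community labels, so that only the partition
  induced by \<open>s\<close> matters and a relabelling of the communities changes nothing.\<close>

definition block_avg ::
  "nat \<Rightarrow> nat set \<Rightarrow> (nat \<Rightarrow> nat) \<Rightarrow> (nat \<Rightarrow> nat \<times> nat \<Rightarrow> real) \<Rightarrow> nat \<times> nat \<Rightarrow> real" where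
  "block_avg d Z s y \<omega> =
     (\<Sum>i\<in>Z. \<Sum>\<omega>'\<in>cell d s \<omega>. y i \<omega>') / (real (card Z) * real (card (cell d s \<omega>)))"

lemma J_subset: "J d \<subseteq> {1..d} \<times> {1..d}"
  by (auto simp: J_def)

lemma finite_J [simp, intro]: "finite (J d)"
  using J_subset by (rule finite_subset) auto

abbreviation hellinger :: "nat \<Rightarrow> (nat \<times> nat \<Rightarrow> real) \<Rightarrow> (nat \<times> nat \<Rightarrow> real) \<Rightarrow> real" where
  "hellinger d f g \<equiv> (\<Sum>\<omega>\<in>J d. (sqrt (f \<omega>) - sqrt (g \<omega>))\<^sup>2)"

lemma card_J_le: "real (card (J d)) \<le> (real d)\<^sup>2"
proof -
  have "card (J d) \<le> card ({1..d} \<times> {1..d})" by (intro card_mono J_subset) auto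
  then have "card (J d) \<le> d * d" by (simp add: card_cartesian_product)
  then show ?thesis by (simp add: power2_eq_square flip: of_nat_mult)
qed

lemma cell_subset: "cell d s \<omega> \<subseteq> J d"
  by (auto simp: cell_def)

lemma finite_cell [simp, intro]: "finite (cell d s \<omega>)"
  using cell_subset finite_J by (rule finite_subset)

lemma in_cell: "\<omega> \<in> J d \<Longrightarrow> \<omega> \<in> cell d s \<omega>"
  by (simp add: cell_def)

lemma card_cell_pos: "\<omega> \<in> J d \<Longrightarrow> 0 < card (cell d s \<omega>)"
  using in_cell[of \<omega> d s] by (auto simp: card_gt_0_iff simp del: split_paired_All)

lemma cell_cong: "\<omega>' \<in> cell d s \<omega> \<Longrightarrow> cell d s \<omega>' = cell d s \<omega>"
  by (auto simp: cell_def)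

lemma sum_J_cells: "(\<Sum>\<omega>\<in>J d. g \<omega>) = (\<Sum>b\<in>key s ` J d. \<Sum>\<omega>\<in>{\<omega> \<in> J d. key s \<omega> = b}. g \<omega>)"
  by (intro sum.image_gen) auto

lemma block_avg_bounds:
  assumes "\<omega> \<in> J d" "finite Z" "Z \<noteq> {}"
    and y: "\<And>i \<omega>'. i \<in> Z \<Longrightarrow> \<omega>' \<in> J d \<Longrightarrow> a \<le> y i \<omega>' \<and> y i \<omega>' \<le> b"
  shows "a \<le> block_avg d Z s y \<omega>" "block_avg d Z s y \<omega> \<le> b"
proof -
  have N: "0 < real (card Z)" "0 < real (card (cell d s \<omega>))"
    using assms card_cell_pos by (auto simp: card_gt_0_iff)
  have "(\<Sum>i\<in>Z. \<Sum>\<omega>'\<in>cell d s \<omega>. a) \<le> (\<Sum>i\<in>Z. \<Sum>\<omega>'\<in>cell d s \<omega>. y i \<omega>')"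
    using y cell_subset by (intro sum_mono) blast
  then show "a \<le> block_avg d Z s y \<omega>"
    using N by (simp add: block_avg_def field_simps)
  have "(\<Sum>i\<in>Z. \<Sum>\<omega>'\<in>cell d s \<omega>. y i \<omega>') \<le> (\<Sum>i\<in>Z. \<Sum>\<omega>'\<in>cell d s \<omega>. b)"
    using y cell_subset by (intro sum_mono) blast
  then show "block_avg d Z s y \<omega> \<le> b"
    using N by (simp add: block_avg_def field_simps)
qed

text \<open>On a block C both averages are constant, being totals divided by |Z| |C|; the |C| equal
  summands and the factor |Z| cancel these denominators. What remains are deviations of block
  totals, in the form of \<open>Pi_poisson_block_tail\<close>.\<close>

lemma sum_J_hellinger_block_avg:
  assumes "finite Z" and "\<And>i \<omega>. 0 \<le> f i \<omega>" "\<And>i \<omega>. 0 \<le> r i \<omega>"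
  shows "real (card Z) * hellinger d (block_avg d Z s f) (block_avg d Z s r)
    = (\<Sum>b\<in>key s ` J d. (sqrt (\<Sum>(i, \<omega>)\<in>Z \<times> {\<omega> \<in> J d. key s \<omega> = b}. f i \<omega>)
        - sqrt (\<Sum>(i, \<omega>)\<in>Z \<times> {\<omega> \<in> J d. key s \<omega> = b}. r i \<omega>))\<^sup>2)"
proof (cases "Z = {}")
  case True
  then show ?thesis by simp
next
  case False
  then have N: "0 < real (card Z)" using assms(1) by (simp add: card_gt_0_iff)
  show ?thesis
    unfolding sum_J_cells[of _ d s] sum_distrib_left[of _ _ "key s ` J d"]
  proof (rule sum.cong[OF refl])
    fix b assume "b \<in> key s ` J d"
    then obtain \<omega>0 where \<omega>0: "\<omega>0 \<in> J d" "key s \<omega>0 = b" by auto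
    define C where "C = cell d s \<omega>0"
    have C: "{\<omega> \<in> J d. key s \<omega> = b} = C" using \<omega>0 by (simp add: C_def cell_def)
    have c: "0 < real (card C)" unfolding C_def using card_cell_pos[OF \<omega>0(1)] by simp
    define T where "T y = (\<Sum>(i, \<omega>)\<in>Z \<times> C. y i \<omega> :: real)" for y
    have avg: "block_avg d Z s y \<omega> = T y / (real (card Z) * real (card C))" if "\<omega> \<in> C" for y \<omega>
      using cell_cong[of \<omega> d s \<omega>0] that by (simp add: block_avg_def T_def C_def sum.cartesian_product)
    have "real (card Z) * (\<Sum>\<omega>\<in>C. (sqrt (block_avg d Z s f \<omega>) - sqrt (block_avg d Z s r \<omega>))\<^sup>2)
       = real (card Z) * (real (card C) * (sqrt (T f / (real (card Z) * real (card C))) - sqrt (T r / (real (card Z) * real (card C))))\<^sup>2)"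
      by (simp add: avg)
    also have "\<dots> = (sqrt (T f) - sqrt (T r))\<^sup>2"
      using N c by (simp add: real_sqrt_divide diff_divide_distrib[symmetric] power_divide)
    finally show "real (card Z) * (\<Sum>\<omega>\<in>{\<omega> \<in> J d. key s \<omega> = b}. (sqrt (block_avg d Z s f \<omega>) - sqrt (block_avg d Z s r \<omega>))\<^sup>2)
       = (sqrt (\<Sum>(i, \<omega>)\<in>Z \<times> {\<omega> \<in> J d. key s \<omega> = b}. f i \<omega>)
        - sqrt (\<Sum>(i, \<omega>)\<in>Z \<times> {\<omega> \<in> J d. key s \<omega> = b}. r i \<omega>))\<^sup>2"
      unfolding C T_def .
  qed
qed

lemma block_avg_hellinger_tail:
  fixes r :: "nat \<Rightarrow> nat \<times> nat \<Rightarrow> real"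
  assumes "finite U" "Z \<times> J d \<subseteq> U" "\<And>i \<omega>. 0 < r i \<omega>"
    and s: "\<And>j. j \<in> {1..d} \<Longrightarrow> s j \<in> {1..K}"
  shows "measure_pmf.prob (Pi_pmf U 0 (\<lambda>(i, \<omega>). poisson_pmf (r i \<omega>)))
    {f. v \<le> real (card Z) * hellinger d (block_avg d Z s (\<lambda>i \<omega>. real (f (i, \<omega>)))) (block_avg d Z s r)} \<le> exp (3 * (real K)\<^sup>2 - v / 4)"
\<comment> \<open>For empty \<open>J d\<close> the inclusion
  \<open>Z \<times> J d \<subseteq> U\<close> does not make \<open>Z\<close> finite; the Hellinger
  sum is then 0 and only the sign of \<open>v\<close> matters.\<close>
proof (cases "J d = {}")
  case True
  show ?thesis
  proof (cases "v \<le> 0")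
    case True
    then have "v / 4 \<le> 3 * (real K)\<^sup>2" using zero_le_power2[of "real K"] by linarith
    then have "1 \<le> exp (3 * (real K)\<^sup>2 - v / 4)" by simp
    then show ?thesis by (rule order_trans[OF measure_pmf.prob_le_1])
  next
    case False
    then show ?thesis using \<open>J d = {}\<close> by simp
  qed
next
  case False
  define A where "A b = Z \<times> {\<omega> \<in> J d. key s \<omega> = b}" for b
  have fZ: "finite Z"
    using finite_subset[OF assms(2,1)] False by (auto dest: finite_cartesian_productD1)
  have "key s ` J d \<subseteq> {1..K} \<times> {1..K}"
    using s by (auto simp: key_def J_def)
  then have "card (key s ` J d) \<le> card ({1..K} \<times> {1..K})"
    by (intro card_mono) auto
  then have card: "real (card (key s ` J d)) \<le> (real K)\<^sup>2"
    by (simp add: card_cartesian_product power2_eq_square flip: of_nat_mult)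
  have "measure_pmf.prob (Pi_pmf U 0 (\<lambda>x. poisson_pmf (case_prod r x)))
    {f. v \<le> (\<Sum>b\<in>key s ` J d. (sqrt (\<Sum>x\<in>A b. real (f x)) - sqrt (\<Sum>x\<in>A b. case_prod r x))\<^sup>2)}
    \<le> exp (3 * real (card (key s ` J d)) - v / 4)"
    using assms by (intro Pi_poisson_block_tail) (auto simp: A_def disjoint_family_on_def)
  also have "\<dots> \<le> exp (3 * (real K)\<^sup>2 - v / 4)" using card by simp
  finally show ?thesis
    using fZ assms(3) by (subst sum_J_hellinger_block_avg)
      (auto simp: A_def case_prod_beta' intro: less_imp_le)
qed

lemma sum_squares_mean_le:
  fixes v :: "'a \<Rightarrow> real"
  assumes "finite C" "C \<noteq> {}"
  shows "(\<Sum>x\<in>C. ((\<Sum>x\<in>C. v x) / real (card C) - v x)\<^sup>2) \<le> (\<Sum>x\<in>C. (k - v x)\<^sup>2)"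
proof -
  define c where "c = real (card C)"
  define m where "m = (\<Sum>x\<in>C. v x) / c"
  have c: "c > 0" using assms by (simp add: c_def card_gt_0_iff)
  have S: "(\<Sum>x\<in>C. v x) = c * m" using c by (simp add: m_def)
  have ex: "(\<Sum>x\<in>C. (k - v x)\<^sup>2) = c * k\<^sup>2 - 2 * k * (c * m) + (\<Sum>x\<in>C. (v x)\<^sup>2)" for k
    unfolding S[symmetric] by (simp add: power2_diff sum.distrib sum_subtractf sum_distrib_left c_def)
  have "(\<Sum>x\<in>C. (k - v x)\<^sup>2) - (\<Sum>x\<in>C. (m - v x)\<^sup>2) = c * (k - m)\<^sup>2"
    unfolding ex by (simp add: power2_eq_square algebra_simps)
  moreover have "c * (k - m)\<^sup>2 \<ge> 0" using c by simp
  ultimately show ?thesis unfolding m_def c_def by linarith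
qed

lemma block_avg_const:
  assumes "finite Z" "Z \<noteq> {}"
  shows "block_avg d Z s (\<lambda>_. y) \<omega> = (\<Sum>\<omega>'\<in>cell d s \<omega>. y \<omega>') / real (card (cell d s \<omega>))"
  using assms by (simp add: block_avg_def)

text \<open>Least squares: the mean over a block is its best constant approximation. The competitor
  \<open>g\<close> is free; for the bias it will be the true \<open>B m\<close> at the estimated
  labels.\<close>

lemma sum_J_block_avg_best:
  assumes "finite Z" "Z \<noteq> {}"
  shows "(\<Sum>\<omega>\<in>J d. (block_avg d Z s (\<lambda>_. y) \<omega> - y \<omega>)\<^sup>2) \<le> (\<Sum>\<omega>\<in>J d. (g (key s \<omega>) - y \<omega>)\<^sup>2)"
  unfolding sum_J_cells[of _ d s]
proof (rule sum_mono)
  fix b assume "b \<in> key s ` J d"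
  then obtain \<omega>0 where \<omega>0: "\<omega>0 \<in> J d" "key s \<omega>0 = b" by auto
  define C where "C = {\<omega> \<in> J d. key s \<omega> = b}"
  have "C = cell d s \<omega>" if "\<omega> \<in> C" for \<omega>
    using that by (auto simp: C_def cell_def)
  then have "(\<Sum>\<omega>\<in>C. (block_avg d Z s (\<lambda>_. y) \<omega> - y \<omega>)\<^sup>2)
      = (\<Sum>\<omega>\<in>C. ((\<Sum>\<omega>\<in>C. y \<omega>) / real (card C) - y \<omega>)\<^sup>2)"
    using assms by (intro sum.cong refl) (simp add: block_avg_const)
  also have "\<dots> \<le> (\<Sum>\<omega>\<in>C. (g b - y \<omega>)\<^sup>2)"
  proof (rule sum_squares_mean_le)
    have "\<omega>0 \<in> C" using \<omega>0 by (simp add: C_def)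
    then show "C \<noteq> {}" by auto
  qed (simp add: C_def)
  also have "\<dots> = (\<Sum>\<omega>\<in>C. (g (key s \<omega>) - y \<omega>)\<^sup>2)"
    by (simp add: C_def)
  finally show "(\<Sum>\<omega>\<in>{\<omega> \<in> J d. key s \<omega> = b}. (block_avg d Z s (\<lambda>_. y) \<omega> - y \<omega>)\<^sup>2)
     \<le> (\<Sum>\<omega>\<in>{\<omega> \<in> J d. key s \<omega> = b}. (g (key s \<omega>) - y \<omega>)\<^sup>2)"
    unfolding C_def .
qed

lemma sqrt_diff_square_le:
  fixes a b :: real
  assumes "0 \<le> a" "0 < c" "c \<le> b"
  shows "(sqrt a - sqrt b)\<^sup>2 \<le> (a - b)\<^sup>2 / c"
proof -
  have "(a - b)\<^sup>2 = (sqrt a - sqrt b)\<^sup>2 * (sqrt a + sqrt b)\<^sup>2"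
    using assms by (simp add: power_mult_distrib[symmetric] square_diff_square_factored[symmetric] algebra_simps)
  moreover have "c \<le> (sqrt a + sqrt b)\<^sup>2"
  proof -
    have "0 \<le> 2 * sqrt a * sqrt b" using assms by simp
    moreover have "(sqrt a + sqrt b)\<^sup>2 = a + b + 2 * sqrt a * sqrt b"
      unfolding power2_sum using assms by simp
    ultimately show ?thesis using assms by linarith
  qed
  ultimately have "(sqrt a - sqrt b)\<^sup>2 * c \<le> (a - b)\<^sup>2" by (simp add: mult_left_mono)
  then show ?thesis using assms by (simp add: field_simps)
qed

lemma card_J_endpoint_le:
  assumes "D \<subseteq> {1..d}"
  shows "real (card {\<omega> \<in> J d. fst \<omega> \<in> D \<or> snd \<omega> \<in> D}) \<le> 2 * real d * real (card D)"
proof -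
  have fD: "finite D" using assms by (rule finite_subset) auto
  have "{\<omega> \<in> J d. fst \<omega> \<in> D \<or> snd \<omega> \<in> D} \<subseteq> D \<times> {1..d} \<union> {1..d} \<times> D"
    using J_subset by fastforce
  then have "card {\<omega> \<in> J d. fst \<omega> \<in> D \<or> snd \<omega> \<in> D} \<le> card (D \<times> {1..d} \<union> {1..d} \<times> D)"
    using fD by (intro card_mono) auto
  also have "\<dots> \<le> card (D \<times> {1..d}) + card ({1..d} \<times> D)" by (rule card_Un_le)
  also have "\<dots> = 2 * d * card D" by (simp add: card_cartesian_product)
  finally have "real (card {\<omega> \<in> J d. fst \<omega> \<in> D \<or> snd \<omega> \<in> D}) \<le> real (2 * d * card D)"
    by (rule of_nat_mono)
  then show ?thesis by simp
qed

abbreviation counts :: "layers \<Rightarrow> nat \<Rightarrow> nat \<times> nat \<Rightarrow> real" where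
  "counts x \<equiv> \<lambda>i \<omega>. real (x i \<omega>)"

section \<open>Bias of block averages under nearly correct labels\<close>

locale block_model =
  fixes n d K :: nat and z :: "nat \<Rightarrow> nat" and B :: "nat \<Rightarrow> nat \<Rightarrow> nat \<Rightarrow> real"
    and \<sigma> :: "nat \<Rightarrow> nat \<Rightarrow> nat" and \<theta> \<alpha> \<beta> \<gamma> :: real
  assumes Theta: "(z, B, \<sigma>) \<in> Theta n d K \<theta> \<alpha> \<beta> \<gamma>"
    and \<theta>: "0 < \<theta>" and \<alpha>: "1 \<le> \<alpha>" and \<gamma>: "1 \<le> \<gamma>" and n: "0 < n"
begin

definition P :: "nat \<Rightarrow> nat \<times> nat \<Rightarrow> real" where
  "P m = mean (B m) (\<sigma> m)"

abbreviation "Pbar Z s \<equiv> block_avg d Z s (\<lambda>i. P (z i))"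

abbreviation "deviation Z s Q \<equiv>
  real (card Z) * hellinger d Q (Pbar Z s)"

text \<open>The term 32 \<alpha>^2 pays for layers of the wrong class, the term 4 for mislabelled
  nodes; both arise in \<open>block_avg_bias\<close>.\<close>

abbreviation "bias_bound \<eta> \<equiv> (32 * \<alpha>\<^sup>2 + 4) * \<gamma>\<^sup>2 * (\<theta> * (real d)\<^sup>2 * \<eta>)"

text \<open>The labels are already aligned with the truth, and one \<open>\<eta>\<close> measures
  both kinds of error. The size n / (4 \<alpha>) is half of the guaranteed size of a true
  class.\<close>

definition near :: "real \<Rightarrow> nat \<Rightarrow> nat set \<Rightarrow> (nat \<Rightarrow> nat) \<Rightarrow> bool" where
  "near \<eta> m Z s \<longleftrightarrow> Z \<subseteq> {1..n} \<and> Z \<noteq> {} \<and> real n / (4 * \<alpha>) \<le> real (card Z) \<and>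
     real (card {i \<in> Z. z i \<noteq> m}) \<le> \<eta> * real n \<and>
     (\<forall>j\<in>{1..d}. s j \<in> {1..K}) \<and> real (card {j \<in> {1..d}. s j \<noteq> \<sigma> m j}) \<le> \<eta> * real d"

lemma z_in: "i \<in> {1..n} \<Longrightarrow> z i \<in> {1, 2}"
  using Theta by (simp add: Theta_def)

lemma \<sigma>_in: "m \<in> {1, 2} \<Longrightarrow> j \<in> {1..d} \<Longrightarrow> \<sigma> m j \<in> {1..K}"
  using Theta unfolding Theta_def by blast

lemma B_bounds:
  assumes "m \<in> {1, 2}" "k \<in> {1..K}" "l \<in> {1..K}"
  shows "\<theta> \<le> B m k l" "B m k l \<le> \<gamma> * \<theta>"
  using Theta assms unfolding Theta_def by blast+

lemma P_bounds:
  assumes "m \<in> {1, 2}" "\<omega> \<in> J d"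
  shows "\<theta> \<le> P m \<omega>" "P m \<omega> \<le> \<gamma> * \<theta>"
proof -
  have "fst \<omega> \<in> {1..d}" "snd \<omega> \<in> {1..d}" using assms by (auto simp: J_def)
  then show "\<theta> \<le> P m \<omega>" "P m \<omega> \<le> \<gamma> * \<theta>"
    using assms(1) by (auto simp: P_def mean_def intro!: B_bounds \<sigma>_in)
qed

lemma sqrt_P_diff_le:
  assumes "a \<in> {1, 2}" "b \<in> {1, 2}" "\<omega> \<in> J d"
  shows "(sqrt (P a \<omega>) - sqrt (P b \<omega>))\<^sup>2 \<le> \<gamma> * \<theta>"
proof -
  have "0 \<le> P a \<omega>" "P a \<omega> \<le> \<gamma> * \<theta>" "0 \<le> P b \<omega>" "P b \<omega> \<le> \<gamma> * \<theta>"
    using P_bounds[OF assms(1,3)] P_bounds[OF assms(2,3)] \<theta> by auto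
  then have "0 \<le> sqrt (P a \<omega>)" "sqrt (P a \<omega>) \<le> sqrt (\<gamma> * \<theta>)" "0 \<le> sqrt (P b \<omega>)" "sqrt (P b \<omega>) \<le> sqrt (\<gamma> * \<theta>)"
    by auto
  then have "\<bar>sqrt (P a \<omega>) - sqrt (P b \<omega>)\<bar> \<le> sqrt (\<gamma> * \<theta>)" unfolding abs_le_iff by linarith
  then have "\<bar>sqrt (P a \<omega>) - sqrt (P b \<omega>)\<bar>\<^sup>2 \<le> (sqrt (\<gamma> * \<theta>))\<^sup>2" by (intro power_mono) auto
  then show ?thesis using \<theta> \<gamma> by simp
qed

lemma block_avg_P_bounds:
  assumes "Z \<subseteq> {1..n}" "Z \<noteq> {}" "\<omega> \<in> J d"
  shows "\<theta> \<le> Pbar Z s \<omega>" "Pbar Z s \<omega> \<le> \<gamma> * \<theta>"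
proof -
  have "\<theta> \<le> P (z i) \<omega>' \<and> P (z i) \<omega>' \<le> \<gamma> * \<theta>" if "i \<in> Z" "\<omega>' \<in> J d" for i \<omega>'
    using P_bounds[OF z_in[OF subsetD[OF assms(1) that(1)]] that(2)] by simp
  then show "\<theta> \<le> Pbar Z s \<omega>" "Pbar Z s \<omega> \<le> \<gamma> * \<theta>"
    using assms finite_subset[OF assms(1)]
    by (intro block_avg_bounds[where a = \<theta> and b = "\<gamma> * \<theta>"]; simp)+
qed

lemma block_avg_bias:
  assumes "near \<eta> m Z s" and m: "m \<in> {1, 2}" and \<eta>: "0 \<le> \<eta>" "\<eta> \<le> 1"
  shows "hellinger d (Pbar Z s) (P m)
    \<le> bias_bound \<eta>"
proof -
  have Z: "Z \<subseteq> {1..n}" "Z \<noteq> {}" "real n / (4 * \<alpha>) \<le> real (card Z)"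
      "real (card {i \<in> Z. z i \<noteq> m}) \<le> \<eta> * real n"
    and s: "\<And>j. j \<in> {1..d} \<Longrightarrow> s j \<in> {1..K}"
      "real (card {j \<in> {1..d}. s j \<noteq> \<sigma> m j}) \<le> \<eta> * real d"
    using assms(1) by (auto simp: near_def)
  have fZ: "finite Z" using Z(1) by (rule finite_subset) auto
  have N: "0 < real (card Z)" using fZ Z(2) by (simp add: card_gt_0_iff)
  define Q where "Q = Pbar Z s"
  \<comment> \<open>The same block average with every layer given the mean of class
    \<open>m\<close>. Passing from \<open>Q\<close> to \<open>R\<close> isolates the effect of wrong
    layers, passing from \<open>R\<close> to \<open>P m\<close> that of wrong nodes.\<close>
  define R where "R = block_avg d Z s (\<lambda>_. P m)"
  have QR: "(Q \<omega> - R \<omega>)\<^sup>2 \<le> (4 * \<alpha> * \<eta> * \<gamma> * \<theta>)\<^sup>2" if \<omega>: "\<omega> \<in> J d" for \<omega>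
  proof -
    define c where "c = real (card (cell d s \<omega>))"
    have c: "0 < c" using card_cell_pos[OF \<omega>] by (simp add: c_def)
    have QR_eq: "\<bar>Q \<omega> - R \<omega>\<bar> = \<bar>\<Sum>i\<in>Z. \<Sum>\<omega>'\<in>cell d s \<omega>. P (z i) \<omega>' - P m \<omega>'\<bar> / (real (card Z) * c)"
      using N c unfolding Q_def R_def block_avg_def c_def[symmetric]
      by (simp only: sum_subtractf diff_divide_distrib[symmetric]) simp
    have "\<bar>\<Sum>i\<in>Z. \<Sum>\<omega>'\<in>cell d s \<omega>. P (z i) \<omega>' - P m \<omega>'\<bar>
       \<le> (\<Sum>i\<in>Z. \<Sum>\<omega>'\<in>cell d s \<omega>. \<bar>P (z i) \<omega>' - P m \<omega>'\<bar>)"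
      by (intro order_trans[OF sum_abs] sum_mono sum_abs)
    also have "\<dots> \<le> (\<Sum>i\<in>Z. if z i \<noteq> m then c * (\<gamma> * \<theta>) else 0)"
    proof (rule sum_mono)
      fix i assume i: "i \<in> Z"
      show "(\<Sum>\<omega>'\<in>cell d s \<omega>. \<bar>P (z i) \<omega>' - P m \<omega>'\<bar>) \<le> (if z i \<noteq> m then c * (\<gamma> * \<theta>) else 0)"
      proof (cases "z i = m")
        case False
        have "(\<Sum>\<omega>'\<in>cell d s \<omega>. \<bar>P (z i) \<omega>' - P m \<omega>'\<bar>) \<le> (\<Sum>\<omega>'\<in>cell d s \<omega>. \<gamma> * \<theta>)"
        proof (rule sum_mono)
          fix \<omega>' assume "\<omega>' \<in> cell d s \<omega>"
          then have \<omega>': "\<omega>' \<in> J d" by (rule subsetD[OF cell_subset])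
          have zi: "z i \<in> {1, 2}" by (rule z_in[OF subsetD[OF Z(1) i]])
          have "\<theta> \<le> P m \<omega>'" "P m \<omega>' \<le> \<gamma> * \<theta>" by (rule P_bounds[OF m \<omega>'])+
          moreover have "\<theta> \<le> P (z i) \<omega>'" "P (z i) \<omega>' \<le> \<gamma> * \<theta>" by (rule P_bounds[OF zi \<omega>'])+
          ultimately show "\<bar>P (z i) \<omega>' - P m \<omega>'\<bar> \<le> \<gamma> * \<theta>"
            using \<theta> unfolding abs_le_iff by linarith
        qed
        then show ?thesis using False by (simp add: c_def)
      qed simp
    qed
    also have "\<dots> = real (card {i \<in> Z. z i \<noteq> m}) * (c * (\<gamma> * \<theta>))"
      using fZ by (simp add: sum.If_cases Int_def)
    also have "\<dots> \<le> \<eta> * real n * (c * (\<gamma> * \<theta>))"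
      using Z(4) c \<gamma> \<theta> by (intro mult_right_mono) auto
    finally have "\<bar>Q \<omega> - R \<omega>\<bar> \<le> \<eta> * real n * (c * (\<gamma> * \<theta>)) / (real (card Z) * c)"
      unfolding QR_eq using N c by (intro divide_right_mono) auto
    also have "\<dots> = \<eta> * \<gamma> * \<theta> * (real n / real (card Z))"
      using c by simp
    also have "\<dots> \<le> \<eta> * \<gamma> * \<theta> * (4 * \<alpha>)"
      using Z(3) N \<alpha> \<eta> \<gamma> \<theta> by (intro mult_left_mono) (auto simp: field_simps)
    finally have "\<bar>Q \<omega> - R \<omega>\<bar> \<le> 4 * \<alpha> * \<eta> * \<gamma> * \<theta>" by (simp add: mult_ac)
    then show ?thesis by (simp add: abs_le_square_iff[symmetric])
  qed
  \<comment> \<open>\<open>B m\<close> at the labels \<open>s\<close> is constant on blocks, hence a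
    competitor of \<open>R\<close>, and it differs from \<open>P m\<close> only at pairs with an
    endpoint in \<open>D\<close>.\<close>
  define D where "D = {j \<in> {1..d}. s j \<noteq> \<sigma> m j}"
  have "(\<Sum>\<omega>\<in>J d. (R \<omega> - P m \<omega>)\<^sup>2) \<le> (\<Sum>\<omega>\<in>J d. (case_prod (B m) (key s \<omega>) - P m \<omega>)\<^sup>2)"
    unfolding R_def using fZ Z(2) by (rule sum_J_block_avg_best)
  also have "\<dots> \<le> (\<Sum>\<omega>\<in>J d. if fst \<omega> \<in> D \<or> snd \<omega> \<in> D then (\<gamma> * \<theta>)\<^sup>2 else 0)"
  proof (rule sum_mono)
    fix \<omega> assume \<omega>: "\<omega> \<in> J d"
    then have i: "fst \<omega> \<in> {1..d}" "snd \<omega> \<in> {1..d}" by (auto simp: J_def)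
    have b: "\<theta> \<le> B m (s (fst \<omega>)) (s (snd \<omega>))" "B m (s (fst \<omega>)) (s (snd \<omega>)) \<le> \<gamma> * \<theta>"
      by (intro B_bounds m s(1) i)+
    have p: "\<theta> \<le> P m \<omega>" "P m \<omega> \<le> \<gamma> * \<theta>" by (rule P_bounds[OF m \<omega>])+
    have "\<bar>B m (s (fst \<omega>)) (s (snd \<omega>)) - P m \<omega>\<bar> \<le> \<gamma> * \<theta>"
      using b p \<theta> unfolding abs_le_iff by linarith
    also have "\<dots> \<le> \<bar>\<gamma> * \<theta>\<bar>" by (rule abs_ge_self)
    finally have "\<bar>B m (s (fst \<omega>)) (s (snd \<omega>)) - P m \<omega>\<bar> \<le> \<bar>\<gamma> * \<theta>\<bar>" .
    then have "(B m (s (fst \<omega>)) (s (snd \<omega>)) - P m \<omega>)\<^sup>2 \<le> (\<gamma> * \<theta>)\<^sup>2"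
      by (simp add: abs_le_square_iff)
    then show "(case_prod (B m) (key s \<omega>) - P m \<omega>)\<^sup>2
      \<le> (if fst \<omega> \<in> D \<or> snd \<omega> \<in> D then (\<gamma> * \<theta>)\<^sup>2 else 0)"
      using i by (auto simp: key_def D_def P_def mean_def)
  qed
  also have "\<dots> = real (card {\<omega> \<in> J d. fst \<omega> \<in> D \<or> snd \<omega> \<in> D}) * (\<gamma> * \<theta>)\<^sup>2"
    by (simp add: sum.If_cases Int_def)
  also have "\<dots> \<le> (2 * real d * real (card D)) * (\<gamma> * \<theta>)\<^sup>2"
    by (intro mult_right_mono card_J_endpoint_le) (auto simp: D_def)
  also have "\<dots> \<le> (2 * real d * (\<eta> * real d)) * (\<gamma> * \<theta>)\<^sup>2"
    using s(2) by (intro mult_right_mono mult_left_mono) (auto simp: D_def)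
  finally have RP: "(\<Sum>\<omega>\<in>J d. (R \<omega> - P m \<omega>)\<^sup>2) \<le> 2 * (real d)\<^sup>2 * \<eta> * (\<gamma> * \<theta>)\<^sup>2"
    by (simp add: power2_eq_square mult_ac)
  have "hellinger d Q (P m) \<le> (\<Sum>\<omega>\<in>J d. (Q \<omega> - P m \<omega>)\<^sup>2 / \<theta>)"
  proof (intro sum_mono sqrt_diff_square_le)
    fix \<omega> assume \<omega>: "\<omega> \<in> J d"
    show "0 \<le> Q \<omega>" using block_avg_P_bounds(1)[OF Z(1,2) \<omega>, of s] \<theta> by (simp add: Q_def)
    show "\<theta> \<le> P m \<omega>" using P_bounds m \<omega> by auto
  qed (rule \<theta>)
  also have "\<dots> \<le> (\<Sum>\<omega>\<in>J d. (2 * (Q \<omega> - R \<omega>)\<^sup>2 + 2 * (R \<omega> - P m \<omega>)\<^sup>2) / \<theta>)"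
  proof (intro sum_mono divide_right_mono)
    fix \<omega>
    show "(Q \<omega> - P m \<omega>)\<^sup>2 \<le> 2 * (Q \<omega> - R \<omega>)\<^sup>2 + 2 * (R \<omega> - P m \<omega>)\<^sup>2"
      using zero_le_power2[of "(Q \<omega> - R \<omega>) - (R \<omega> - P m \<omega>)"]
      by (simp add: power2_eq_square algebra_simps)
  qed (use \<theta> in auto)
  also have "\<dots> = (2 * (\<Sum>\<omega>\<in>J d. (Q \<omega> - R \<omega>)\<^sup>2) + 2 * (\<Sum>\<omega>\<in>J d. (R \<omega> - P m \<omega>)\<^sup>2)) / \<theta>"
    by (simp add: sum.distrib sum_divide_distrib[symmetric] sum_distrib_left)
  also have "\<dots> \<le> (2 * ((real d)\<^sup>2 * (4 * \<alpha> * \<eta> * \<gamma> * \<theta>)\<^sup>2) + 2 * (2 * (real d)\<^sup>2 * \<eta> * (\<gamma> * \<theta>)\<^sup>2)) / \<theta>"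
  proof (intro divide_right_mono add_mono mult_left_mono RP)
    have "(\<Sum>\<omega>\<in>J d. (Q \<omega> - R \<omega>)\<^sup>2) \<le> (\<Sum>\<omega>\<in>J d. (4 * \<alpha> * \<eta> * \<gamma> * \<theta>)\<^sup>2)"
      using QR by (rule sum_mono)
    also have "\<dots> \<le> (real d)\<^sup>2 * (4 * \<alpha> * \<eta> * \<gamma> * \<theta>)\<^sup>2"
      using card_J_le[of d] by (simp add: mult_right_mono)
    finally show "(\<Sum>\<omega>\<in>J d. (Q \<omega> - R \<omega>)\<^sup>2) \<le> (real d)\<^sup>2 * (4 * \<alpha> * \<eta> * \<gamma> * \<theta>)\<^sup>2" .
  qed (use \<theta> in auto)
  also have "\<dots> = (32 * \<alpha>\<^sup>2 * \<eta> + 4) * (\<gamma>\<^sup>2 * \<theta> * (real d)\<^sup>2 * \<eta>)"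
    using \<theta> by (simp add: power2_eq_square field_simps)
  \<comment> \<open>Since \<eta> <= 1, the contribution of order \<eta>^2 from wrong layers is
    absorbed into the linear one.\<close>
  also have "\<dots> \<le> (32 * \<alpha>\<^sup>2 + 4) * (\<gamma>\<^sup>2 * \<theta> * (real d)\<^sup>2 * \<eta>)"
    using \<eta> \<theta> by (intro mult_right_mono add_mono mult_left_le) auto
  finally show ?thesis by (simp add: Q_def mult_ac)
qed

end

section \<open>The plug-in likelihood ratio\<close>

lemma exp_mult_le_convex:
  fixes u x :: real
  assumes "0 \<le> u" "u \<le> 1"
  shows "exp (u * x) \<le> 1 + u * (exp x - 1)"
proof -
  have "exp ((1 - u) *\<^sub>R 0 + u *\<^sub>R x) \<le> (1 - u) * exp 0 + u * exp x"
    using assms by (intro convex_onD[OF exp_convex]) auto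
  then show ?thesis by (simp add: algebra_simps)
qed

text \<open>
  The left-hand side is the exponent of the Chernoff bound at \<open>l\<close> for the plug-in rates \<open>Qa, Qb\<close>
  under the true rate \<open>Pa\<close>.  At \<open>l = 1/2\<close> and \<open>Q = P\<close> it is minus half the squared Hellinger
  distance; smaller \<open>l\<close> are reduced to this case by convexity.
\<close>

lemma plug_in_exponent_le:
  fixes Qa Qb Pa Pb \<theta> \<gamma> l \<kappa> :: real
  assumes \<theta>: "0 < \<theta>" and \<gamma>: "1 \<le> \<gamma>" and Q: "\<theta> / 4 \<le> Qa" "\<theta> / 4 \<le> Qb"
    and P: "\<theta> \<le> Pa" "Pa \<le> \<gamma> * \<theta>" "\<theta> \<le> Pb"
    and l: "0 < l" "l \<le> 1 / 2" and \<kappa>: "0 < \<kappa>" "\<kappa> \<le> 1 / 2"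
  shows "l * (Qa - Qb) + Pa * (exp (l * (ln Qb - ln Qa)) - 1)
    \<le> 2 * l * (- (1 / 2) * (1 - 2 * \<kappa>) * (sqrt Pa - sqrt Pb)\<^sup>2
        + 6 * \<gamma>\<^sup>2 / \<kappa> * ((sqrt Qa - sqrt Pa)\<^sup>2 + (sqrt Qb - sqrt Pb)\<^sup>2))"
proof -
  define a b p q where "a = sqrt Qa" and "b = sqrt Qb" and "p = sqrt Pa" and "q = sqrt Pb"
  have pos: "0 < Qa" "0 < Qb" "0 < Pa" "0 < Pb" using assms by auto
  then have pos': "0 < a" "0 < b" "0 < p" "0 < q" by (auto simp: a_def b_def p_def q_def)
  have sq: "a\<^sup>2 = Qa" "b\<^sup>2 = Qb" "p\<^sup>2 = Pa" "q\<^sup>2 = Pb"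
    using pos by (auto simp: a_def b_def p_def q_def)
  have "l * (ln Qb - ln Qa) = 2 * l * ln (b / a)"
    using pos' by (simp add: sq[symmetric] ln_div ln_realpow algebra_simps)
  \<comment> \<open>Convexity with 2 l <= 1 reduces every \<open>l\<close> to the exponent 1/2,
    where the exponential is just b / a.\<close>
  then have "exp (l * (ln Qb - ln Qa)) - 1 \<le> 2 * l * (b / a - 1)"
    using exp_mult_le_convex[of "2 * l" "ln (b / a)"] l pos' by (simp only: exp_ln divide_pos_pos) simp
  then have "l * (Qa - Qb) + Pa * (exp (l * (ln Qb - ln Qa)) - 1)
      \<le> l * (Qa - Qb) + Pa * (2 * l * (b / a - 1))"
    using pos by (intro add_left_mono mult_left_mono) auto
  also have "\<dots> = 2 * l * (- (1 / 2) * (a - b)\<^sup>2 + (p\<^sup>2 - a\<^sup>2) / a * (b - a))"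
    using pos' unfolding sq[symmetric] by (simp add: field_simps power2_eq_square)
  also have "\<dots> \<le> 2 * l * (- (1 / 2) * (1 - 2 * \<kappa>) * (p - q)\<^sup>2 + 6 * \<gamma>\<^sup>2 / \<kappa> * ((a - p)\<^sup>2 + (b - q)\<^sup>2))"
  proof (intro mult_left_mono)
    \<comment> \<open>The cross term u (b - a) vanishes if the plug-in rate \<open>Qa\<close> is the
      true one. Young's inequality trades it for a fraction \<kappa> of (a - b)^2 and a multiple of
      (a - p)^2.\<close>
    define u where "u = (p\<^sup>2 - a\<^sup>2) / a"
    define e where "e = (a - p) - (b - q)"
    \<comment> \<open>Here the bound \<theta> / 4 on \<open>Qa\<close> is decisive: without it p /
      a, and with it the ratio of u to p - a, would be unbounded.\<close>
    have "p / a = sqrt (Pa / Qa)" by (simp add: p_def a_def real_sqrt_divide)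
    also have "\<dots> \<le> sqrt ((2 * \<gamma>)\<^sup>2)"
    proof (intro real_sqrt_le_mono)
      have "Pa / Qa \<le> \<gamma> * \<theta> / (\<theta> / 4)" using P Q \<theta> \<gamma> by (intro frac_le) auto
      also have "\<dots> = 4 * \<gamma>" using \<theta> by simp
      also have "\<dots> \<le> (2 * \<gamma>)\<^sup>2" using \<gamma> by (simp add: power2_eq_square)
      finally show "Pa / Qa \<le> (2 * \<gamma>)\<^sup>2" .
    qed
    finally have "p / a \<le> 2 * \<gamma>" using \<gamma> unfolding real_sqrt_abs by linarith
    then have r: "0 \<le> 1 + p / a" "1 + p / a \<le> 3 * \<gamma>" using \<gamma> pos' by auto
    have "u = (p - a) * (1 + p / a)"
      using pos' by (simp add: u_def field_simps power2_eq_square)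
    then have "u\<^sup>2 = (1 + p / a)\<^sup>2 * (a - p)\<^sup>2" by (simp add: power_mult_distrib power2_commute)
    also have "\<dots> \<le> (3 * \<gamma>)\<^sup>2 * (a - p)\<^sup>2"
      using r by (intro mult_right_mono power_mono) auto
    finally have u2: "u\<^sup>2 \<le> 9 * \<gamma>\<^sup>2 * (a - p)\<^sup>2" by (simp add: power_mult_distrib)
    have "0 \<le> (\<kappa> * (b - a) - u)\<^sup>2" by simp
    then have "2 * \<kappa> * (u * (b - a)) \<le> \<kappa>\<^sup>2 * (b - a)\<^sup>2 + u\<^sup>2"
      by (simp add: power2_eq_square algebra_simps)
    then have cross: "u * (b - a) \<le> \<kappa> / 2 * (a - b)\<^sup>2 + u\<^sup>2 / (2 * \<kappa>)"
      using \<kappa> by (simp add: field_simps power2_eq_square)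
    have "(p - q)\<^sup>2 * (1 - \<kappa>) - e\<^sup>2 / \<kappa> \<le> (a - b)\<^sup>2"
    proof -
      have ab: "a - b = (p - q) + e" by (simp add: e_def)
      have "(\<kappa> * (p - q) + e)\<^sup>2 / \<kappa> + e\<^sup>2 \<ge> 0" using \<kappa> by simp
      also have "(\<kappa> * (p - q) + e)\<^sup>2 / \<kappa> + e\<^sup>2 = (a - b)\<^sup>2 - ((p - q)\<^sup>2 * (1 - \<kappa>) - e\<^sup>2 / \<kappa>)"
        unfolding ab using \<kappa> by (simp add: field_simps power2_eq_square)
      finally show ?thesis by simp
    qed
    then have "(1 - \<kappa>) * ((p - q)\<^sup>2 * (1 - \<kappa>) - e\<^sup>2 / \<kappa>) \<le> (1 - \<kappa>) * (a - b)\<^sup>2"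
      using \<kappa> by (intro mult_left_mono) auto
    moreover have "(1 - 2 * \<kappa>) * (p - q)\<^sup>2 - e\<^sup>2 / \<kappa> \<le> (1 - \<kappa>) * ((p - q)\<^sup>2 * (1 - \<kappa>) - e\<^sup>2 / \<kappa>)"
    proof -
      define D E where "D = (p - q)\<^sup>2" and "E = e\<^sup>2 / \<kappa>"
      have "0 \<le> \<kappa>\<^sup>2 * D + \<kappa> * E" using \<kappa> by (simp add: D_def E_def)
      then show ?thesis unfolding D_def[symmetric] E_def[symmetric]
        by (simp add: power2_eq_square algebra_simps)
    qed
    \<comment> \<open>Two losses of \<kappa> each, from the cross term and from replacing (a - b)^2
      by (p - q)^2, add up to 2 \<kappa> because (1 - \<kappa>)^2 >= 1 - 2 \<kappa>.\<close>
    ultimately have main: "(1 - 2 * \<kappa>) * (p - q)\<^sup>2 - e\<^sup>2 / \<kappa> \<le> (1 - \<kappa>) * (a - b)\<^sup>2" by linarith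
    have "e\<^sup>2 \<le> 2 * ((a - p)\<^sup>2 + (b - q)\<^sup>2)"
      using zero_le_power2[of "(a - p) + (b - q)"] by (simp add: e_def power2_eq_square algebra_simps)
    then have "e\<^sup>2 / \<kappa> \<le> 2 * ((a - p)\<^sup>2 + (b - q)\<^sup>2) / \<kappa>" using \<kappa> by (intro divide_right_mono) auto
    then have e2: "e\<^sup>2 / \<kappa> \<le> 2 * (((a - p)\<^sup>2 + (b - q)\<^sup>2) / \<kappa>)" by simp
    have u3: "u\<^sup>2 / (2 * \<kappa>) \<le> 9 * \<gamma>\<^sup>2 * (a - p)\<^sup>2 / (2 * \<kappa>)" using u2 \<kappa> by (intro divide_right_mono) auto
    have "((a - p)\<^sup>2 + (b - q)\<^sup>2) / \<kappa> + 9 * \<gamma>\<^sup>2 * (a - p)\<^sup>2 / (2 * \<kappa>)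
       \<le> \<gamma>\<^sup>2 * ((a - p)\<^sup>2 + (b - q)\<^sup>2) / \<kappa> + 5 * \<gamma>\<^sup>2 * ((a - p)\<^sup>2 + (b - q)\<^sup>2) / \<kappa>"
    proof (intro add_mono)
      have "1 * ((a - p)\<^sup>2 + (b - q)\<^sup>2) \<le> \<gamma>\<^sup>2 * ((a - p)\<^sup>2 + (b - q)\<^sup>2)"
        using \<gamma> by (intro mult_right_mono) auto
      then show "((a - p)\<^sup>2 + (b - q)\<^sup>2) / \<kappa> \<le> \<gamma>\<^sup>2 * ((a - p)\<^sup>2 + (b - q)\<^sup>2) / \<kappa>"
        using \<kappa> by (intro divide_right_mono) auto
      have "9 * \<gamma>\<^sup>2 * (a - p)\<^sup>2 \<le> 10 * \<gamma>\<^sup>2 * ((a - p)\<^sup>2 + (b - q)\<^sup>2)"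
        by (intro mult_mono) auto
      then show "9 * \<gamma>\<^sup>2 * (a - p)\<^sup>2 / (2 * \<kappa>) \<le> 5 * \<gamma>\<^sup>2 * ((a - p)\<^sup>2 + (b - q)\<^sup>2) / \<kappa>"
        using \<kappa> by (simp add: field_simps)
    qed
    also have "\<dots> = 6 * \<gamma>\<^sup>2 / \<kappa> * ((a - p)\<^sup>2 + (b - q)\<^sup>2)" using \<kappa> by (simp add: field_simps)
    finally have coef: "((a - p)\<^sup>2 + (b - q)\<^sup>2) / \<kappa> + 9 * \<gamma>\<^sup>2 * (a - p)\<^sup>2 / (2 * \<kappa>)
        \<le> 6 * \<gamma>\<^sup>2 / \<kappa> * ((a - p)\<^sup>2 + (b - q)\<^sup>2)" .
    have "- (1 / 2) * (a - b)\<^sup>2 + u * (b - a) \<le> - (1 / 2) * ((1 - \<kappa>) * (a - b)\<^sup>2) + u\<^sup>2 / (2 * \<kappa>)"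
      using cross by (simp add: algebra_simps)
    also have "\<dots> \<le> - (1 / 2) * ((1 - 2 * \<kappa>) * (p - q)\<^sup>2 - e\<^sup>2 / \<kappa>) + 9 * \<gamma>\<^sup>2 * (a - p)\<^sup>2 / (2 * \<kappa>)"
    proof -
      have "- (1 / 2) * s + t \<le> - (1 / 2) * s' + t'" if "s' \<le> s" "t \<le> t'" for s t s' t' :: real
        using that by linarith
      from this[OF main u3] show ?thesis .
    qed
    also have "\<dots> \<le> - (1 / 2) * (1 - 2 * \<kappa>) * (p - q)\<^sup>2
        + (((a - p)\<^sup>2 + (b - q)\<^sup>2) / \<kappa> + 9 * \<gamma>\<^sup>2 * (a - p)\<^sup>2 / (2 * \<kappa>))"
    proof -
      have "- (1 / 2) * (h * D - E) + W \<le> - (1 / 2) * h * D + (F + W)" if "E \<le> 2 * F"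
        for h D E F W :: real
        using that by (simp add: field_simps)
      from this[OF e2] show ?thesis .
    qed
    finally show "- (1 / 2) * (a - b)\<^sup>2 + (p\<^sup>2 - a\<^sup>2) / a * (b - a)
      \<le> - (1 / 2) * (1 - 2 * \<kappa>) * (p - q)\<^sup>2 + 6 * \<gamma>\<^sup>2 / \<kappa> * ((a - p)\<^sup>2 + (b - q)\<^sup>2)"
      using coef unfolding u_def by linarith
  qed (use l in auto)
  finally show ?thesis by (simp add: a_def b_def p_def q_def)
qed

lemma sqrt_square_diff_le_2:
  fixes a b :: real
  assumes "0 \<le> a" "0 \<le> b"
  shows "a \<le> 2 * (sqrt a - sqrt b)\<^sup>2 + 2 * b"
proof -
  have "(sqrt a)\<^sup>2 \<le> 2 * (sqrt a - sqrt b)\<^sup>2 + 2 * (sqrt b)\<^sup>2"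
    using zero_le_power2[of "sqrt a - 2 * sqrt b"] by (simp only: power2_eq_square algebra_simps)
  then show ?thesis using assms by simp
qed

section \<open>Bounds on the Chernoff exponent, with and without low estimates\<close>

context block_model
begin

text \<open>At such an entry the square root of the estimate is at least sqrt \<theta> / 2 below
  that of any true mean, so each one uses up \<theta> / 4 of the Hellinger budget.\<close>

abbreviation "low Q \<equiv> {\<omega> \<in> J d. Q \<omega> < \<theta> / 4}"

abbreviation "log_range \<tau> \<equiv> ln (real n * (real d)\<^sup>2 * (1 + (2 * \<tau> + 2 * \<gamma> * \<theta>)))"


text \<open>Counts are integers: a nonzero block total is at least 1, so a nonzero average is at
  least 1 / (n d^2). The range of logarithms is therefore finite even for very low
  estimates.\<close>

lemma abs_ln_block_avg_le:
  fixes x :: layers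
  assumes "near \<eta> m Z s" "\<omega> \<in> J d" and le: "block_avg d Z s (counts x) \<omega> \<le> c" and "0 \<le> c"
  shows "\<bar>ln (block_avg d Z s (counts x) \<omega>)\<bar> \<le> ln (real n * (real d)\<^sup>2 * (1 + c))"
proof -
  define T where "T = (\<Sum>i\<in>Z. \<Sum>\<omega>'\<in>cell d s \<omega>. x i \<omega>')"
  define c' where "c' = card Z * card (cell d s \<omega>)"
  define Q where "Q = block_avg d Z s (counts x) \<omega>"
  have Z: "Z \<subseteq> {1..n}" "Z \<noteq> {}" using assms(1) by (auto simp: near_def)
  have fZ: "finite Z" using Z(1) by (rule finite_subset) auto
  have c1: "1 \<le> real c'"
  proof -
    have "0 < c'" using card_cell_pos[OF assms(2), of s] fZ Z(2) by (simp add: c'_def card_gt_0_iff)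
    then show ?thesis by linarith
  qed
  have "c' \<le> n * d\<^sup>2"
  proof -
    have "card Z \<le> n" using card_mono[OF _ Z(1)] by simp
    moreover have "card (cell d s \<omega>) \<le> d\<^sup>2"
      using card_mono[OF _ cell_subset, of d s \<omega>] card_J_le[of d]
      by (metis finite_J le_trans of_nat_le_iff of_nat_power)
    ultimately show ?thesis unfolding c'_def by (intro mult_le_mono)
  qed
  then have c2: "real c' \<le> real n * (real d)\<^sup>2"
    by (metis of_nat_le_iff of_nat_mult of_nat_power)
  have Q: "Q = real T / real c'" by (simp add: Q_def block_avg_def T_def c'_def)
  have big: "1 \<le> real n * (real d)\<^sup>2" "1 \<le> real n * (real d)\<^sup>2 * (1 + c)"
    using c1 c2 \<open>0 \<le> c\<close> by (auto intro: order_trans[OF _ mult_mono[of 1 _ 1]])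
  show ?thesis
  proof (cases "T = 0")
    \<comment> \<open>A vanishing average has logarithm 0 by the convention on which
      \<open>loglik\<close> relies too.\<close>
    case True
    then show ?thesis using big Q unfolding Q_def by simp
  next
    case False
    then have "1 \<le> real T" by simp
    then have "1 / (real n * (real d)\<^sup>2) \<le> Q" unfolding Q using c1 c2 by (intro frac_le) auto
    moreover have "1 / (real n * (real d)\<^sup>2 * (1 + c)) \<le> 1 / (real n * (real d)\<^sup>2)"
      using big \<open>0 \<le> c\<close> by (intro divide_left_mono) (auto simp: mult_le_cancel_left1)
    ultimately have lo: "1 / (real n * (real d)\<^sup>2 * (1 + c)) \<le> Q" by linarith
    have Qpos: "0 < Q" using Q \<open>1 \<le> real T\<close> c1 by simp
    have "Q \<le> 1 * (1 + c)" using le by (simp add: Q_def)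
    also have "\<dots> \<le> real n * (real d)\<^sup>2 * (1 + c)" using big \<open>0 \<le> c\<close> by (intro mult_right_mono) auto
    finally have "ln Q \<le> ln (real n * (real d)\<^sup>2 * (1 + c))" using Qpos big by simp
    moreover have "ln (1 / (real n * (real d)\<^sup>2 * (1 + c))) \<le> ln Q"
      using lo big Qpos by (subst ln_le_cancel_iff) auto
    then have "- ln (real n * (real d)\<^sup>2 * (1 + c)) \<le> ln Q"
      using big by (auto simp: ln_div split: if_splits)
    ultimately show ?thesis by (simp add: Q_def)
  qed
qed

text \<open>Dividing by |Z| >= n / (4 \<alpha>) turns the deviation into a Hellinger distance of at
  most \<tau> from the block average of the true means. Adding the bias gives the distance to the
  truth; the budget argument bounds the low entries; and the estimates stay summable over any set
  \<open>L\<close>, which controls them where the pointwise estimate fails.\<close>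

lemma sum_hellinger_block_avg_le:
  assumes near: "near \<eta> m Z s" and m: "m \<in> {1, 2}" and \<eta>: "0 \<le> \<eta>" "\<eta> \<le> 1"
    and Q: "\<And>\<omega>. 0 \<le> Q \<omega>" and x: "0 \<le> x"
    and lt: "deviation Z s Q < x"
  defines "\<tau> \<equiv> 4 * \<alpha> * x / real n"
  shows "hellinger d Q (P m)
      \<le> 2 * \<tau> + 2 * bias_bound \<eta>"
    and "\<theta> * real (card (low Q)) \<le> 4 * \<tau>"
    and "\<And>L. L \<subseteq> J d \<Longrightarrow> (\<Sum>\<omega>\<in>L. Q \<omega>) \<le> 2 * \<tau> + 2 * \<gamma> * \<theta> * real (card L)"
    and "\<And>\<omega>. \<omega> \<in> J d \<Longrightarrow> Q \<omega> \<le> 2 * \<tau> + 2 * \<gamma> * \<theta>"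
proof -
  define R where "R = Pbar Z s"
  have Z: "Z \<subseteq> {1..n}" "Z \<noteq> {}" "real n / (4 * \<alpha>) \<le> real (card Z)"
    using near by (auto simp: near_def)
  have N: "0 < real n / (4 * \<alpha>)" using n \<alpha> by simp
  define S where "S = hellinger d Q R"
  have S0: "0 \<le> S" unfolding S_def by (intro sum_nonneg) auto
  have "real n / (4 * \<alpha>) * S \<le> real (card Z) * S" using Z(3) S0 by (rule mult_right_mono)
  also have "\<dots> \<le> x" using lt by (simp add: S_def R_def)
  finally have S: "S \<le> \<tau>" using N n \<alpha> by (simp add: \<tau>_def field_simps)
  have R: "\<theta> \<le> R \<omega>" "R \<omega> \<le> \<gamma> * \<theta>" if "\<omega> \<in> J d" for \<omega>
    unfolding R_def using block_avg_P_bounds[OF Z(1,2) that] by auto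
  have "hellinger d Q (P m)
      \<le> (\<Sum>\<omega>\<in>J d. 2 * (sqrt (Q \<omega>) - sqrt (R \<omega>))\<^sup>2 + 2 * (sqrt (R \<omega>) - sqrt (P m \<omega>))\<^sup>2)"
  proof (rule sum_mono)
    fix \<omega>
    show "(sqrt (Q \<omega>) - sqrt (P m \<omega>))\<^sup>2
        \<le> 2 * (sqrt (Q \<omega>) - sqrt (R \<omega>))\<^sup>2 + 2 * (sqrt (R \<omega>) - sqrt (P m \<omega>))\<^sup>2"
      using zero_le_power2[of "(sqrt (Q \<omega>) - sqrt (R \<omega>)) - (sqrt (R \<omega>) - sqrt (P m \<omega>))"]
      by (simp only: power2_eq_square algebra_simps)
  qed
  also have "\<dots> = 2 * S + 2 * hellinger d R (P m)"
    by (simp add: S_def sum.distrib sum_distrib_left)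
  finally show "hellinger d Q (P m)
      \<le> 2 * \<tau> + 2 * bias_bound \<eta>"
    using S block_avg_bias[OF near m \<eta>] unfolding R_def by linarith
  have "\<theta> / 4 * real (card (low Q)) = (\<Sum>\<omega>\<in>low Q. \<theta> / 4)"
    by simp
  also have "\<dots> \<le> (\<Sum>\<omega>\<in>low Q. (sqrt (Q \<omega>) - sqrt (R \<omega>))\<^sup>2)"
  proof (rule sum_mono)
    fix \<omega> assume "\<omega> \<in> low Q"
    then have \<omega>: "\<omega> \<in> J d" "Q \<omega> \<le> \<theta> / 4" by auto
    have "sqrt (Q \<omega>) \<le> sqrt \<theta> / 2"
      using real_sqrt_le_mono[OF \<omega>(2)] by (simp add: real_sqrt_divide)
    moreover have "sqrt \<theta> \<le> sqrt (R \<omega>)" using R(1)[OF \<omega>(1)] by (rule real_sqrt_le_mono)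
    ultimately have "sqrt \<theta> / 2 \<le> sqrt (R \<omega>) - sqrt (Q \<omega>)" by linarith
    then have "(sqrt \<theta> / 2)\<^sup>2 \<le> (sqrt (R \<omega>) - sqrt (Q \<omega>))\<^sup>2" using \<theta> by (intro power_mono) auto
    then show "\<theta> / 4 \<le> (sqrt (Q \<omega>) - sqrt (R \<omega>))\<^sup>2"
      using \<theta> by (simp add: power_divide power2_commute)
  qed
  also have "\<dots> \<le> S" unfolding S_def by (intro sum_mono2) auto
  finally show "\<theta> * real (card (low Q)) \<le> 4 * \<tau>" using S by linarith
  show sumL: "(\<Sum>\<omega>\<in>L. Q \<omega>) \<le> 2 * \<tau> + 2 * \<gamma> * \<theta> * real (card L)" if L: "L \<subseteq> J d" for L
  proof -
    have "(\<Sum>\<omega>\<in>L. Q \<omega>) \<le> (\<Sum>\<omega>\<in>L. 2 * (sqrt (Q \<omega>) - sqrt (R \<omega>))\<^sup>2 + 2 * (\<gamma> * \<theta>))"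
    proof (rule sum_mono)
      fix \<omega> assume "\<omega> \<in> L"
      then have \<omega>: "\<omega> \<in> J d" using L by auto
      have "Q \<omega> \<le> 2 * (sqrt (Q \<omega>) - sqrt (R \<omega>))\<^sup>2 + 2 * R \<omega>"
        using Q R(1)[OF \<omega>] \<theta> by (intro sqrt_square_diff_le_2) auto
      then show "Q \<omega> \<le> 2 * (sqrt (Q \<omega>) - sqrt (R \<omega>))\<^sup>2 + 2 * (\<gamma> * \<theta>)"
        using R(2)[OF \<omega>] by linarith
    qed
    also have "\<dots> = 2 * (\<Sum>\<omega>\<in>L. (sqrt (Q \<omega>) - sqrt (R \<omega>))\<^sup>2) + 2 * \<gamma> * \<theta> * real (card L)"
      by (simp add: sum.distrib sum_distrib_left)
    also have "(\<Sum>\<omega>\<in>L. (sqrt (Q \<omega>) - sqrt (R \<omega>))\<^sup>2) \<le> S"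
      unfolding S_def using L by (intro sum_mono2) auto
    finally show ?thesis using S by linarith
  qed
  show "Q \<omega> \<le> 2 * \<tau> + 2 * \<gamma> * \<theta>" if "\<omega> \<in> J d" for \<omega>
    using sumL[of "{\<omega>}"] that by simp
qed


lemma info_eq:
  assumes "a \<in> {1, 2}" "b \<in> {1, 2}" "a \<noteq> b"
  shows "info d B \<sigma> = hellinger d (P a) (P b)"
  using assms by (auto simp: info_def P_def power2_commute)

text \<open>Cumulant generating function at \<open>l\<close> of the plug-in log-likelihood of the
  wrong class minus that of class \<open>a\<close>, for a layer drawn from class
  \<open>a\<close>.\<close>

definition exponent :: "real \<Rightarrow> nat \<Rightarrow> (nat \<times> nat \<Rightarrow> real) \<Rightarrow> (nat \<times> nat \<Rightarrow> real) \<Rightarrow> real" where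
  "exponent l a Qa Qb =
     (\<Sum>\<omega>\<in>J d. l * (Qa \<omega> - Qb \<omega>) + P a \<omega> * (exp (l * (ln (Qb \<omega>) - ln (Qa \<omega>))) - 1))"

text \<open>Off \<open>L\<close> the pointwise estimate \<open>plug_in_exponent_le\<close> applies.
  On \<open>L\<close> the hypothesis keeps the exponential below e, so a low entry costs at most l
  times its estimate, 2 \<gamma> \<theta>, and the loss of at most \<gamma> \<theta> of
  information.\<close>

lemma exponent_le:
  assumes ab: "a \<in> {1, 2}" "b \<in> {1, 2}" "a \<noteq> b"
    and Q: "\<And>\<omega>. 0 \<le> Qa \<omega>" "\<And>\<omega>. 0 \<le> Qb \<omega>"
    and l: "0 < l" "l \<le> 1 / 2" and \<kappa>: "0 < \<kappa>" "\<kappa> \<le> 1 / 2"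
  defines "L \<equiv> low Qa \<union> low Qb"
  assumes ln: "\<And>\<omega>. \<omega> \<in> L \<Longrightarrow> l * \<bar>ln (Qb \<omega>) - ln (Qa \<omega>)\<bar> \<le> 1"
    and ea: "hellinger d Qa (P a) \<le> e"
    and eb: "hellinger d Qb (P b) \<le> e"
  shows "exponent l a Qa Qb
    \<le> 2 * l * (- (1 / 2) * (1 - 2 * \<kappa>) * (info d B \<sigma> - \<gamma> * \<theta> * real (card L)) + 12 * \<gamma>\<^sup>2 / \<kappa> * e)
      + l * (\<Sum>\<omega>\<in>L. Qa \<omega>) + 2 * \<gamma> * \<theta> * real (card L)"
proof -
  define D where "D \<omega> = (sqrt (P a \<omega>) - sqrt (P b \<omega>))\<^sup>2" for \<omega>
  define E where "E \<omega> = (sqrt (Qa \<omega>) - sqrt (P a \<omega>))\<^sup>2 + (sqrt (Qb \<omega>) - sqrt (P b \<omega>))\<^sup>2" for \<omega>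
  define \<psi> where "\<psi> \<omega> = l * (Qa \<omega> - Qb \<omega>) + P a \<omega> * (exp (l * (ln (Qb \<omega>) - ln (Qa \<omega>))) - 1)" for \<omega>
  define g where "g = 6 * \<gamma>\<^sup>2 / \<kappa>"
  define h where "h = (1 / 2) * (1 - 2 * \<kappa>)"
  have g0: "0 \<le> g" using \<kappa> by (simp add: g_def)
  have h0: "0 \<le> h" using \<kappa> by (simp add: h_def)
  have LJ: "L \<subseteq> J d" by (auto simp: L_def)
  have "(\<Sum>\<omega>\<in>J d - L. \<psi> \<omega>) \<le> (\<Sum>\<omega>\<in>J d - L. 2 * l * (- h * D \<omega> + g * E \<omega>))"
  proof (rule sum_mono)
    fix \<omega> assume "\<omega> \<in> J d - L"
    then have \<omega>: "\<omega> \<in> J d" "\<theta> / 4 \<le> Qa \<omega>" "\<theta> / 4 \<le> Qb \<omega>" by (auto simp: L_def)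
    show "\<psi> \<omega> \<le> 2 * l * (- h * D \<omega> + g * E \<omega>)"
      using plug_in_exponent_le[OF \<theta> \<gamma> \<omega>(2,3) P_bounds(1,2)[OF ab(1) \<omega>(1)] P_bounds(1)[OF ab(2) \<omega>(1)] l \<kappa>]
      by (simp only: \<psi>_def D_def E_def g_def h_def minus_mult_left[symmetric] mult.assoc)
  qed
  also have "\<dots> = 2 * l * (- h * (\<Sum>\<omega>\<in>J d - L. D \<omega>) + g * (\<Sum>\<omega>\<in>J d - L. E \<omega>))"
    by (simp only: sum_distrib_left[symmetric] sum.distrib)
  also have "\<dots> \<le> 2 * l * (- h * (info d B \<sigma> - \<gamma> * \<theta> * real (card L)) + g * (2 * e))"
  proof (rule mult_left_mono[OF add_mono])
    have "(\<Sum>\<omega>\<in>L. D \<omega>) \<le> (\<Sum>\<omega>\<in>L. \<gamma> * \<theta>)"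
    proof (rule sum_mono)
      fix \<omega> assume "\<omega> \<in> L"
      then have \<omega>: "\<omega> \<in> J d" using LJ by auto
      show "D \<omega> \<le> \<gamma> * \<theta>" unfolding D_def using ab(1,2) \<omega> by (rule sqrt_P_diff_le)
    qed
    moreover have "(\<Sum>\<omega>\<in>J d. D \<omega>) = (\<Sum>\<omega>\<in>J d - L. D \<omega>) + (\<Sum>\<omega>\<in>L. D \<omega>)"
      using LJ by (intro sum.subset_diff) auto
    ultimately have "info d B \<sigma> - \<gamma> * \<theta> * real (card L) \<le> (\<Sum>\<omega>\<in>J d - L. D \<omega>)"
      using info_eq[OF ab] unfolding D_def by (simp add: mult.commute)
    then show "- h * (\<Sum>\<omega>\<in>J d - L. D \<omega>) \<le> - h * (info d B \<sigma> - \<gamma> * \<theta> * real (card L))"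
      using h0 by (simp add: mult_left_mono)
    have "(\<Sum>\<omega>\<in>J d - L. E \<omega>) \<le> (\<Sum>\<omega>\<in>J d. E \<omega>)"
      by (intro sum_mono2) (auto simp: E_def)
    also have "\<dots> \<le> 2 * e" using ea eb by (simp add: E_def sum.distrib)
    finally show "g * (\<Sum>\<omega>\<in>J d - L. E \<omega>) \<le> g * (2 * e)"
      using g0 by (rule mult_left_mono)
  qed (use l in auto)
  finally have off: "(\<Sum>\<omega>\<in>J d - L. \<psi> \<omega>)
    \<le> 2 * l * (- h * (info d B \<sigma> - \<gamma> * \<theta> * real (card L)) + g * (2 * e))" .
  have "(\<Sum>\<omega>\<in>L. \<psi> \<omega>) \<le> (\<Sum>\<omega>\<in>L. l * Qa \<omega> + 2 * (\<gamma> * \<theta>))"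
  proof (rule sum_mono)
    fix \<omega> assume \<omega>: "\<omega> \<in> L"
    then have J: "\<omega> \<in> J d" using LJ by auto
    have "l * (ln (Qb \<omega>) - ln (Qa \<omega>)) \<le> l * \<bar>ln (Qb \<omega>) - ln (Qa \<omega>)\<bar>"
      using l by (intro mult_left_mono) auto
    then have "exp (l * (ln (Qb \<omega>) - ln (Qa \<omega>))) \<le> exp 1" using ln[OF \<omega>] by simp
    then have e: "exp (l * (ln (Qb \<omega>) - ln (Qa \<omega>))) - 1 \<le> 2" using exp_le by linarith
    have pa: "0 \<le> P a \<omega>" "P a \<omega> \<le> \<gamma> * \<theta>" using P_bounds[OF ab(1) J] \<theta> by auto
    have "P a \<omega> * (exp (l * (ln (Qb \<omega>) - ln (Qa \<omega>))) - 1) \<le> P a \<omega> * 2"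
      using e pa by (intro mult_left_mono) auto
    moreover have "0 \<le> l * Qb \<omega>" using Q l by simp
    ultimately show "\<psi> \<omega> \<le> l * Qa \<omega> + 2 * (\<gamma> * \<theta>)"
      unfolding \<psi>_def right_diff_distrib[of l] using pa by linarith
  qed
  also have "\<dots> = l * (\<Sum>\<omega>\<in>L. Qa \<omega>) + 2 * \<gamma> * \<theta> * real (card L)"
    by (simp add: sum.distrib sum_distrib_left)
  finally have on: "(\<Sum>\<omega>\<in>L. \<psi> \<omega>) \<le> l * (\<Sum>\<omega>\<in>L. Qa \<omega>) + 2 * \<gamma> * \<theta> * real (card L)" .
  have "exponent l a Qa Qb = (\<Sum>\<omega>\<in>J d - L. \<psi> \<omega>) + (\<Sum>\<omega>\<in>L. \<psi> \<omega>)"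
    unfolding exponent_def \<psi>_def[symmetric] using LJ by (intro sum.subset_diff) auto
  moreover have "g * (2 * e) = 12 * \<gamma>\<^sup>2 / \<kappa> * e" by (simp add: g_def)
  moreover have "- h * y = - (1 / 2) * (1 - 2 * \<kappa>) * y" for y by (simp add: h_def)
  ultimately show ?thesis using off on by (simp only:)
qed

lemma exponent_half_le:
  assumes ab: "a \<in> {1, 2}" "b \<in> {1, 2}" "a \<noteq> b"
    and near: "near \<eta> a Za sa" "near \<eta> b Zb sb" and \<eta>: "0 \<le> \<eta>" "\<eta> \<le> 1"
    and Q: "\<And>\<omega>. 0 \<le> Qa \<omega>" "\<And>\<omega>. 0 \<le> Qb \<omega>" and x: "0 \<le> x"
    and lta: "deviation Za sa Qa < x"
    and ltb: "deviation Zb sb Qb < x"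
    and \<kappa>: "0 < \<kappa>" "\<kappa> \<le> 1 / 2"
    and small: "16 * \<alpha> * x < \<theta> * real n"
  shows "exponent (1 / 2) a Qa Qb \<le> - (1 / 2) * (1 - 2 * \<kappa>) * info d B \<sigma>
    + 24 * \<gamma>\<^sup>2 / \<kappa> * (4 * \<alpha> * x / real n + bias_bound \<eta>)"
proof -
  note A = sum_hellinger_block_avg_le[OF near(1) ab(1) \<eta> Q(1) x lta]
  note B = sum_hellinger_block_avg_le[OF near(2) ab(2) \<eta> Q(2) x ltb]
  \<comment> \<open>The number of low entries is an integer, and \<theta> times it is at most 4
    \<tau> < \<theta>; so it is 0.\<close>
  have \<tau>: "4 * (4 * \<alpha> * x / real n) < \<theta>" using small n by (simp add: field_simps)
  have "low Q = {}" if "\<theta> * real (card (low Q)) \<le> 4 * (4 * \<alpha> * x / real n)" for Q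
  proof (rule ccontr)
    assume "low Q \<noteq> {}"
    then have "0 < card (low Q)" by (subst card_gt_0_iff) simp
    then have "\<theta> * 1 \<le> \<theta> * real (card (low Q))" using \<theta> by (intro mult_left_mono) linarith+
    then show False using that \<tau> by linarith
  qed
  from this[OF A(2)] this[OF B(2)] have L: "low Qa \<union> low Qb = {}" by blast
  have "exponent (1 / 2) a Qa Qb
    \<le> 2 * (1 / 2) * (- (1 / 2) * (1 - 2 * \<kappa>) * (info d B \<sigma> - \<gamma> * \<theta> * real (card ({} :: (nat \<times> nat) set)))
       + 12 * \<gamma>\<^sup>2 / \<kappa> * (2 * (4 * \<alpha> * x / real n)
          + 2 * bias_bound \<eta>))
      + (1 / 2) * (\<Sum>\<omega>\<in>{}. Qa \<omega>) + 2 * \<gamma> * \<theta> * real (card ({} :: (nat \<times> nat) set))"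
    unfolding L[symmetric] by (rule exponent_le[OF ab Q _ _ \<kappa> _ A(1) B(1)]) (simp_all only: L, simp_all)
  also have "\<dots> = - (1 / 2) * (1 - 2 * \<kappa>) * info d B \<sigma>
    + 24 * \<gamma>\<^sup>2 / \<kappa> * (4 * \<alpha> * x / real n + bias_bound \<eta>)"
    by (simp add: distrib_left)
  finally show ?thesis .
qed

text \<open>Low entries are tolerated here: \<open>l\<close> is so small that the log-ratios,
  whatever the nonzero averages, stay bounded after multiplication by \<open>l\<close>. As there are
  at most 8 \<tau> / \<theta> low entries, their total price is a multiple of \<tau>.\<close>

lemma exponent_small_le:
  fixes x :: layers
  assumes ab: "a \<in> {1, 2}" "b \<in> {1, 2}" "a \<noteq> b"
    and near: "near \<eta> a Za sa" "near \<eta> b Zb sb" and \<eta>: "0 \<le> \<eta>" "\<eta> \<le> 1"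
  defines "Qa \<equiv> block_avg d Za sa (counts x)"
  defines "Qb \<equiv> block_avg d Zb sb (counts x)"
  assumes v: "0 \<le> v"
    and lta: "deviation Za sa Qa < v"
    and ltb: "deviation Zb sb Qb < v"
    and l: "0 < l" "l \<le> 1 / 2"
  defines "\<tau> \<equiv> 4 * \<alpha> * v / real n"
  assumes small: "2 * l * log_range \<tau> \<le> 1"
  shows "exponent l a Qa Qb \<le> - l / 2 * info d B \<sigma> + 240 * \<gamma>\<^sup>2 * \<tau>
    + 192 * \<gamma>\<^sup>2 * bias_bound \<eta> * l"
proof -
  define bias where "bias = bias_bound \<eta>"
  have Q: "0 \<le> Qa \<omega>" "0 \<le> Qb \<omega>" for \<omega>
    unfolding Qa_def Qb_def block_avg_def by (intro divide_nonneg_nonneg sum_nonneg; simp)+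
  note A = sum_hellinger_block_avg_le[OF near(1) ab(1) \<eta> Q(1) v lta, folded \<tau>_def bias_def]
  note B = sum_hellinger_block_avg_le[OF near(2) ab(2) \<eta> Q(2) v ltb, folded \<tau>_def bias_def]
  define L where "L = low Qa \<union> low Qb"
  have LJ: "L \<subseteq> J d" by (auto simp: L_def)
  have \<tau>0: "0 \<le> \<tau>" using v \<alpha> by (simp add: \<tau>_def)
  have c0: "0 \<le> 2 * \<tau> + 2 * \<gamma> * \<theta>" using \<tau>0 \<gamma> \<theta> by simp
  have "real (card L) \<le> real (card (low Qa)) + real (card (low Qb))"
    unfolding L_def by (simp add: card_Un_le flip: of_nat_add)
  then have "\<theta> * real (card L) \<le> \<theta> * (real (card (low Qa)) + real (card (low Qb)))"
    using \<theta> by (intro mult_left_mono) auto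
  then have L: "\<theta> * real (card L) \<le> 8 * \<tau>" using A(2) B(2) unfolding distrib_left by linarith
  have ln: "l * \<bar>ln (Qb \<omega>) - ln (Qa \<omega>)\<bar> \<le> 1" if "\<omega> \<in> L" for \<omega>
  proof -
    have \<omega>: "\<omega> \<in> J d" using that LJ by auto
    have "\<bar>ln (Qa \<omega>)\<bar> \<le> log_range \<tau>"
      using abs_ln_block_avg_le[OF near(1) \<omega> A(4)[OF \<omega>, unfolded Qa_def] c0] by (simp add: Qa_def)
    moreover have "\<bar>ln (Qb \<omega>)\<bar> \<le> log_range \<tau>"
      using abs_ln_block_avg_le[OF near(2) \<omega> B(4)[OF \<omega>, unfolded Qb_def] c0] by (simp add: Qb_def)
    ultimately have "\<bar>ln (Qb \<omega>) - ln (Qa \<omega>)\<bar> \<le> 2 * log_range \<tau>"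
      by linarith
    then have "l * \<bar>ln (Qb \<omega>) - ln (Qa \<omega>)\<bar> \<le> l * (2 * log_range \<tau>)"
      using l by (intro mult_left_mono) auto
    then show ?thesis using small by (simp add: mult_ac)
  qed
  have "\<gamma> * (\<theta> * real (card L)) \<le> \<gamma> * (8 * \<tau>)" using L \<gamma> by (intro mult_left_mono) auto
  then have gL: "\<gamma> * \<theta> * real (card L) \<le> 8 * \<gamma> * \<tau>" by (simp add: mult_ac)
  have g2: "\<gamma> * \<tau> \<le> \<gamma>\<^sup>2 * \<tau>" "\<tau> \<le> \<gamma>\<^sup>2 * \<tau>"
    using mult_right_mono[OF self_le_power[OF \<gamma>, of 2] \<tau>0] mult_right_mono[OF one_le_power[OF \<gamma>, of 2] \<tau>0]
    by simp_all
  \<comment> \<open>With \<kappa> = 1/4 half of the information survives. Only the order of the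
    exponent matters in this regime, and the constants below are generous.\<close>
  have "exponent l a Qa Qb \<le> 2 * l * (- (1 / 2) * (1 - 2 * (1 / 4)) * (info d B \<sigma> - \<gamma> * \<theta> * real (card L))
       + 12 * \<gamma>\<^sup>2 / (1 / 4) * (2 * \<tau> + 2 * bias))
      + l * (\<Sum>\<omega>\<in>L. Qa \<omega>) + 2 * \<gamma> * \<theta> * real (card L)"
    unfolding L_def
    by (rule exponent_le[OF ab Q l _ _ _ A(1) B(1)]) (use ln in \<open>auto simp: L_def\<close>)
  also have "\<dots> = - l / 2 * info d B \<sigma> + l / 2 * (\<gamma> * \<theta> * real (card L)) + 192 * l * (\<gamma>\<^sup>2 * \<tau>) + 192 * \<gamma>\<^sup>2 * bias * l
      + l * (\<Sum>\<omega>\<in>L. Qa \<omega>) + 2 * (\<gamma> * \<theta> * real (card L))"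
    by (simp add: algebra_simps)
  also have "\<dots> \<le> - l / 2 * info d B \<sigma> + (1 / 4) * (8 * \<gamma> * \<tau>) + 96 * (\<gamma>\<^sup>2 * \<tau>) + 192 * \<gamma>\<^sup>2 * bias * l
      + (1 / 2) * (2 * \<tau> + 2 * (8 * \<gamma> * \<tau>)) + 2 * (8 * \<gamma> * \<tau>)"
  proof (intro add_mono order_refl)
    show "l / 2 * (\<gamma> * \<theta> * real (card L)) \<le> (1 / 4) * (8 * \<gamma> * \<tau>)"
      using l \<gamma> \<theta> by (intro mult_mono[OF _ gL]) auto
    show "192 * l * (\<gamma>\<^sup>2 * \<tau>) \<le> 96 * (\<gamma>\<^sup>2 * \<tau>)" using l \<tau>0 by (intro mult_right_mono) auto
    have "(\<Sum>\<omega>\<in>L. Qa \<omega>) \<le> 2 * \<tau> + 2 * (8 * \<gamma> * \<tau>)" using A(3)[OF LJ] gL by linarith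
    then show "l * (\<Sum>\<omega>\<in>L. Qa \<omega>) \<le> (1 / 2) * (2 * \<tau> + 2 * (8 * \<gamma> * \<tau>))"
      using l Q by (intro mult_mono sum_nonneg) auto
    show "2 * (\<gamma> * \<theta> * real (card L)) \<le> 2 * (8 * \<gamma> * \<tau>)" using gL by simp
  qed
  also have "\<dots> \<le> - l / 2 * info d B \<sigma> + 240 * (\<gamma>\<^sup>2 * \<tau>) + 192 * \<gamma>\<^sup>2 * bias * l"
  proof -
    have "0 \<le> \<gamma>\<^sup>2 * \<tau>" using \<tau>0 by simp
    have "u + 1 / 4 * (8 * g * t) + 96 * y + w + 1 / 2 * (2 * t + 2 * (8 * g * t)) + 2 * (8 * g * t)
        \<le> u + 240 * y + w" if "g * t \<le> y" "t \<le> y" "0 \<le> y" for u g t y w :: real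
      using that by (simp add: field_simps)
    from this[OF g2 \<open>0 \<le> \<gamma>\<^sup>2 * \<tau>\<close>] show ?thesis .
  qed
  finally show ?thesis by (simp add: bias_def mult_ac)
qed

abbreviation "layer_loglik f i Q \<equiv> (\<Sum>\<omega>\<in>J d. - Q \<omega> + real (f (i, \<omega>)) * ln (Q \<omega>))"

abbreviation "layers_pmf A \<equiv> Pi_pmf A 0 (\<lambda>(i, \<omega>). poisson_pmf (P (z i) \<omega>))"

text \<open>Chernoff's bound for a statistic linear in the counts. The event includes ties and hence
  covers every way of breaking them.\<close>

lemma likelihood_error_prob:
  assumes i: "i \<in> {1..n}" and l: "0 < l"
  shows "measure_pmf.prob (layers_pmf ({i} \<times> J d))
    {f. layer_loglik f i Qa \<le> layer_loglik f i Qb}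
    \<le> exp (exponent l (z i) Qa Qb)"
proof -
  define c where "c x = l * (ln (Qb (snd x)) - ln (Qa (snd x)))" for x :: "nat \<times> nat \<times> nat"
  define v where "v = - l * (\<Sum>\<omega>\<in>J d. Qa \<omega> - Qb \<omega>)"
  have s: "(\<Sum>x\<in>{i} \<times> J d. h x) = (\<Sum>\<omega>\<in>J d. h (i, \<omega>))" for h :: "nat \<times> nat \<times> nat \<Rightarrow> real"
  proof -
    have "{i} \<times> J d = Pair i ` J d" by auto
    then show ?thesis by (simp add: sum.reindex inj_on_def)
  qed
  have set: "{f. layer_loglik f i Qa \<le> layer_loglik f i Qb}
     = {f. v \<le> (\<Sum>x\<in>{i} \<times> J d. c x * real (f x))}"
  proof (intro Collect_cong)
    fix f :: "nat \<times> nat \<times> nat \<Rightarrow> nat"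
    have "(\<Sum>x\<in>{i} \<times> J d. c x * real (f x)) - v
      = l * (layer_loglik f i Qb - layer_loglik f i Qa)"
      unfolding s v_def
      by (simp add: c_def sum_distrib_left sum_subtractf[symmetric] sum.distrib[symmetric] algebra_simps)
    then show "(layer_loglik f i Qa \<le> layer_loglik f i Qb)
      = (v \<le> (\<Sum>x\<in>{i} \<times> J d. c x * real (f x)))"
      using l by (smt (verit) mult_nonneg_nonneg mult_pos_neg)
  qed
  have "measure_pmf.prob (Pi_pmf ({i} \<times> J d) 0 (\<lambda>x. poisson_pmf (P (z (fst x)) (snd x))))
      {f. v \<le> (\<Sum>x\<in>{i} \<times> J d. c x * real (f x))}
    \<le> exp ((\<Sum>x\<in>{i} \<times> J d. P (z (fst x)) (snd x) * (exp (c x) - 1)) - v)"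
    using P_bounds(1)[OF z_in[OF i]] \<theta> by (intro Pi_poisson_chernoff) (auto intro: less_le_trans)
  also have "(\<Sum>x\<in>{i} \<times> J d. P (z (fst x)) (snd x) * (exp (c x) - 1)) - v = exponent l (z i) Qa Qb"
    unfolding s v_def exponent_def by (simp add: c_def sum.distrib sum_distrib_left sum_negf)
  finally show ?thesis unfolding set by (simp add: case_prod_beta')
qed

end

section \<open>Error probability of a single layer\<close>

text \<open>The independent variables live on the upper triangle \<open>J d\<close>, while the
  initialization reads full matrices. Folding an entry onto its representative lets
  \<open>layers_of\<close> rebuild the symmetric data.\<close>

definition canon :: "nat \<times> nat \<Rightarrow> nat \<times> nat" where
  "canon \<omega> = (min (fst \<omega>) (snd \<omega>), max (fst \<omega>) (snd \<omega>))"

definition layers_of :: "(nat \<times> nat \<times> nat \<Rightarrow> nat) \<Rightarrow> layers" where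
  "layers_of f i \<omega> = f (i, canon \<omega>)"

lemma canon_J [simp]: "\<omega> \<in> J d \<Longrightarrow> canon \<omega> = \<omega>"
  by (auto simp: canon_def J_def)

lemma canon_in_J: "\<omega> \<in> {1..d} \<times> {1..d} \<Longrightarrow> canon \<omega> \<in> J d"
  by (auto simp: canon_def J_def)

text \<open>Leave-one-out in formal terms: by this and the next three lemmas, all estimates of run
  \<open>i\<close> stay the same when layer \<open>i\<close> is redrawn.\<close>

lemma init_without_cong:
  assumes "\<And>j \<omega>. j \<in> {1..n} - {i} \<Longrightarrow> \<omega> \<in> {1..d} \<times> {1..d} \<Longrightarrow> x j \<omega> = x' j \<omega>"
  shows "init_without n d Init x i = init_without n d Init x' i"
proof -
  have "(\<lambda>i'\<in>{1..n} - {i}. \<lambda>\<omega>\<in>{1..d} \<times> {1..d}. x i' \<omega>) = (\<lambda>i'\<in>{1..n} - {i}. \<lambda>\<omega>\<in>{1..d} \<times> {1..d}. x' i' \<omega>)"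
    using assms by (intro restrict_ext) auto
  then show ?thesis by (simp add: init_without_def)
qed

lemma ztil_cong:
  assumes "\<And>j \<omega>. j \<in> {1..n} - {i} \<Longrightarrow> \<omega> \<in> {1..d} \<times> {1..d} \<Longrightarrow> x j \<omega> = x' j \<omega>"
  shows "ztil n d Init x i = ztil n d Init x' i"
proof -
  have "init_without n d Init x i = init_without n d Init x' i" using assms by (rule init_without_cong)
  then show ?thesis by (simp add: ztil_def fun_eq_iff)
qed

lemma sigtil_cong:
  assumes "\<And>j \<omega>. j \<in> {1..n} - {i} \<Longrightarrow> \<omega> \<in> {1..d} \<times> {1..d} \<Longrightarrow> x j \<omega> = x' j \<omega>"
  shows "sigtil n d Init x i = sigtil n d Init x' i"
proof -
  have "init_without n d Init x i = init_without n d Init x' i" using assms by (rule init_without_cong)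
  then show ?thesis by (simp add: sigtil_def fun_eq_iff)
qed

lemma Phat_cong:
  assumes "\<And>j \<omega>. j \<in> {1..n} - {i} \<Longrightarrow> \<omega> \<in> {1..d} \<times> {1..d} \<Longrightarrow> x j \<omega> = x' j \<omega>"
  shows "Phat n d Init x i m = Phat n d Init x' i m"
proof -
  have z: "ztil n d Init x i = ztil n d Init x' i" using assms by (rule ztil_cong)
  have s: "sigtil n d Init x i = sigtil n d Init x' i" using assms by (rule sigtil_cong)
  have x: "x j \<omega> = x' j \<omega>" if "j \<in> {1..n} - {i}" "\<omega> \<in> J d" for j \<omega>
    using assms[OF that(1)] subsetD[OF J_subset that(2)] by simp
  have "Bhat n d Init x i m = Bhat n d Init x' i m"
    unfolding Bhat_def z s Let_def
    by (intro ext arg_cong2[where f = "(/)"] sum.cong refl arg_cong2[where f = "(*)"]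
        arg_cong[where f = real] x)
  then show ?thesis by (simp add: Phat_def s)
qed

lemma block_avg_cong:
  assumes "\<And>i \<omega>. i \<in> Z \<Longrightarrow> \<omega> \<in> J d \<Longrightarrow> y i \<omega> = y' i \<omega>"
  shows "block_avg d Z s y \<omega> = block_avg d Z s y' \<omega>"
  unfolding block_avg_def using assms cell_subset
  by (intro arg_cong2[where f = "(/)"] sum.cong refl) blast

text \<open>The labelling enters only through the question which entries share a block, so the raw
  labels may be replaced by labels permuted back to the truth.\<close>

lemma Phat_eq_block_avg:
  assumes \<omega>: "\<omega> \<in> J d"
    and s: "\<And>j k. j \<in> {1..d} \<Longrightarrow> k \<in> {1..d} \<Longrightarrow> sigtil n d Init x i m j = sigtil n d Init x i m k \<longleftrightarrow> s j = s k"
  shows "Phat n d Init x i m \<omega> =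
    block_avg d {j \<in> {1..n} - {i}. ztil n d Init x i j = m} s (counts x) \<omega>"
proof -
  define \<zeta> t where "\<zeta> = ztil n d Init x i" and "t = sigtil n d Init x i m"
  have in_d: "fst \<omega> \<in> {1..d}" "snd \<omega> \<in> {1..d}" if "\<omega> \<in> J d" for \<omega>
    using that by (auto simp: J_def)
  have C: "J d \<inter> {\<omega>'. (t (fst \<omega>'), t (snd \<omega>')) = (t (fst \<omega>), t (snd \<omega>))} = cell d s \<omega>"
  proof -
    have "t (fst \<omega>') = t (fst \<omega>) \<longleftrightarrow> s (fst \<omega>') = s (fst \<omega>)" "t (snd \<omega>') = t (snd \<omega>) \<longleftrightarrow> s (snd \<omega>') = s (snd \<omega>)"
      if "\<omega>' \<in> J d" for \<omega>'
      unfolding t_def using in_d[OF that] in_d[OF \<omega>] by (intro s; simp)+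
    then show ?thesis by (auto simp: cell_def key_def)
  qed
  have Z: "({1..n} - {i}) \<inter> {j. \<zeta> j = m} = {j \<in> {1..n} - {i}. \<zeta> j = m}" by auto
  have "Phat n d Init x i m \<omega> = Bhat n d Init x i m (t (fst \<omega>)) (t (snd \<omega>))"
    by (simp add: Phat_def mean_def t_def)
  also have "\<dots> = (\<Sum>j\<in>({1..n} - {i}) \<inter> {j. \<zeta> j = m}.
        \<Sum>\<omega>'\<in>J d \<inter> {\<omega>'. (t (fst \<omega>'), t (snd \<omega>')) = (t (fst \<omega>), t (snd \<omega>))}. real (x j \<omega>'))
     / (\<Sum>j\<in>({1..n} - {i}) \<inter> {j. \<zeta> j = m}.
        \<Sum>\<omega>'\<in>J d \<inter> {\<omega>'. (t (fst \<omega>'), t (snd \<omega>')) = (t (fst \<omega>), t (snd \<omega>))}. 1)"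
    unfolding Bhat_def Let_def \<zeta>_def[symmetric] t_def[symmetric]
    by simp
  also have "\<dots> = block_avg d {j \<in> {1..n} - {i}. \<zeta> j = m} s (counts x) \<omega>"
    unfolding C Z block_avg_def by simp
  finally show ?thesis by (simp add: \<zeta>_def)
qed

lemma mismatch_le_iff:
  assumes "0 < N"
  shows "mismatch N a b \<le> \<eta> \<longleftrightarrow> real (card {i \<in> {1..N}. a i \<noteq> b i}) \<le> \<eta> * real N"
  using assms by (simp add: mismatch_def field_simps sum_of_bool_eq Int_def)

lemma hloss_le_iff: "hloss N k a b \<le> \<eta> \<longleftrightarrow> (\<exists>\<pi>. \<pi> permutes {1..k} \<and> mismatch N a (\<pi> \<circ> b) \<le> \<eta>)"
proof -
  have "{\<pi>. \<pi> permutes {1..k}} \<noteq> {}" using permutes_id by blast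
  then show ?thesis
    unfolding hloss_def by (subst Min_le_iff) (auto intro: finite_permutations)
qed

section \<open>Probability that a single layer is misled\<close>

context block_model
begin

definition aligned :: "real \<Rightarrow> init_alg \<Rightarrow> layers \<Rightarrow> nat \<Rightarrow> (nat \<Rightarrow> nat) \<Rightarrow> bool" where
  "aligned \<eta> Init x i \<pi> \<longleftrightarrow> \<pi> permutes {1, 2} \<and> mismatch n (ztil n d Init x i) (\<pi> \<circ> z) \<le> \<eta> \<and>
     (\<forall>m\<in>{1, 2}. hloss d K (sigtil n d Init x i (\<pi> m)) (\<sigma> m) \<le> \<eta>)"

text \<open>The choice depends on \<open>x\<close> only through the predicate
  \<open>aligned\<close>, hence not on layer \<open>i\<close>. Given the other layers,
  \<open>misled\<close> thus compares two fixed plug-in likelihoods.\<close>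

definition alignment :: "real \<Rightarrow> init_alg \<Rightarrow> layers \<Rightarrow> nat \<Rightarrow> nat \<Rightarrow> nat" where
  "alignment \<eta> Init x i = (SOME \<pi>. aligned \<eta> Init x i \<pi>)"

text \<open>Ties count as errors because the arg max may resolve them either way;
  \<open>3 - z i\<close> is the other class.\<close>

definition misled :: "real \<Rightarrow> init_alg \<Rightarrow> layers \<Rightarrow> nat \<Rightarrow> bool" where
  "misled \<eta> Init x i \<longleftrightarrow> (\<exists>\<pi>. aligned \<eta> Init x i \<pi>) \<and>
     loglik n d Init x i (alignment \<eta> Init x i (z i)) \<le> loglik n d Init x i (alignment \<eta> Init x i (3 - z i))"

lemma aligned_alignment: "\<exists>\<pi>. aligned \<eta> Init x i \<pi> \<Longrightarrow> aligned \<eta> Init x i (alignment \<eta> Init x i)"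
  unfolding alignment_def by (erule someI_ex)

lemma aligned_cong:
  assumes "\<And>j \<omega>. j \<in> {1..n} - {i} \<Longrightarrow> \<omega> \<in> {1..d} \<times> {1..d} \<Longrightarrow> x j \<omega> = x' j \<omega>"
  shows "aligned \<eta> Init x i = aligned \<eta> Init x' i"
proof -
  have z: "ztil n d Init x i = ztil n d Init x' i" using assms by (rule ztil_cong)
  have s: "sigtil n d Init x i = sigtil n d Init x' i" using assms by (rule sigtil_cong)
  show ?thesis unfolding aligned_def z s ..
qed

definition near_labels :: "real \<Rightarrow> (nat \<Rightarrow> nat) set" where
  "near_labels \<eta> = {\<zeta> \<in> {1..n} \<rightarrow>\<^sub>E {0, 1, 2}. real (card {j \<in> {1..n}. \<zeta> j \<noteq> z j}) \<le> \<eta> * real (card {1..n})}"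

definition near_nodes :: "real \<Rightarrow> nat \<Rightarrow> (nat \<Rightarrow> nat) set" where
  "near_nodes \<eta> m = {s \<in> {1..d} \<rightarrow>\<^sub>E {1..K}. real (card {j \<in> {1..d}. s j \<noteq> \<sigma> m j}) \<le> \<eta> * real (card {1..d})}"

definition label_set :: "nat \<Rightarrow> (nat \<Rightarrow> nat) \<Rightarrow> nat \<Rightarrow> nat set" where
  "label_set i \<zeta> m = {j \<in> {1..n} - {i}. \<zeta> j = m}"

lemma near_label_set:
  assumes \<zeta>: "\<zeta> \<in> near_labels \<eta>" "\<zeta> i \<notin> {1, 2}" and s: "s \<in> near_nodes \<eta> m" and m: "m \<in> {1, 2}"
    and \<eta>: "4 * \<alpha> * \<eta> \<le> 1"
  shows "near \<eta> m (label_set i \<zeta> m) s"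
proof -
  define D where "D = {j \<in> {1..n}. \<zeta> j \<noteq> z j}"
  define Z where "Z = label_set i \<zeta> m"
  have fin: "finite D" "finite Z" by (auto simp: D_def Z_def label_set_def)
  have D: "real (card D) \<le> \<eta> * real n" using \<zeta>(1) by (simp add: D_def near_labels_def)
  \<comment> \<open>Layer \<open>i\<close> is excluded from \<open>Z\<close>, but it lies in
    \<open>D\<close> because its label is neither 1 nor 2.\<close>
  have "{j \<in> {1..n}. z j = m} \<subseteq> Z \<union> D" using \<zeta>(2) m by (auto simp: Z_def D_def label_set_def)
  then have "card {j \<in> {1..n}. z j = m} \<le> card (Z \<union> D)" using fin by (intro card_mono) auto
  also have "\<dots> \<le> card Z + card D" by (rule card_Un_le)
  finally have "real (card {j \<in> {1..n}. z j = m}) \<le> real (card Z) + real (card D)"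
    by (simp flip: of_nat_add)
  moreover have "real n / (2 * \<alpha>) \<le> real (card {j \<in> {1..n}. z j = m})"
    using Theta m by (auto simp: Theta_def)
  moreover have "\<eta> * real n \<le> real n / (4 * \<alpha>)"
  proof -
    have "(4 * \<alpha> * \<eta>) * real n \<le> 1 * real n" using \<eta> by (intro mult_right_mono) auto
    then show ?thesis using \<alpha> by (simp add: field_simps)
  qed
  moreover have "real n / (2 * \<alpha>) = real n / (4 * \<alpha>) + real n / (4 * \<alpha>)" using \<alpha> by (simp add: field_simps)
  ultimately have Z: "real n / (4 * \<alpha>) \<le> real (card Z)" using D by linarith
  moreover have "0 < real n / (4 * \<alpha>)" using n \<alpha> by simp
  ultimately have "Z \<noteq> {}" by auto
  moreover have "card {j \<in> Z. z j \<noteq> m} \<le> card D"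
    using fin by (intro card_mono) (auto simp: D_def Z_def label_set_def)
  then have "real (card {j \<in> Z. z j \<noteq> m}) \<le> \<eta> * real n" using D by linarith
  moreover have "Z \<subseteq> {1..n}" by (auto simp: Z_def label_set_def)
  moreover have "\<forall>j\<in>{1..d}. s j \<in> {1..K}" "real (card {j \<in> {1..d}. s j \<noteq> \<sigma> m j}) \<le> \<eta> * real d"
    using s by (auto simp: near_nodes_def PiE_def Pi_def)
  ultimately show ?thesis using Z unfolding near_def Z_def by blast
qed

text \<open>The inverse permutations, applied to the raw labels, give candidates near the truth that
  induce the same layer classes and node blocks, hence the same estimated means.\<close>

lemma aligned_imp_near:
  assumes "valid_init d K Init" and al: "aligned \<eta> Init x i \<pi>" and i: "i \<in> {1..n}" and m: "m \<in> {1, 2}"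
    and \<eta>: "4 * \<alpha> * \<eta> \<le> 1" and d: "0 < d"
  obtains \<zeta> s where "\<zeta> \<in> near_labels \<eta>" "s \<in> near_nodes \<eta> m" "near \<eta> m (label_set i \<zeta> m) s"
    "\<And>\<omega>. \<omega> \<in> J d \<Longrightarrow> Phat n d Init x i (\<pi> m) \<omega> = block_avg d (label_set i \<zeta> m) s (counts x) \<omega>"
proof -
  define zt where "zt = ztil n d Init x i"
  define st where "st = sigtil n d Init x i (\<pi> m)"
  have \<pi>: "\<pi> permutes {1, 2}" and mz: "mismatch n zt (\<pi> \<circ> z) \<le> \<eta>"
    and "hloss d K st (\<sigma> m) \<le> \<eta>"
    using al m by (auto simp: aligned_def zt_def st_def)
  then obtain \<phi> where \<phi>: "\<phi> permutes {1..K}" and ms: "mismatch d st (\<phi> \<circ> \<sigma> m) \<le> \<eta>"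
    by (auto simp: hloss_le_iff)
  have \<pi>': "inv \<pi> permutes {1, 2}" using \<pi> by (rule permutes_inv)
  have \<phi>': "inv \<phi> permutes {1..K}" using \<phi> by (rule permutes_inv)
  have \<pi>m: "\<pi> m \<in> {1, 2}" using permutes_in_image[OF \<pi>, of m] m by simp
  have inv: "inv \<pi> y = k \<longleftrightarrow> y = \<pi> k" for y k using \<pi> by (auto simp: permutes_inverses)
  have invs: "inv \<phi> y = k \<longleftrightarrow> y = \<phi> k" for y k using \<phi> by (auto simp: permutes_inverses)
  define \<zeta> where "\<zeta> = (\<lambda>j\<in>{1..n}. inv \<pi> (zt j))"
  define s where "s = (\<lambda>j\<in>{1..d}. inv \<phi> (st j))"
  have zt: "zt j \<in> {0, 1, 2}" if "j \<in> {1..n}" for j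
    using assms(1) that by (auto simp: valid_init_def zt_def ztil_def init_without_def)
  have zti: "zt i = 0" by (simp add: zt_def ztil_def)
  \<comment> \<open>The dummy label survives the relabelling, since permutations of {1, 2} fix
    0.\<close>
  have inv0: "inv \<pi> 0 = 0" using \<pi>' by (rule permutes_not_in) simp
  have st: "st j \<in> {1..K}" if "j \<in> {1..d}" for j
    using assms(1) that \<pi>m unfolding valid_init_def st_def sigtil_def init_without_def by blast
  have \<zeta>: "\<zeta> \<in> near_labels \<eta>"
  proof -
    have "\<zeta> j \<in> {0, 1, 2}" if "j \<in> {1..n}" for j
      using zt[OF that] permutes_in_image[OF \<pi>', of "zt j"] inv0 that by (auto simp: \<zeta>_def)
    moreover have "{j \<in> {1..n}. \<zeta> j \<noteq> z j} = {j \<in> {1..n}. zt j \<noteq> (\<pi> \<circ> z) j}"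
      by (auto simp: \<zeta>_def inv)
    ultimately show ?thesis
      using mz n by (auto simp: near_labels_def mismatch_le_iff \<zeta>_def)
  qed
  have s: "s \<in> near_nodes \<eta> m"
  proof -
    have "s j \<in> {1..K}" if "j \<in> {1..d}" for j
      using st[OF that] permutes_in_image[OF \<phi>', of "st j"] that by (simp add: s_def)
    moreover have "{j \<in> {1..d}. s j \<noteq> \<sigma> m j} = {j \<in> {1..d}. st j \<noteq> (\<phi> \<circ> \<sigma> m) j}"
      by (auto simp: s_def invs)
    ultimately show ?thesis
      using ms d by (auto simp: near_nodes_def mismatch_le_iff s_def)
  qed
  have \<zeta>i: "\<zeta> i \<notin> {1, 2}" using i by (simp add: \<zeta>_def zti inv0)
  have Z: "{j \<in> {1..n} - {i}. zt j = \<pi> m} = label_set i \<zeta> m"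
    by (auto simp: label_set_def \<zeta>_def inv)
  have "Phat n d Init x i (\<pi> m) \<omega> = block_avg d (label_set i \<zeta> m) s (counts x) \<omega>"
    if "\<omega> \<in> J d" for \<omega>
    unfolding Z[symmetric] zt_def
  proof (rule Phat_eq_block_avg[OF that])
    fix j k assume "j \<in> {1..d}" "k \<in> {1..d}"
    then show "sigtil n d Init x i (\<pi> m) j = sigtil n d Init x i (\<pi> m) k \<longleftrightarrow> s j = s k"
      using permutes_inj[OF \<phi>'] by (simp add: s_def st_def inj_eq)
  qed
  from that[OF \<zeta> s near_label_set[OF \<zeta> \<zeta>i s m \<eta>] this] show ?thesis .
qed

text \<open>Bound on the logarithm of the number of candidates, plus the 3 K^2 of the block tail:
  \<open>card_labellings_near_le\<close> gives 4 n sqrt \<eta> for three layer labels and (K + 1) d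
  sqrt \<eta> for K node labels.\<close>

definition label_entropy :: "real \<Rightarrow> real" where
  "label_entropy \<eta> = 4 * real n * sqrt \<eta> + (real K + 1) * real d * sqrt \<eta> + 3 * (real K)\<^sup>2"

definition data_pmf :: "(nat \<times> nat \<times> nat \<Rightarrow> nat) pmf" where
  "data_pmf = layers_pmf ({1..n} \<times> J d)"

abbreviation "misled_prob \<eta> Init i \<equiv> measure_pmf.prob data_pmf {f. misled \<eta> Init (layers_of f) i}"

definition deviates :: "nat \<Rightarrow> real \<Rightarrow> nat \<Rightarrow> (nat \<Rightarrow> nat) \<Rightarrow> (nat \<Rightarrow> nat) \<Rightarrow> layers \<Rightarrow> bool" where
  "deviates i v m \<zeta> s x \<longleftrightarrow> v \<le> deviation (label_set i \<zeta> m) s (block_avg d (label_set i \<zeta> m) s (counts x))"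

lemma prob_deviates:
  assumes s: "s \<in> near_nodes \<eta> m"
  shows "measure_pmf.prob data_pmf {f. deviates i v m \<zeta> s (layers_of f)} \<le> exp (3 * (real K)\<^sup>2 - v / 4)"
proof -
  define Z where "Z = label_set i \<zeta> m"
  \<comment> \<open>The rate 1 off the index set meets the demand for positive rates everywhere; the
    law of the data does not see it.\<close>
  define r where "r j \<omega> = (if j \<in> {1..n} \<and> \<omega> \<in> J d then P (z j) \<omega> else 1)" for j \<omega>
  have Z: "Z \<subseteq> {1..n}" by (auto simp: Z_def label_set_def)
  have "0 < P (z j) \<omega>" if "j \<in> {1..n}" "\<omega> \<in> J d" for j \<omega>
    using P_bounds(1)[OF z_in[OF that(1)] that(2)] \<theta> by linarith
  then have r: "0 < r j \<omega>" for j \<omega>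
    by (simp add: r_def)
  have "data_pmf = Pi_pmf ({1..n} \<times> J d) 0 (\<lambda>(i, \<omega>). poisson_pmf (r i \<omega>))"
    unfolding data_pmf_def by (intro Pi_pmf_cong) (auto simp: r_def)
  moreover have "block_avg d Z s (\<lambda>i \<omega>. real (layers_of f i \<omega>)) \<omega> = block_avg d Z s (\<lambda>i \<omega>. real (f (i, \<omega>))) \<omega>" for f \<omega>
    by (intro block_avg_cong) (simp add: layers_of_def)
  moreover have "Pbar Z s \<omega> = block_avg d Z s r \<omega>" for \<omega>
    using Z by (intro block_avg_cong) (auto simp: r_def)
  ultimately show ?thesis
    using block_avg_hellinger_tail[of "{1..n} \<times> J d" Z d r s K v] Z r s
    by (simp add: deviates_def Z_def[symmetric] near_nodes_def PiE_def Pi_def Sigma_mono)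
qed

text \<open>The labellings used by the algorithm depend on the data, so the tail for fixed
  labellings is summed over all candidates and over both classes.\<close>

lemma prob_some_deviates:
  assumes \<eta>: "0 < \<eta>" "\<eta> \<le> 1"
  shows "measure_pmf.prob data_pmf
     {f. \<exists>m\<in>{1, 2}. \<exists>\<zeta>\<in>near_labels \<eta>. \<exists>s\<in>near_nodes \<eta> m. deviates i v m \<zeta> s (layers_of f)}
   \<le> 2 * exp (label_entropy \<eta> - v / 4)"
proof -
  define e where "e = exp (3 * (real K)\<^sup>2 - v / 4)"
  have cl: "real (card (near_labels \<eta>)) \<le> exp (4 * real n * sqrt \<eta>)"
    using card_labellings_near_le[of "{1..n}" "{0, 1, 2 :: nat}" \<eta> z] \<eta>
    by (simp add: near_labels_def)
  have cn: "real (card (near_nodes \<eta> m)) \<le> exp ((real K + 1) * real d * sqrt \<eta>)" for m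
    using card_labellings_near_le[of "{1..d}" "{1..K}" \<eta> "\<sigma> m"] \<eta> by (simp add: near_nodes_def)
  have fl: "finite (near_labels \<eta>)" unfolding near_labels_def by (intro finite_Collect_conjI disjI1) (simp add: finite_PiE)
  have fn: "finite (near_nodes \<eta> m)" for m
    unfolding near_nodes_def by (intro finite_Collect_conjI disjI1) (simp add: finite_PiE)
  define T where "T m = near_labels \<eta> \<times> near_nodes \<eta> m" for m
  define V where "V m t = {f. deviates i v m (fst t) (snd t) (layers_of f)}" for m t
  have one: "measure_pmf.prob data_pmf (\<Union>t\<in>T m. V m t)
      \<le> exp (4 * real n * sqrt \<eta>) * exp ((real K + 1) * real d * sqrt \<eta>) * e" for m
  proof -
    have "measure_pmf.prob data_pmf (\<Union>t\<in>T m. V m t)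
      \<le> (\<Sum>t\<in>T m. measure_pmf.prob data_pmf (V m t))"
      using fl fn by (intro measure_pmf.finite_measure_subadditive_finite) (auto simp: T_def)
    also have "\<dots> \<le> (\<Sum>t\<in>T m. e)"
      unfolding e_def V_def by (intro sum_mono prob_deviates[of _ \<eta>]) (auto simp: T_def)
    also have "\<dots> = real (card (near_labels \<eta>)) * real (card (near_nodes \<eta> m)) * e"
      by (simp add: T_def card_cartesian_product)
    also have "\<dots> \<le> exp (4 * real n * sqrt \<eta>) * exp ((real K + 1) * real d * sqrt \<eta>) * e"
      using cl cn by (intro mult_right_mono mult_mono) (auto simp: e_def)
    finally show ?thesis .
  qed
  have eq: "{f. \<exists>m\<in>{1, 2}. \<exists>\<zeta>\<in>near_labels \<eta>. \<exists>s\<in>near_nodes \<eta> m. deviates i v m \<zeta> s (layers_of f)}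
     = (\<Union>t\<in>T 1. V 1 t)
     \<union> (\<Union>t\<in>T 2. V 2 t)"
    unfolding T_def V_def by auto
  have "measure_pmf.prob data_pmf ((\<Union>t\<in>T 1. V 1 t)
       \<union> (\<Union>t\<in>T 2. V 2 t))
     \<le> measure_pmf.prob data_pmf (\<Union>t\<in>T 1. V 1 t)
     + measure_pmf.prob data_pmf (\<Union>t\<in>T 2. V 2 t)"
    by (rule measure_Un_le) auto
  also have "\<dots> \<le> 2 * (exp (4 * real n * sqrt \<eta>) * exp ((real K + 1) * real d * sqrt \<eta>) * e)"
    using one[of 1] one[of 2] by linarith
  also have "\<dots> = 2 * exp (label_entropy \<eta> - v / 4)"
    by (simp add: e_def label_entropy_def mult_exp_exp algebra_simps)
  finally show ?thesis unfolding eq .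
qed

text \<open>
  The estimates entering the \<open>i\<close>-th likelihood ratio depend on the other layers only, hence
  can be treated as constants when the \<open>i\<close>-th layer is drawn.
\<close>

lemma prob_misled_le:
  assumes valid: "valid_init d K Init" and i: "i \<in> {1..n}" and \<eta>: "0 < \<eta>" "4 * \<alpha> * \<eta> \<le> 1"
    and d: "0 < d" and l: "0 < l"
    and \<Psi>: "\<And>a b Za sa Zb sb x. a \<in> {1, 2} \<Longrightarrow> b \<in> {1, 2} \<Longrightarrow> a \<noteq> b \<Longrightarrow>
      near \<eta> a Za sa \<Longrightarrow> near \<eta> b Zb sb \<Longrightarrow>
      deviation Za sa (block_avg d Za sa (counts x)) < v \<Longrightarrow>
      deviation Zb sb (block_avg d Zb sb (counts x)) < v \<Longrightarrow>
      exponent l a (block_avg d Za sa (counts x))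
        (block_avg d Zb sb (counts x)) \<le> \<Psi>"
  shows "misled_prob \<eta> Init i
    \<le> 2 * exp (label_entropy \<eta> - v / 4) + exp \<Psi>"
proof -
  define Bad where "Bad =
    {f. \<exists>m\<in>{1, 2}. \<exists>\<zeta>\<in>near_labels \<eta>. \<exists>s\<in>near_nodes \<eta> m. deviates i v m \<zeta> s (layers_of f)}"
  define G where "G = {f. misled \<eta> Init (layers_of f) i} - Bad"
  define A where "A = {i} \<times> J d"
  define A' where "A' = ({1..n} - {i}) \<times> J d"
  have AA: "{1..n} \<times> J d = A \<union> A'" "A \<inter> A' = {}" "finite A" "finite A'"
    using i by (auto simp: A_def A'_def)
  have \<eta>1: "\<eta> \<le> 1" using mult_right_mono[of 1 "4 * \<alpha>" \<eta>] \<eta> \<alpha> by linarith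
  have "measure_pmf.prob data_pmf G \<le> exp \<Psi>"
    unfolding data_pmf_def AA(1)
  proof (rule prob_Pi_pmf_split_le[OF AA(3,4,2)])
    fix g :: "nat \<times> nat \<times> nat \<Rightarrow> nat"
    define mg where "mg f = (\<lambda>x. if x \<in> A then f x else g x)" for f :: "nat \<times> nat \<times> nat \<Rightarrow> nat"
    show "measure_pmf.prob (layers_pmf A) {f. (\<lambda>x. if x \<in> A then f x else g x) \<in> G}
        \<le> exp \<Psi>"
    proof (cases "\<exists>f0. mg f0 \<in> G")
      case False
      then have "{f. (\<lambda>x. if x \<in> A then f x else g x) \<in> G} = {}" by (simp add: mg_def)
      then show ?thesis by (simp only: measure_empty exp_ge_zero)
    next
      case True
      \<comment> \<open>One outcome of layer \<open>i\<close> serves as reference: alignment,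
        labellings and estimates found there are those of every outcome with the same
        \<open>g\<close>. So this section of \<open>G\<close> lies in a single likelihood-ratio
        event.\<close>
      then obtain f0 where f0: "misled \<eta> Init (layers_of (mg f0)) i" "mg f0 \<notin> Bad" by (auto simp: G_def)
      define x0 where "x0 = layers_of (mg f0)"
      define \<pi> where "\<pi> = alignment \<eta> Init x0 i"
      define a where "a = z i"
      define b where "b = 3 - z i"
      have "z i = 1 \<or> z i = 2" using z_in[OF i] by simp
      then have ab: "a \<in> {1, 2}" "b \<in> {1, 2}" "a \<noteq> b" by (auto simp: a_def b_def)
      have al: "aligned \<eta> Init x0 i \<pi>"
        using f0(1) aligned_alignment unfolding misled_def \<pi>_def x0_def by blast
      have same: "layers_of (mg f) j \<omega> = x0 j \<omega>" if "j \<in> {1..n} - {i}" for f j \<omega>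
        using that by (auto simp: x0_def layers_of_def mg_def A_def)
      have eq: "aligned \<eta> Init (layers_of (mg f)) i = aligned \<eta> Init x0 i"
        "Phat n d Init (layers_of (mg f)) i = Phat n d Init x0 i" for f
      proof -
        show "aligned \<eta> Init (layers_of (mg f)) i = aligned \<eta> Init x0 i" for f
          using same by (intro aligned_cong)
        show "Phat n d Init (layers_of (mg f)) i = Phat n d Init x0 i" for f
          using same by (intro ext[of "Phat n d Init (layers_of (mg f)) i"] Phat_cong)
      qed
      obtain \<zeta>a sa where A: "\<zeta>a \<in> near_labels \<eta>" "sa \<in> near_nodes \<eta> a" "near \<eta> a (label_set i \<zeta>a a) sa"
        "\<And>\<omega>. \<omega> \<in> J d \<Longrightarrow> Phat n d Init x0 i (\<pi> a) \<omega> = block_avg d (label_set i \<zeta>a a) sa (counts x0) \<omega>"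
        by (rule aligned_imp_near[OF valid al i ab(1) \<eta>(2) d]) blast
      obtain \<zeta>b sb where B: "\<zeta>b \<in> near_labels \<eta>" "sb \<in> near_nodes \<eta> b" "near \<eta> b (label_set i \<zeta>b b) sb"
        "\<And>\<omega>. \<omega> \<in> J d \<Longrightarrow> Phat n d Init x0 i (\<pi> b) \<omega> = block_avg d (label_set i \<zeta>b b) sb (counts x0) \<omega>"
        by (rule aligned_imp_near[OF valid al i ab(2) \<eta>(2) d]) blast
      define Qa where "Qa = block_avg d (label_set i \<zeta>a a) sa (counts x0)"
      define Qb where "Qb = block_avg d (label_set i \<zeta>b b) sb (counts x0)"
      have "\<not> deviates i v a \<zeta>a sa x0" "\<not> deviates i v b \<zeta>b sb x0"
        using f0(2) A(1,2) B(1,2) ab(1,2) unfolding Bad_def x0_def by blast+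
      then have \<psi>: "exponent l a Qa Qb \<le> \<Psi>"
        unfolding Qa_def Qb_def deviates_def not_le using A(3) B(3) ab by (intro \<Psi>)
      have "{f. mg f \<in> G} \<subseteq>
        {f. layer_loglik f i Qa \<le> layer_loglik f i Qb}"
      proof safe
        fix f assume "mg f \<in> G"
        then have "loglik n d Init (layers_of (mg f)) i (\<pi> a) \<le> loglik n d Init (layers_of (mg f)) i (\<pi> b)"
          by (simp add: G_def misled_def \<pi>_def alignment_def eq a_def b_def)
        moreover have "loglik n d Init (layers_of (mg f)) i (\<pi> a) = layer_loglik f i Qa"
          unfolding loglik_def eq by (intro sum.cong refl) (simp add: A(4) Qa_def layers_of_def mg_def A_def)
        moreover have "loglik n d Init (layers_of (mg f)) i (\<pi> b) = layer_loglik f i Qb"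
          unfolding loglik_def eq by (intro sum.cong refl) (simp add: B(4) Qb_def layers_of_def mg_def A_def)
        ultimately show "layer_loglik f i Qa \<le> layer_loglik f i Qb"
          by simp
      qed
      then have "measure_pmf.prob (layers_pmf A) {f. mg f \<in> G}
        \<le> measure_pmf.prob (layers_pmf A)
          {f. layer_loglik f i Qa \<le> layer_loglik f i Qb}"
        by (rule measure_pmf.finite_measure_mono) simp
      also have "\<dots> \<le> exp (exponent l a Qa Qb)"
        unfolding A_def a_def using i l by (rule likelihood_error_prob)
      also have "\<dots> \<le> exp \<Psi>" using \<psi> by simp
      finally show ?thesis by (simp add: mg_def)
    qed
  qed simp
  moreover have "measure_pmf.prob data_pmf Bad
      \<le> 2 * exp (label_entropy \<eta> - v / 4)"
    unfolding Bad_def using \<eta>(1) \<eta>1 by (rule prob_some_deviates)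
  moreover have "misled_prob \<eta> Init i
     \<le> measure_pmf.prob data_pmf (Bad \<union> G)"
    by (intro measure_pmf.finite_measure_mono) (auto simp: G_def)
  moreover have "measure_pmf.prob data_pmf (Bad \<union> G) \<le> measure_pmf.prob data_pmf Bad + measure_pmf.prob data_pmf G"
    by (rule measure_Un_le) auto
  ultimately show ?thesis by linarith
qed

end

section \<open>Error of the two-stage algorithm\<close>

lemma hloss_le_1: "hloss N k a b \<le> 1"
  unfolding hloss_le_iff
proof (intro exI[of _ id] conjI permutes_id)
  show "mismatch N a (id \<circ> b) \<le> 1"
  proof (cases "N = 0")
    case False
    have "card {i \<in> {1..N}. a i \<noteq> (id \<circ> b) i} \<le> card {1..N}" by (intro card_mono) auto
    then show ?thesis using False by (subst mismatch_le_iff) auto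
  qed (simp add: mismatch_def)
qed

context block_model
begin

lemma prob_misled_le_half:
  assumes valid: "valid_init d K Init" and i: "i \<in> {1..n}" and \<eta>: "0 < \<eta>" "4 * \<alpha> * \<eta> \<le> 1"
    and d: "0 < d" and v: "0 \<le> v" "16 * \<alpha> * v < \<theta> * real n" and \<kappa>: "0 < \<kappa>" "\<kappa> \<le> 1 / 2"
  shows "misled_prob \<eta> Init i
    \<le> 2 * exp (label_entropy \<eta> - v / 4)
      + exp (- (1 / 2) * (1 - 2 * \<kappa>) * info d B \<sigma>
    + 24 * \<gamma>\<^sup>2 / \<kappa> * (4 * \<alpha> * v / real n + bias_bound \<eta>))"
proof (rule prob_misled_le[OF valid i \<eta> d, where l = "1 / 2"])
  have \<eta>': "0 \<le> \<eta>" "\<eta> \<le> 1" using mult_right_mono[of 1 "4 * \<alpha>" \<eta>] \<eta> \<alpha> by linarith+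
  have Q: "0 \<le> block_avg d Z s (counts x) \<omega>" for Z s x \<omega>
    unfolding block_avg_def by (intro divide_nonneg_nonneg sum_nonneg; simp)
  fix a b Za sa Zb sb and x :: layers
  assume "a \<in> {1, 2}" "b \<in> {1, 2}" "a \<noteq> b" "near \<eta> a Za sa" "near \<eta> b Zb sb"
    "deviation Za sa (block_avg d Za sa (counts x)) < v"
    "deviation Zb sb (block_avg d Zb sb (counts x)) < v"
  then show "exponent (1 / 2) a (block_avg d Za sa (counts x))
        (block_avg d Zb sb (counts x)) \<le> - (1 / 2) * (1 - 2 * \<kappa>) * info d B \<sigma>
    + 24 * \<gamma>\<^sup>2 / \<kappa> * (4 * \<alpha> * v / real n + bias_bound \<eta>)"
    by (intro exponent_half_le \<eta>' Q v \<kappa>)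
qed simp

lemma prob_misled_le_small:
  assumes valid: "valid_init d K Init" and i: "i \<in> {1..n}" and \<eta>: "0 < \<eta>" "4 * \<alpha> * \<eta> \<le> 1"
    and d: "0 < d" and v: "0 \<le> v" and l: "0 < l" "l \<le> 1 / 2"
    and small: "2 * l * log_range (4 * \<alpha> * v / real n) \<le> 1"
  shows "misled_prob \<eta> Init i
    \<le> 2 * exp (label_entropy \<eta> - v / 4)
      + exp (- l / 2 * info d B \<sigma> + 240 * \<gamma>\<^sup>2 * (4 * \<alpha> * v / real n)
        + 192 * \<gamma>\<^sup>2 * bias_bound \<eta> * l)"
proof (rule prob_misled_le[OF valid i \<eta> d l(1)])
  have \<eta>': "0 \<le> \<eta>" "\<eta> \<le> 1" using mult_right_mono[of 1 "4 * \<alpha>" \<eta>] \<eta> \<alpha> by linarith+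
  fix a b Za sa Zb sb and x :: layers
  assume "a \<in> {1, 2}" "b \<in> {1, 2}" "a \<noteq> b" "near \<eta> a Za sa" "near \<eta> b Zb sb"
    "deviation Za sa (block_avg d Za sa (counts x)) < v"
    "deviation Zb sb (block_avg d Zb sb (counts x)) < v"
  then show "exponent l a (block_avg d Za sa (counts x))
        (block_avg d Zb sb (counts x)) \<le> - l / 2 * info d B \<sigma> + 240 * \<gamma>\<^sup>2 * (4 * \<alpha> * v / real n)
        + 192 * \<gamma>\<^sup>2 * bias_bound \<eta> * l"
    by (intro exponent_small_le \<eta>' v l small)
qed

text \<open>
  Off the two small sets where the runs \<open>1\<close> and \<open>i\<close> mislabel, the cluster of layer \<open>i\<close> in run \<open>i\<close>
  is the true class of \<open>i\<close>, which run \<open>1\<close> labels \<open>\<pi>1 (z i)\<close>.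
\<close>

lemma two_stage_label:
  assumes zloo: "zloo = (\<lambda>i j. if j = i then c i else ztil n d Init x i j)"
    and i: "i \<in> {2..n}" and al: "aligned \<eta> Init x 1 \<pi>1" "aligned \<eta> Init x i \<pi>"
    and c: "c i = \<pi> (z i)" and \<eta>: "8 * \<alpha> * \<eta> < 1"
    and zh: "is_arg_max (\<lambda>m. card ({j \<in> {1..n}. zloo 1 j = m} \<inter> {j \<in> {1..n}. zloo i j = zloo i i}))
        (\<lambda>m. m \<in> {1, 2}) zh"
  shows "zh = \<pi>1 (z i)"
proof (rule ccontr)
  assume ne: "zh \<noteq> \<pi>1 (z i)"
  define F where "F m = {j \<in> {1..n}. zloo 1 j = m} \<inter> {j \<in> {1..n}. zloo i j = zloo i i}" for m
  define D where "D = {j \<in> {1..n}. ztil n d Init x 1 j \<noteq> (\<pi>1 \<circ> z) j} \<union> {j \<in> {1..n}. ztil n d Init x i j \<noteq> (\<pi> \<circ> z) j}"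
  have \<pi>: "\<pi>1 permutes {1, 2}" "\<pi> permutes {1, 2}" using al by (auto simp: aligned_def)
  have iz: "i \<in> {1..n}" using i by auto
  then have iz: "i \<in> {1..n}" "z i \<in> {1, 2}" using z_in by blast+
  have \<pi>z: "\<pi>1 (z j) \<in> {1, 2}" "\<pi> (z j) \<in> {1, 2}" if "j \<in> {1..n}" for j
    using permutes_in_image[OF \<pi>(1), of "z j"] permutes_in_image[OF \<pi>(2), of "z j"] z_in[OF that] by auto
  have fD: "finite D" by (simp add: D_def)
  have D: "real (card D) \<le> 2 * (\<eta> * real n)"
  proof -
    have "card D \<le> card {j \<in> {1..n}. ztil n d Init x 1 j \<noteq> (\<pi>1 \<circ> z) j} + card {j \<in> {1..n}. ztil n d Init x i j \<noteq> (\<pi> \<circ> z) j}"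
      unfolding D_def by (rule card_Un_le)
    moreover have "real (card {j \<in> {1..n}. ztil n d Init x 1 j \<noteq> (\<pi>1 \<circ> z) j}) \<le> \<eta> * real n"
      "real (card {j \<in> {1..n}. ztil n d Init x i j \<noteq> (\<pi> \<circ> z) j}) \<le> \<eta> * real n"
      using al n unfolding aligned_def by (simp_all only: mismatch_le_iff)
    ultimately show ?thesis by linarith
  qed
  have good: "zloo 1 j = \<pi>1 (z j)" "zloo i j = zloo i i \<longleftrightarrow> z j = z i" if "j \<in> {1..n} - D" for j
  proof -
    have zt: "ztil n d Init x 1 j = \<pi>1 (z j)" "ztil n d Init x i j = \<pi> (z j)"
      using that by (auto simp: D_def)
    \<comment> \<open>Layer 1 carries the dummy label 0 in run 1 and so belongs to \<open>D\<close>;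
      likewise layer \<open>i\<close> for run \<open>i\<close>.\<close>
    have "j \<noteq> 1" using zt(1) \<pi>z(1)[of j] that by (auto simp: ztil_def)
    then show "zloo 1 j = \<pi>1 (z j)" using zt by (simp add: zloo)
    have "j \<noteq> i" using zt(2) \<pi>z(2)[of j] that by (auto simp: ztil_def)
    then show "zloo i j = zloo i i \<longleftrightarrow> z j = z i"
      using zt c permutes_inj[OF \<pi>(2)] by (simp add: zloo inj_eq)
  qed
  have "{j \<in> {1..n}. z j = z i} \<subseteq> F (\<pi>1 (z i)) \<union> D"
    using good by (auto simp: F_def)
  then have "card {j \<in> {1..n}. z j = z i} \<le> card (F (\<pi>1 (z i)) \<union> D)"
    using fD by (intro card_mono) (auto simp: F_def)
  also have "\<dots> \<le> card (F (\<pi>1 (z i))) + card D" by (rule card_Un_le)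
  finally have "real (card {j \<in> {1..n}. z j = z i}) \<le> real (card (F (\<pi>1 (z i)))) + real (card D)"
    by (simp flip: of_nat_add)
  moreover have "real n / (2 * \<alpha>) \<le> real (card {j \<in> {1..n}. z j = z i})"
    using Theta iz(2) by (auto simp: Theta_def)
  moreover have "F zh \<subseteq> D"
  proof (rule subsetI, rule ccontr)
    fix j assume j: "j \<in> F zh" "j \<notin> D"
    then have jD: "j \<in> {1..n} - D" by (simp add: F_def)
    have "zloo 1 j = zh" "zloo i j = zloo i i" using j by (auto simp: F_def)
    then show False using good[OF jD] ne by simp
  qed
  then have "real (card (F zh)) \<le> real (card D)" using fD by (simp add: card_mono)
  moreover have "card (F (\<pi>1 (z i))) \<le> card (F zh)"
    using zh \<pi>z(1)[OF iz(1)] by (auto simp: is_arg_max_def F_def not_less)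
  then have "real (card (F (\<pi>1 (z i)))) \<le> real (card (F zh))" by simp
  \<comment> \<open>The correct label collects at least n / (2 \<alpha>) - |D| layers, the other at
    most |D|, and |D| <= 2 \<eta> n. This is the origin of 8 \<alpha> \<eta> < 1.\<close>
  moreover have "4 * (\<eta> * real n) < real n / (2 * \<alpha>)"
  proof -
    have "(8 * \<alpha> * \<eta>) * real n < 1 * real n" using \<eta> n by (intro mult_strict_right_mono) auto
    then show ?thesis using \<alpha> by (simp add: field_simps)
  qed
  ultimately show False using D by linarith
qed

text \<open>The consensus step translates the labels of every run into those of run 1, so the one
  permutation \<open>\<pi> 1\<close> is right for all layers that are not misled.\<close>

lemma hloss_two_stage_le:
  assumes out: "two_stage_output n d Init x zhat"
    and al: "\<And>i. i \<in> {1..n} \<Longrightarrow> \<exists>\<pi>. aligned \<eta> Init x i \<pi>" and \<eta>: "8 * \<alpha> * \<eta> < 1"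
  shows "hloss n 2 zhat z \<le> real (card {i \<in> {1..n}. misled \<eta> Init x i}) / real n"
proof -
  define \<pi> where "\<pi> = alignment \<eta> Init x"
  have \<pi>: "aligned \<eta> Init x i (\<pi> i)" if "i \<in> {1..n}" for i
    unfolding \<pi>_def using al[OF that] by (rule aligned_alignment)
  have perm: "\<pi> i permutes {1, 2}" if "i \<in> {1..n}" for i
    using \<pi>[OF that] by (simp add: aligned_def)
  obtain c zloo where zloo: "zloo = (\<lambda>i j. if j = i then c i else ztil n d Init x i j)"
    and c: "\<And>i. i \<in> {1..n} \<Longrightarrow> is_arg_max (loglik n d Init x i) (\<lambda>m. m \<in> {1, 2}) (c i)"
    and z1: "zhat 1 = zloo 1 1"
    and zi: "\<And>i. i \<in> {2..n} \<Longrightarrow> is_arg_max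
        (\<lambda>m. card ({j \<in> {1..n}. zloo 1 j = m} \<inter> {j \<in> {1..n}. zloo i j = zloo i i}))
        (\<lambda>m. m \<in> {1, 2}) (zhat i)"
    using out unfolding two_stage_output_def Let_def by blast
  have one: "1 \<in> {1..n}" using n by auto
  have correct: "c i = \<pi> i (z i)" if i: "i \<in> {1..n}" "\<not> misled \<eta> Init x i" for i
  proof (rule ccontr)
    assume ne: "c i \<noteq> \<pi> i (z i)"
    have zi: "z i = 1 \<or> z i = 2" using z_in[OF i(1)] by simp
    have ci: "c i \<in> {1, 2}" using c[OF i(1)] by (simp add: is_arg_max_def)
    have "\<pi> i ` {1, 2} = {1, 2}" by (rule permutes_image[OF perm[OF i(1)]])
    then have "{\<pi> i 1, \<pi> i 2} = {1, 2}" by simp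
    then have "c i = \<pi> i (3 - z i)" "\<pi> i (z i) \<in> {1, 2}"
      using zi ci ne by (auto simp: doubleton_eq_iff)
    then have "loglik n d Init x i (\<pi> i (z i)) \<le> loglik n d Init x i (\<pi> i (3 - z i))"
      using c[OF i(1)] by (auto simp: is_arg_max_def not_less)
    then have "misled \<eta> Init x i" using al[OF i(1)] by (auto simp: misled_def \<pi>_def)
    then show False using i(2) by simp
  qed
  have zh: "zhat i = \<pi> 1 (z i)" if i: "i \<in> {1..n}" "\<not> misled \<eta> Init x i" for i
  proof (cases "i = 1")
    case True
    then show ?thesis using z1 correct[OF i] by (simp add: zloo)
  next
    case False
    then have i2: "i \<in> {2..n}" using i(1) by auto
    show ?thesis
      by (rule two_stage_label[OF zloo i2 \<pi>[OF one] \<pi>[OF i(1)] correct[OF i] \<eta> zi[OF i2]])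
  qed
  have "{1..2 :: nat} = {1, 2}" by auto
  then have "\<pi> 1 permutes {1..2}" using perm[OF one] by simp
  moreover have "mismatch n zhat (\<pi> 1 \<circ> z) \<le> real (card {i \<in> {1..n}. misled \<eta> Init x i}) / real n"
  proof -
    have "card {i \<in> {1..n}. zhat i \<noteq> (\<pi> 1 \<circ> z) i} \<le> card {i \<in> {1..n}. misled \<eta> Init x i}"
      using zh by (intro card_mono) auto
    then show ?thesis using n by (simp add: mismatch_le_iff)
  qed
  ultimately show ?thesis unfolding hloss_le_iff by blast
qed

end

section \<open>From misled layers to the loss on the sample space\<close>

lemma good_init_cong:
  assumes "\<And>j \<omega>. j \<in> {1..n} \<Longrightarrow> \<omega> \<in> {1..d} \<times> {1..d} \<Longrightarrow> x j \<omega> = x' j \<omega>"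
  shows "good_init n d K z \<sigma> \<eta>z \<eta>\<sigma> Init x = good_init n d K z \<sigma> \<eta>z \<eta>\<sigma> Init x'"
proof -
  have "ztil n d Init x i = ztil n d Init x' i" "sigtil n d Init x i = sigtil n d Init x' i" for i
    using assms by (intro ztil_cong sigtil_cong; simp)+
  then show ?thesis by (simp add: good_init_def)
qed

context block_model
begin

lemma misled_cong:
  assumes "i \<in> {1..n}" and "\<And>j \<omega>. j \<in> {1..n} \<Longrightarrow> \<omega> \<in> {1..d} \<times> {1..d} \<Longrightarrow> x j \<omega> = x' j \<omega>"
  shows "misled \<eta> Init x i = misled \<eta> Init x' i"
proof -
  have 1: "aligned \<eta> Init x i = aligned \<eta> Init x' i"
    using assms(2) by (intro aligned_cong) simp
  have "Phat n d Init x i m = Phat n d Init x' i m" for m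
    using assms(2) by (intro Phat_cong) simp
  then have 2: "loglik n d Init x i m = loglik n d Init x' i m" for m
    unfolding loglik_def using assms J_subset[of d] by (intro sum.cong refl) auto
  show ?thesis by (simp add: misled_def alignment_def 1 2)
qed

lemma good_init_aligned:
  assumes "good_init n d K z \<sigma> \<eta>z \<eta>\<sigma> Init x" "\<eta>z \<le> \<eta>" "\<eta>\<sigma> \<le> \<eta>" "i \<in> {1..n}"
  shows "\<exists>\<pi>. aligned \<eta> Init x i \<pi>"
  using assms unfolding good_init_def aligned_def by (meson order_trans)

end

text \<open>The bound \<open>p\<close> on the probability of misleading a layer is left open, so
  that the passage to the loss is made once for both regimes.\<close>

locale sampled_block_model = block_model +
  fixes M :: "'w measure" and X :: "nat \<Rightarrow> nat \<times> nat \<Rightarrow> 'w \<Rightarrow> nat" and Init :: init_alg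
    and zhat :: "'w \<Rightarrow> nat \<Rightarrow> nat" and \<eta>z \<eta>\<sigma> \<eta> p :: real and E :: "'w \<Rightarrow> bool"
  assumes model: "poisson_block_model n d z B \<sigma> M X"
    and out: "\<And>w. w \<in> space M \<Longrightarrow> two_stage_output n d Init (\<lambda>i \<omega>. X i \<omega> w) (zhat w)"
    and zhat_measurable: "\<And>i. i \<in> {1..n} \<Longrightarrow> (\<lambda>w. zhat w i) \<in> measurable M (count_space UNIV)"
    and E: "\<And>w. E w = good_init n d K z \<sigma> \<eta>z \<eta>\<sigma> Init (\<lambda>i \<omega>. X i \<omega> w)"
    and \<eta>: "\<eta>z \<le> \<eta>" "\<eta>\<sigma> \<le> \<eta>" "8 * \<alpha> * \<eta> < 1"
    and p: "\<And>i. i \<in> {1..n} \<Longrightarrow> misled_prob \<eta> Init i \<le> p"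
begin

sublocale prob_space M
  using model by (simp add: poisson_block_model_def)

definition data :: "'w \<Rightarrow> nat \<times> nat \<times> nat \<Rightarrow> nat" where
  "data w = (\<lambda>a. if a \<in> {1..n} \<times> J d then (case a of (i, \<omega>) \<Rightarrow> X i \<omega>) w else 0)"

lemma data_event: "{w \<in> space M. data w \<in> H} \<in> sets M"
  "prob {w \<in> space M. data w \<in> H} = measure_pmf.prob data_pmf H"
proof -
  have *: "distr M (count_space UNIV) (case a of (i, \<omega>) \<Rightarrow> X i \<omega>)
      = measure_pmf (case a of (i, \<omega>) \<Rightarrow> poisson_pmf (P (z i) \<omega>))" if "a \<in> {1..n} \<times> J d" for a
    using model that by (auto simp: poisson_block_model_def P_def)
  have indep: "indep_vars (\<lambda>_. count_space UNIV) (\<lambda>(i, \<omega>). X i \<omega>) ({1..n} \<times> J d)"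
    using model by (simp add: poisson_block_model_def)
  note tr = prob_eq_Pi_pmf[OF prob_space_axioms _ indep *, where dflt = 0 and H = H]
  show "{w \<in> space M. data w \<in> H} \<in> sets M" unfolding data_def by (rule tr(1)) auto
  show "prob {w \<in> space M. data w \<in> H} = measure_pmf.prob data_pmf H"
    unfolding data_def data_pmf_def by (rule tr(2)) auto
qed

lemma layers_of_data:
  assumes "w \<in> space M" "i \<in> {1..n}" "\<omega> \<in> {1..d} \<times> {1..d}"
  shows "layers_of (data w) i \<omega> = X i \<omega> w"
proof -
  obtain j k where \<omega>: "\<omega> = (j, k)" by (cases \<omega>)
  have "X i (j, k) w = X i (k, j) w"
    using model assms by (auto simp: poisson_block_model_def \<omega>)
  then have "X i (canon \<omega>) w = X i \<omega> w" by (auto simp: canon_def \<omega> min_def max_def)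
  then show ?thesis using canon_in_J[OF assms(3)] assms(2) by (simp add: layers_of_def data_def)
qed

lemma E_event: "{w \<in> space M. E w} \<in> sets M"
proof -
  have "{w \<in> space M. E w} = {w \<in> space M. data w \<in> {f. good_init n d K z \<sigma> \<eta>z \<eta>\<sigma> Init (layers_of f)}}"
  proof (rule Collect_cong, rule conj_cong[OF refl])
    fix w assume w: "w \<in> space M"
    show "E w = (data w \<in> {f. good_init n d K z \<sigma> \<eta>z \<eta>\<sigma> Init (layers_of f)})"
      unfolding E mem_Collect_eq using layers_of_data[OF w] by (intro good_init_cong) simp
  qed
  then show ?thesis by (simp only: data_event(1))
qed

definition Mis :: "nat \<Rightarrow> 'w set" where
  "Mis i = {w \<in> space M. misled \<eta> Init (\<lambda>i \<omega>. X i \<omega> w) i}"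

lemma Mis: "i \<in> {1..n} \<Longrightarrow> Mis i \<in> sets M" "i \<in> {1..n} \<Longrightarrow> prob (Mis i) \<le> p"
proof -
  assume i: "i \<in> {1..n}"
  have "Mis i = {w \<in> space M. data w \<in> {f. misled \<eta> Init (layers_of f) i}}"
    unfolding Mis_def
  proof (rule Collect_cong, rule conj_cong[OF refl])
    fix w assume w: "w \<in> space M"
    show "misled \<eta> Init (\<lambda>i \<omega>. X i \<omega> w) i = (data w \<in> {f. misled \<eta> Init (layers_of f) i})"
      unfolding mem_Collect_eq using layers_of_data[OF w] by (intro misled_cong i) simp
  qed
  then show "Mis i \<in> sets M" "prob (Mis i) \<le> p" using p[OF i] by (simp_all only: data_event)
qed

text \<open>A majorant of the loss on the good event that is determined by the data, however
  \<open>zhat\<close> breaks ties, and whose mean is bounded layer by layer.\<close>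

definition errors :: "'w \<Rightarrow> real" where
  "errors w = (\<Sum>i\<in>{1..n}. indicator (Mis i) w) / real n"

lemma errors: "integrable M errors" "(\<integral>w. errors w \<partial>M) \<le> p" "0 \<le> errors w"
proof -
  show "integrable M errors"
    unfolding errors_def using Mis(1)
    by (intro integrable_divide_zero Bochner_Integration.integrable_sum integrable_real_indicator) (auto simp: less_top[symmetric])
  have "(\<integral>w. errors w \<partial>M) = (\<Sum>i\<in>{1..n}. prob (Mis i)) / real n"
  proof -
    have "integrable M (indicat_real (Mis i))" if "i \<in> {1..n}" for i
      using Mis(1)[OF that] by (intro integrable_real_indicator) (auto simp: less_top[symmetric])
    then have "(\<integral>w. (\<Sum>i\<in>{1..n}. indicat_real (Mis i) w) \<partial>M) = (\<Sum>i\<in>{1..n}. prob (Mis i \<inter> space M))"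
      by (subst Bochner_Integration.integral_sum) auto
    also have "\<dots> = (\<Sum>i\<in>{1..n}. prob (Mis i))"
      by (intro sum.cong refl arg_cong[where f = prob]) (auto simp: Mis_def)
    finally show ?thesis by (simp add: errors_def)
  qed
  also have "\<dots> \<le> (\<Sum>i\<in>{1..n}. p) / real n"
    using Mis(2) by (intro divide_right_mono sum_mono) auto
  also have "\<dots> = p" using n by simp
  finally show "(\<integral>w. errors w \<partial>M) \<le> p" .
  show "0 \<le> errors w" unfolding errors_def by (intro divide_nonneg_nonneg sum_nonneg) auto
qed

lemma hloss_le_errors:
  assumes "w \<in> space M" "E w"
  shows "hloss n 2 (zhat w) z \<le> errors w"
proof -
  have "hloss n 2 (zhat w) z \<le> real (card {i \<in> {1..n}. misled \<eta> Init (\<lambda>i \<omega>. X i \<omega> w) i}) / real n"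
    using assms \<eta> good_init_aligned[OF assms(2)[unfolded E] \<eta>(1,2)]
    by (intro hloss_two_stage_le out) auto
  also have "real (card {i \<in> {1..n}. misled \<eta> Init (\<lambda>i \<omega>. X i \<omega> w) i}) = (\<Sum>i\<in>{1..n}. indicator (Mis i) w)"
    using assms(1) by (simp add: indicator_def Mis_def sum.If_cases Int_def of_bool_def)
  finally show ?thesis by (simp add: errors_def)
qed

lemma expectation_hloss_le: "(\<integral>w. hloss n 2 (zhat w) z \<partial>M) \<le> (1 - prob {w \<in> space M. E w}) + p"
proof (cases "integrable M (\<lambda>w. hloss n 2 (zhat w) z)")
  \<comment> \<open>The Bochner integral of a nonintegrable function is 0, and the right-hand side
    is nonnegative.\<close>
  case False
  have "0 \<le> (\<integral>w. errors w \<partial>M)" using errors(3) by (intro integral_nonneg_AE) simp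
  then show ?thesis using False errors(2) prob_le_1[of "{w \<in> space M. E w}"]
    by (simp add: not_integrable_integral_eq)
next
  case True
  have "(\<integral>w. hloss n 2 (zhat w) z \<partial>M) \<le> (\<integral>w. (1 - indicator {w \<in> space M. E w} w) + errors w \<partial>M)"
  proof (rule integral_mono[OF True])
    show "integrable M (\<lambda>w. (1 - indicator {w \<in> space M. E w} w) + errors w)"
      using errors(1) E_event
      by (intro Bochner_Integration.integrable_add Bochner_Integration.integrable_diff
          integrable_real_indicator) (auto simp: less_top[symmetric])
    fix w assume "w \<in> space M"
    then show "hloss n 2 (zhat w) z \<le> (1 - indicator {w \<in> space M. E w} w) + errors w"
      using hloss_le_errors[of w] hloss_le_1[of n 2 "zhat w" z] errors(3)[of w] by (cases "E w") auto
  qed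
  also have "\<dots> = (1 - prob {w \<in> space M. E w}) + (\<integral>w. errors w \<partial>M)"
  proof -
    have "integrable M (indicat_real {w \<in> space M. E w})"
      using E_event by (intro integrable_real_indicator) (auto simp: less_top[symmetric])
    then show ?thesis
      using errors(1) by (subst Bochner_Integration.integral_add)
        (auto simp: prob_space Collect_conj_eq intro!: arg_cong[where f = prob])
  qed
  finally show ?thesis using errors(2) by linarith
qed

lemma hloss_event: "{w \<in> space M. hloss n 2 (zhat w) z \<le> c} \<in> sets M"
proof -
  have m: "(\<lambda>w. mismatch n (zhat w) (\<pi> \<circ> z)) \<in> borel_measurable M" for \<pi>
    unfolding mismatch_def
    by (intro borel_measurable_divide borel_measurable_sum borel_measurable_const
        measurable_compose[OF zhat_measurable, of _ "\<lambda>k. of_bool (k \<noteq> _)"]) auto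
  have "{w \<in> space M. hloss n 2 (zhat w) z \<le> c}
     = (\<Union>\<pi>\<in>{\<pi>. \<pi> permutes {1..2}}. {w \<in> space M. mismatch n (zhat w) (\<pi> \<circ> z) \<le> c})"
    by (auto simp: hloss_le_iff)
  also have "\<dots> \<in> sets M"
    using m by (intro sets.finite_UN) (auto intro: finite_permutations)
  finally show ?thesis .
qed

text \<open>Markov's inequality at level \<open>c'\<close>; conditioning on an event of probability
  at least 1/2 costs the factor 2. The two levels are kept apart because \<open>errors\<close> has
  gaps in its range: exceeding \<open>c\<close> may force a much larger value.\<close>

lemma cond_prob_hloss_ge_aux:
  assumes c': "0 < c'" and half: "1 / 2 \<le> prob {w \<in> space M. E w}"
    and sup: "\<And>w. w \<in> space M \<Longrightarrow> E w \<Longrightarrow> c < errors w \<Longrightarrow> c' \<le> errors w"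
  shows "1 - 2 * p / c' \<le> \<P>(w in M. hloss n 2 (zhat w) z \<le> c \<bar> E w)"
proof -
  have E_pos: "0 < prob {w \<in> space M. E w}" using half by linarith
  have "prob ({w \<in> space M. E w} - {w \<in> space M. hloss n 2 (zhat w) z \<le> c}) \<le> prob {w \<in> space M. c' \<le> errors w}"
  proof (rule finite_measure_mono)
    show "{w \<in> space M. E w} - {w \<in> space M. hloss n 2 (zhat w) z \<le> c} \<subseteq> {w \<in> space M. c' \<le> errors w}"
      using hloss_le_errors sup by fastforce
    show "{w \<in> space M. c' \<le> errors w} \<in> sets M"
      using borel_measurable_integrable[OF errors(1)] by measurable
  qed
  also have "\<dots> \<le> (\<integral>w. errors w \<partial>M) / c'"
    using errors c' by (intro integral_Markov_inequality_measure[where A = "space M", simplified]) auto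
  also have "\<dots> \<le> p / c'" using errors(2) c' by (intro divide_right_mono) auto
  finally have bad: "prob ({w \<in> space M. E w} - {w \<in> space M. hloss n 2 (zhat w) z \<le> c}) \<le> p / c'" .
  have "prob {w \<in> space M. E w} - prob {w \<in> space M. hloss n 2 (zhat w) z \<le> c \<and> E w}
      = prob ({w \<in> space M. E w} - {w \<in> space M. hloss n 2 (zhat w) z \<le> c})"
  proof -
    have "{w \<in> space M. hloss n 2 (zhat w) z \<le> c \<and> E w} = {w \<in> space M. E w} \<inter> {w \<in> space M. hloss n 2 (zhat w) z \<le> c}"
      by auto
    then show ?thesis using E_event hloss_event by (simp add: finite_measure_Diff')
  qed
  then have "1 - \<P>(w in M. hloss n 2 (zhat w) z \<le> c \<bar> E w)
     = prob ({w \<in> space M. E w} - {w \<in> space M. hloss n 2 (zhat w) z \<le> c}) / prob {w \<in> space M. E w}"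
    unfolding cond_prob_def using E_pos by (simp add: field_simps)
  also have "\<dots> \<le> (p / c') / (1 / 2)"
    using bad half E_pos by (intro frac_le) (auto intro: order_trans[OF measure_nonneg])
  finally show ?thesis by simp
qed

lemma cond_prob_hloss_ge:
  assumes "0 < c" "1 / 2 \<le> prob {w \<in> space M. E w}"
  shows "1 - 2 * p / c \<le> \<P>(w in M. hloss n 2 (zhat w) z \<le> c \<bar> E w)"
  using assms by (intro cond_prob_hloss_ge_aux) auto

text \<open>\<open>errors\<close> is a multiple of 1 / n, so Markov's inequality may be applied at 1
  / n however small \<open>c\<close> is.\<close>

lemma cond_prob_hloss_ge_count:
  assumes "0 \<le> c" "1 / 2 \<le> prob {w \<in> space M. E w}"
  shows "1 - 2 * p * real n \<le> \<P>(w in M. hloss n 2 (zhat w) z \<le> c \<bar> E w)"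
proof -
  have "1 / real n \<le> errors w" if "c < errors w" for w
  proof -
    have "(\<Sum>i\<in>{1..n}. indicat_real (Mis i) w) \<noteq> 0" using that assms(1) by (auto simp: errors_def)
    then obtain i where i: "i \<in> {1..n}" "indicat_real (Mis i) w \<noteq> 0" by (meson sum.neutral)
    have "1 = indicat_real (Mis i) w" using i(2) by (auto simp: indicator_def)
    also have "\<dots> \<le> (\<Sum>i\<in>{1..n}. indicat_real (Mis i) w)" using i(1) by (intro member_le_sum) auto
    finally show ?thesis by (simp add: errors_def divide_right_mono)
  qed
  then have "1 - 2 * p / (1 / real n) \<le> \<P>(w in M. hloss n 2 (zhat w) z \<le> c \<bar> E w)"
    using assms n by (intro cond_prob_hloss_ge_aux) auto
  then show ?thesis by simp
qed

end

section \<open>The two regimes\<close>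

text \<open>The 7 collects 4 from the layer labels and 3 from the K^2 blocks; 2 / sqrt C0 comes from
  the node labels.\<close>

definition entropy_coeff :: "real \<Rightarrow> real \<Rightarrow> real" where
  "entropy_coeff \<gamma> C0 = 7 * \<gamma> + 2 / sqrt C0"

text \<open>The summand 2 stems from the factor 1 - 2 \<kappa> at \<kappa> = sqrt q. The rest is
  twice the coefficient of sqrt q I in the cost of estimation, as the rate is written (1 - D sqrt q)
  I / 2.\<close>

definition rate_coeff :: "real \<Rightarrow> real \<Rightarrow> real" where
  "rate_coeff \<alpha> \<gamma> = 2 + 48 * \<gamma>\<^sup>2 * (4 * \<alpha> + (32 * \<alpha>\<^sup>2 + 4) * \<gamma>\<^sup>2)"

lemma sqrt_le_self:
  fixes x :: real
  assumes "1 \<le> x"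
  shows "sqrt x \<le> x"
  using real_sqrt_le_mono[OF self_le_power[OF assms, of 2]] assms by simp

text \<open>
  The parameter \<open>q\<close> tends to \<open>0\<close> in the application.  It is the fourth root of
  \<open>\<eta> K\<^sup>2 d\<^sup>2 \<theta> / I\<close>.  The assumption \<open>1 \<le> \<eta> n\<close> is forced by the dummy entry of \<open>ztil\<close>,
  which always counts as an error.
\<close>

locale scaled_block_model = block_model +
  fixes q \<eta> C0 :: real and Init :: init_alg
  assumes valid: "valid_init d K Init" and d: "0 < d" and C0: "0 < C0" "C0 \<le> \<theta>"
    and q: "0 < q" "q \<le> 1 / 4"
    and \<eta>_eq: "\<eta> * (real K)\<^sup>2 * (real d)\<^sup>2 * \<theta> = q ^ 4 * info d B \<sigma>"
    and \<eta>n: "1 \<le> \<eta> * real n" and info_ge_1: "1 \<le> info d B \<sigma>" and \<eta>\<alpha>: "4 * \<alpha> * \<eta> \<le> 1"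
begin

abbreviation "I \<equiv> info d B \<sigma>"

lemma K: "1 \<le> real K"
proof -
  have "\<sigma> 1 1 \<in> {1..K}" using d by (intro \<sigma>_in) auto
  then show ?thesis by simp
qed

lemma n_pos: "1 \<le> real n" using n by simp

lemma \<eta>_pos: "0 < \<eta>"
proof (rule ccontr)
  assume "\<not> 0 < \<eta>"
  then have "\<eta> * real n \<le> 0" by (intro mult_nonpos_nonneg) auto
  then show False using \<eta>n by linarith
qed

lemma info_le: "I \<le> \<gamma> * \<theta> * (real d)\<^sup>2"
proof -
  have "I = hellinger d (P 1) (P 2)" by (simp add: info_def P_def)
  also have "\<dots> \<le> (\<Sum>\<omega>\<in>J d. \<gamma> * \<theta>)"
    by (intro sum_mono sqrt_P_diff_le) auto
  also have "\<dots> \<le> \<gamma> * \<theta> * (real d)\<^sup>2" using card_J_le[of d] \<gamma> \<theta> by (simp add: mult.commute mult_right_mono)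
  finally show ?thesis .
qed

lemma q4: "0 < q ^ 4" "q ^ 4 \<le> q\<^sup>2" "q ^ 4 \<le> q" "q ^ 4 \<le> 1"
  using q power_decreasing[of 2 4 q] power_decreasing[of 1 4 q] power_decreasing[of 0 4 q] by auto

text \<open>Multiplying the defining equation of \<open>q\<close> by n and using \<eta> n >= 1 turns
  the smallness of \<eta> into a lower bound on n.\<close>

lemma scale_info: "(real K)\<^sup>2 * (real d)\<^sup>2 * \<theta> \<le> q ^ 4 * (real n * I)"
proof -
  have "1 * ((real K)\<^sup>2 * (real d)\<^sup>2 * \<theta>) \<le> (\<eta> * real n) * ((real K)\<^sup>2 * (real d)\<^sup>2 * \<theta>)"
    using \<eta>n \<theta> by (intro mult_right_mono) auto
  also have "\<dots> = (\<eta> * (real K)\<^sup>2 * (real d)\<^sup>2 * \<theta>) * real n" by simp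
  also have "\<dots> = q ^ 4 * (real n * I)" unfolding \<eta>_eq by simp
  finally show ?thesis by simp
qed

lemma scale_K: "(real K)\<^sup>2 \<le> \<gamma> * q ^ 4 * real n"
proof -
  have pos: "0 < (real d)\<^sup>2 * \<theta>" using d \<theta> by simp
  have "(real K)\<^sup>2 * ((real d)\<^sup>2 * \<theta>) \<le> q ^ 4 * (real n * I)" using scale_info by (simp add: mult_ac)
  also have "\<dots> \<le> q ^ 4 * (real n * (\<gamma> * \<theta> * (real d)\<^sup>2))"
    using info_le q4 by (intro mult_left_mono) auto
  also have "\<dots> = (\<gamma> * q ^ 4 * real n) * ((real d)\<^sup>2 * \<theta>)" by simp
  finally show ?thesis using pos by (rule mult_right_le_imp_le)
qed

lemma scale_\<eta>: "\<eta> \<le> \<gamma> * q ^ 4"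
proof -
  have pos: "0 < (real d)\<^sup>2 * \<theta>" using d \<theta> by simp
  have "\<eta> * ((real d)\<^sup>2 * \<theta>) = 1 * (\<eta> * ((real d)\<^sup>2 * \<theta>))" by simp
  also have "\<dots> \<le> (real K)\<^sup>2 * (\<eta> * ((real d)\<^sup>2 * \<theta>))"
    using K \<eta>_pos \<theta> by (intro mult_right_mono) auto
  also have "\<dots> = q ^ 4 * I" using \<eta>_eq by (simp add: mult_ac)
  also have "\<dots> \<le> q ^ 4 * (\<gamma> * \<theta> * (real d)\<^sup>2)" using info_le q4 by (intro mult_left_mono) auto
  also have "\<dots> = (\<gamma> * q ^ 4) * ((real d)\<^sup>2 * \<theta>)" by simp
  finally show ?thesis using pos by (rule mult_right_le_imp_le)
qed

lemma scale_bias: "\<theta> * (real d)\<^sup>2 * \<eta> \<le> q ^ 4 * I"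
proof -
  have "1 * (\<theta> * (real d)\<^sup>2 * \<eta>) \<le> (real K)\<^sup>2 * (\<theta> * (real d)\<^sup>2 * \<eta>)"
    using K \<eta>_pos \<theta> by (intro mult_right_mono) auto
  also have "\<dots> = q ^ 4 * I" using \<eta>_eq by (simp add: mult_ac)
  finally show ?thesis by simp
qed

abbreviation "A \<equiv> entropy_coeff \<gamma> C0"

lemma A_pos: "0 < A" using \<gamma> C0 by (simp add: entropy_coeff_def add_pos_pos)

text \<open>Each part is small for its own reason: \<eta> <= \<gamma> q^4 for the layer labels, K^2
  <= \<gamma> q^4 n for the blocks, and K^2 d^2 \<eta> = q^4 I / \<theta>, by which the node labels
  cost only a multiple of q^2 sqrt I however large d is.\<close>

lemma label_entropy_le: "label_entropy \<eta> \<le> A * q\<^sup>2 * (real n + sqrt I)"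
proof -
  have I0: "0 \<le> sqrt I" using info_ge_1 by simp
  have g: "sqrt \<gamma> \<le> \<gamma>" using \<gamma> by (rule sqrt_le_self)
  have q22: "sqrt (q ^ 4) = q\<^sup>2" using real_sqrt_unique[of "q\<^sup>2" "q ^ 4"] by simp
  have "sqrt \<eta> \<le> sqrt (\<gamma> * q ^ 4)" using scale_\<eta> by (rule real_sqrt_le_mono)
  also have "\<dots> = sqrt \<gamma> * q\<^sup>2" by (simp add: real_sqrt_mult q22)
  also have "\<dots> \<le> \<gamma> * q\<^sup>2" using g by (intro mult_right_mono) auto
  finally have "4 * real n * sqrt \<eta> \<le> 4 * real n * (\<gamma> * q\<^sup>2)" by (intro mult_left_mono) auto
  moreover have "3 * (real K)\<^sup>2 \<le> 3 * (\<gamma> * q\<^sup>2 * real n)"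
  proof -
    have "\<gamma> * q ^ 4 * real n \<le> \<gamma> * q\<^sup>2 * real n"
      using q4(2) \<gamma> by (intro mult_right_mono mult_left_mono) auto
    then show ?thesis using scale_K by linarith
  qed
  moreover have "(real K + 1) * real d * sqrt \<eta> \<le> 2 / sqrt C0 * (q\<^sup>2 * sqrt I)"
  proof -
    have "(real K + 1) * real d * sqrt \<eta> \<le> (2 * real K) * real d * sqrt \<eta>"
      using K \<eta>_pos by (intro mult_right_mono) auto
    also have "\<dots> = 2 * sqrt ((real K)\<^sup>2 * (real d)\<^sup>2 * \<eta>)"
      by (simp add: real_sqrt_mult)
    also have "(real K)\<^sup>2 * (real d)\<^sup>2 * \<eta> = q ^ 4 * I / \<theta>"
      using \<eta>_eq \<theta> by (simp add: field_simps)
    also have "2 * sqrt (q ^ 4 * I / \<theta>) \<le> 2 * sqrt (q ^ 4 * I / C0)"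
      using C0 q4 info_ge_1 by (intro mult_left_mono real_sqrt_le_mono divide_left_mono) auto
    also have "\<dots> = 2 / sqrt C0 * (q\<^sup>2 * sqrt I)" by (simp add: real_sqrt_mult real_sqrt_divide q22)
    finally show ?thesis .
  qed
  moreover have "0 \<le> 7 * \<gamma> * (q\<^sup>2 * sqrt I)" "0 \<le> 2 / sqrt C0 * (q\<^sup>2 * real n)"
    using \<gamma> I0 C0 by (intro mult_nonneg_nonneg; simp)+
  ultimately have "label_entropy \<eta> \<le> 7 * \<gamma> * (q\<^sup>2 * real n) + 2 / sqrt C0 * (q\<^sup>2 * sqrt I)
      + 7 * \<gamma> * (q\<^sup>2 * sqrt I) + 2 / sqrt C0 * (q\<^sup>2 * real n)"
    unfolding label_entropy_def by (simp add: mult_ac)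
  also have "\<dots> = A * q\<^sup>2 * (real n + sqrt I)" by (simp add: entropy_coeff_def algebra_simps add_divide_distrib)
  finally show ?thesis .
qed

lemma n_large: "1 \<le> \<gamma> * q ^ 4 * real n"
  using scale_K K one_le_power[OF K, of 2] by linarith

abbreviation "D \<equiv> rate_coeff \<alpha> \<gamma>"

lemma sqrt_info_le: "sqrt I \<le> I"
  using info_ge_1 by (rule sqrt_le_self)

lemma prob_misled_few:
  assumes i: "i \<in> {1..n}" and regime: "256 * \<alpha> * I \<le> real n * \<theta>"
    and q1: "16 * A * q \<le> 1" and q2: "8 * \<gamma> * q ^ 3 \<le> 1"
    and q3: "256 * \<alpha> * A * q\<^sup>2 * (1 / C0 + 1) \<le> 1"
  shows "misled_prob \<eta> Init i \<le> 3 * exp (- (1 - D * sqrt q) * I / 2)"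
proof -
  \<comment> \<open>The first entry keeps v / n below q I, which becomes sqrt q I after division by
    \<kappa> = sqrt q; the second gives 16 \<alpha> v < \<theta> n and so excludes low entries.
    Either way v / 4 exceeds the entropy by at least I.\<close>
  define v where "v = min (real n * q * I) (real n * \<theta> / (32 * \<alpha>))"
  have I1: "1 \<le> I" by (rule info_ge_1)
  have v0: "0 \<le> v" using q I1 \<theta> \<alpha> by (simp add: v_def)
  have v1: "v \<le> real n * q * I" "v \<le> real n * \<theta> / (32 * \<alpha>)" by (auto simp: v_def)
  have "16 * \<alpha> * v \<le> 16 * \<alpha> * (real n * \<theta> / (32 * \<alpha>))" using v1(2) \<alpha> by (intro mult_left_mono) auto
  also have "\<dots> = real n * \<theta> / 2" using \<alpha> by simp
  also have "\<dots> < \<theta> * real n" using n \<theta> by simp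
  finally have v2: "16 * \<alpha> * v < \<theta> * real n" .
  have \<kappa>: "0 < sqrt q" "sqrt q \<le> 1 / 2" using q real_sqrt_le_mono[OF q(2)] by (auto simp: real_sqrt_divide)
  note main = prob_misled_le_half[OF valid i \<eta>_pos \<eta>\<alpha> d v0 v2 \<kappa>]
  have "exp (label_entropy \<eta> - v / 4) \<le> exp (- I)"
  proof -
    have "label_entropy \<eta> - v / 4 \<le> - I"
    proof (cases "real n * q * I \<le> real n * \<theta> / (32 * \<alpha>)")
      case True
      then have v: "v = real n * q * I" by (simp add: v_def)
      have "real n + sqrt I \<le> 2 * (real n * I)"
      proof -
        have "real n * 1 \<le> real n * I" using I1 by (intro mult_left_mono) auto
        moreover have "1 * sqrt I \<le> real n * I"
          using sqrt_info_le n_pos I1 by (intro mult_mono) auto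
        ultimately show ?thesis by linarith
      qed
      then have "A * q\<^sup>2 * (real n + sqrt I) \<le> A * q\<^sup>2 * (2 * (real n * I))"
        using A_pos by (intro mult_left_mono) auto
      also have "\<dots> = (16 * A * q) * (real n * q * I) / 8" by (simp add: power2_eq_square)
      also have "\<dots> \<le> 1 * (real n * q * I) / 8"
        using q1 q I1 by (intro divide_right_mono mult_right_mono) auto
      finally have e: "label_entropy \<eta> - v / 4 \<le> - (real n * q * I / 8)" using label_entropy_le unfolding v by linarith
      \<comment> \<open>From \<gamma> q^4 n >= 1 and small q follows n q >= 8, so that n q I / 8,
        which remains after paying the entropy, is at least I.\<close>
      have "8 * \<gamma> * q ^ 3 \<le> \<gamma> * q ^ 4 * real n" using q2 n_large by linarith
      also have "\<dots> = (\<gamma> * q ^ 3) * (real n * q)" by (simp add: power_numeral_reduce)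
      finally have "(\<gamma> * q ^ 3) * 8 \<le> (\<gamma> * q ^ 3) * (real n * q)" by (simp add: mult_ac)
      then have "8 \<le> real n * q" by (rule mult_left_le_imp_le) (use \<gamma> q in simp)
      then have "8 * I \<le> real n * q * I" using I1 by (intro mult_right_mono) auto
      then show ?thesis using e by linarith
    next
      case False
      then have v: "v = real n * \<theta> / (32 * \<alpha>)" by (simp add: v_def)
      have I\<theta>: "I \<le> real n * \<theta>"
      proof -
        have "1 * I \<le> 256 * \<alpha> * I" using \<alpha> I1 by (intro mult_right_mono) auto
        then show ?thesis using regime by linarith
      qed
      have "real n * C0 \<le> real n * \<theta>" using C0 by (intro mult_left_mono) auto
      then have "real n \<le> real n * \<theta> * (1 / C0)" using C0 by (simp add: field_simps)
      then have "real n + sqrt I \<le> real n * \<theta> * (1 / C0 + 1)"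
        using I\<theta> sqrt_info_le by (simp add: distrib_left)
      then have "A * q\<^sup>2 * (real n + sqrt I) \<le> A * q\<^sup>2 * (real n * \<theta> * (1 / C0 + 1))"
        using A_pos by (intro mult_left_mono) auto
      also have "\<dots> = (256 * \<alpha> * A * q\<^sup>2 * (1 / C0 + 1)) * (real n * \<theta> / (256 * \<alpha>))"
        using \<alpha> by simp
      also have "\<dots> \<le> 1 * (real n * \<theta> / (256 * \<alpha>))"
        using q3 \<theta> \<alpha> by (intro mult_right_mono) auto
      finally have "label_entropy \<eta> - v / 4 \<le> real n * \<theta> / (256 * \<alpha>) - v / 4" using label_entropy_le by linarith
      also have "\<dots> \<le> - (real n * \<theta> / (256 * \<alpha>))" unfolding v using \<alpha> \<theta> by (simp add: field_simps)
      \<comment> \<open>The regime enters here: v / 4 is n \<theta> / (128 \<alpha>); half of it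
        pays for the entropy, and the other half is at least I.\<close>
      also have "\<dots> \<le> - I" using regime \<alpha> by (simp add: field_simps)
      finally show ?thesis .
    qed
    then show ?thesis by simp
  qed
  moreover have "exp (- I) \<le> exp (- (1 - D * sqrt q) * I / 2)"
  proof -
    have "0 \<le> D * sqrt q" using \<alpha> q by (simp add: rate_coeff_def)
    then have "(1 - D * sqrt q) * I \<le> 2 * I" using I1 by (intro mult_right_mono) auto
    then have "- I \<le> - (1 - D * sqrt q) * I / 2" unfolding mult_minus_left by linarith
    then show ?thesis by simp
  qed
  moreover have "exp (- (1 / 2) * (1 - 2 * sqrt q) * I
    + 24 * \<gamma>\<^sup>2 / sqrt q * (4 * \<alpha> * v / real n + bias_bound \<eta>))
    \<le> exp (- (1 - D * sqrt q) * I / 2)"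
  proof -
    have "4 * \<alpha> * v / real n \<le> 4 * \<alpha> * (real n * q * I) / real n"
      using v1(1) \<alpha> by (intro divide_right_mono mult_left_mono) auto
    also have "\<dots> = 4 * \<alpha> * (q * I)" using n by simp
    finally have 1: "4 * \<alpha> * v / real n \<le> 4 * \<alpha> * (q * I)" .
    have "\<theta> * (real d)\<^sup>2 * \<eta> \<le> q * I"
      using scale_bias mult_right_mono[OF q4(3), of I] I1 by linarith
    then have 2: "bias_bound \<eta> \<le> (32 * \<alpha>\<^sup>2 + 4) * \<gamma>\<^sup>2 * (q * I)"
      by (intro mult_left_mono) auto
    have "24 * \<gamma>\<^sup>2 / sqrt q * (4 * \<alpha> * v / real n + bias_bound \<eta>)
      \<le> 24 * \<gamma>\<^sup>2 / sqrt q * (4 * \<alpha> * (q * I) + (32 * \<alpha>\<^sup>2 + 4) * \<gamma>\<^sup>2 * (q * I))"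
      using q by (intro mult_left_mono add_mono 1 2) auto
    also have "\<dots> = 24 * \<gamma>\<^sup>2 * (4 * \<alpha> + (32 * \<alpha>\<^sup>2 + 4) * \<gamma>\<^sup>2) * ((q / sqrt q) * I)"
      by (simp add: algebra_simps)
    also have "q / sqrt q = sqrt q" using q by (simp add: real_div_sqrt)
    finally have *: "24 * \<gamma>\<^sup>2 / sqrt q * (4 * \<alpha> * v / real n + bias_bound \<eta>)
      \<le> 24 * \<gamma>\<^sup>2 * (4 * \<alpha> + (32 * \<alpha>\<^sup>2 + 4) * \<gamma>\<^sup>2) * (sqrt q * I)" .
    define W where "W = 24 * \<gamma>\<^sup>2 * (4 * \<alpha> + (32 * \<alpha>\<^sup>2 + 4) * \<gamma>\<^sup>2)"
    have "D = 2 + 2 * W" by (simp add: rate_coeff_def W_def)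
    then have "- (1 / 2) * (1 - 2 * sqrt q) * I + W * (sqrt q * I) = - (1 - D * sqrt q) * I / 2"
      by (simp add: field_simps)
    then show ?thesis using * unfolding W_def[symmetric] exp_le_cancel_iff by linarith
  qed
  ultimately show ?thesis using main by linarith
qed

lemma prob_misled_many:
  assumes i: "i \<in> {1..n}" and regime: "real n * \<theta> < 256 * \<alpha> * I"
    and L: "1 \<le> ln I" and I1: "16 * A * (ln I)\<^sup>2 \<le> sqrt I"
    and I2: "256 * \<alpha> / C0 * (256 * \<alpha> / C0\<^sup>2) * (1 + 8 * \<alpha> + 512 * \<alpha> * \<gamma>) \<le> I"
    and I3: "76800 * \<gamma>\<^sup>2 * \<alpha> \<le> ln I"
    and q1: "1536 * \<gamma>\<^sup>2 * ((32 * \<alpha>\<^sup>2 + 4) * \<gamma>\<^sup>2) * q ^ 4 \<le> 1"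
  shows "misled_prob \<eta> Init i \<le> 3 * exp (- I / (40 * (ln I)\<^sup>2))"
proof -
  define L where "L = ln I"
  have L1: "1 \<le> L" "1 \<le> L\<^sup>2" using L one_le_power[of L 2] by (auto simp: L_def)
  have Ige: "1 \<le> I" by (rule info_ge_1)
  \<comment> \<open>v / n = I / L^2 is smaller by an order of L than the gain l I / 2 = I / (20 L),
    while v still exceeds the entropy, of order n sqrt I.\<close>
  define v where "v = real n * I / L\<^sup>2"
  \<comment> \<open>As \<open>log_range\<close> will be at most ln (I ^ 5) = 5 L, this is the value
    with 2 l * 5 L = 1.\<close>
  define l where "l = 1 / (10 * L)"
  have v0: "0 \<le> v" using Ige by (simp add: v_def)
  have vn: "v / real n = I / L\<^sup>2" using n by (simp add: v_def)
  have l: "0 < l" "l \<le> 1 / 2" using L1 by (auto simp: l_def field_simps)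
  have \<tau>: "4 * \<alpha> * v / real n = 4 * \<alpha> * (I / L\<^sup>2)" unfolding vn[symmetric] by simp
  have IL: "I / L\<^sup>2 \<le> I" using L1 Ige by (simp add: field_simps mult_le_cancel_left1)
  have nI: "real n \<le> 256 * \<alpha> / C0 * I"
  proof -
    have "real n * C0 \<le> real n * \<theta>" using C0 by (intro mult_left_mono) auto
    then have "real n * C0 \<le> 256 * \<alpha> * I" using regime by linarith
    then show ?thesis using C0 by (simp add: field_simps)
  qed
  have \<theta>I: "\<theta> \<le> 256 * \<alpha> * I"
    using mult_right_mono[OF n_pos, of \<theta>] \<theta> regime by linarith
  have dI: "(real d)\<^sup>2 \<le> 256 * \<alpha> / C0\<^sup>2 * I\<^sup>2"
  proof -
    have "(real d)\<^sup>2 * C0 \<le> (real d)\<^sup>2 * \<theta>" using C0 by (intro mult_left_mono) auto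
    also have "\<dots> \<le> (real K)\<^sup>2 * ((real d)\<^sup>2 * \<theta>)"
      using mult_right_mono[OF one_le_power[OF K, of 2], of "(real d)\<^sup>2 * \<theta>"] \<theta> by simp
    also have "\<dots> \<le> q ^ 4 * (real n * I)" using scale_info by (simp add: mult_ac)
    also have "\<dots> \<le> 1 * (real n * I)" using q4 Ige by (intro mult_right_mono) auto
    also have "\<dots> \<le> (256 * \<alpha> / C0 * I) * I" using mult_right_mono[OF nI, of I] Ige by simp
    finally show ?thesis using C0 by (simp add: field_simps power2_eq_square)
  qed
  have "real n * (real d)\<^sup>2 * (1 + (2 * (4 * \<alpha> * v / real n) + 2 * \<gamma> * \<theta>))
    \<le> (256 * \<alpha> / C0 * I) * (256 * \<alpha> / C0\<^sup>2 * I\<^sup>2) * ((1 + 8 * \<alpha> + 512 * \<alpha> * \<gamma>) * I)"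
  proof (intro mult_mono nI dI)
    have "2 * (4 * \<alpha> * v / real n) \<le> 8 * \<alpha> * I"
      unfolding \<tau> using mult_left_mono[OF IL, of "8 * \<alpha>"] \<alpha> by simp
    moreover have "2 * \<gamma> * \<theta> \<le> 2 * \<gamma> * (256 * \<alpha> * I)" using \<theta>I \<gamma> by (intro mult_left_mono) auto
    ultimately show "1 + (2 * (4 * \<alpha> * v / real n) + 2 * \<gamma> * \<theta>) \<le> (1 + 8 * \<alpha> + 512 * \<alpha> * \<gamma>) * I"
      using Ige by (simp add: algebra_simps)
    show "0 \<le> 1 + (2 * (4 * \<alpha> * v / real n) + 2 * \<gamma> * \<theta>)"
      using \<alpha> \<gamma> \<theta> v0 by (intro add_nonneg_nonneg) auto
  qed (use \<alpha> C0 Ige in auto)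
  also have "\<dots> = (256 * \<alpha> / C0 * (256 * \<alpha> / C0\<^sup>2) * (1 + 8 * \<alpha> + 512 * \<alpha> * \<gamma>)) * I ^ 4"
    by (simp add: power2_eq_square power4_eq_xxxx)
  \<comment> \<open>One more power of I absorbs the constant in \<alpha>, \<gamma> and C0.\<close>
  also have "\<dots> \<le> I * I ^ 4" using I2 Ige by (intro mult_right_mono) auto
  also have "\<dots> = I ^ 5" by (simp add: power_numeral_reduce)
  finally have X: "real n * (real d)\<^sup>2 * (1 + (2 * (4 * \<alpha> * v / real n) + 2 * \<gamma> * \<theta>)) \<le> I ^ 5" .
  have "0 < real n * (real d)\<^sup>2 * (1 + (2 * (4 * \<alpha> * v / real n) + 2 * \<gamma> * \<theta>))"
    using n d \<alpha> \<gamma> \<theta> v0 by (intro mult_pos_pos add_pos_nonneg add_nonneg_nonneg) auto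
  then have "log_range (4 * \<alpha> * v / real n) \<le> ln (I ^ 5)"
    using X by (intro ln_mono) auto
  also have "\<dots> = 5 * L" using Ige by (simp add: ln_realpow L_def)
  finally have "2 * l * log_range (4 * \<alpha> * v / real n) \<le> 2 * l * (5 * L)"
    using l by (intro mult_left_mono) auto
  also have "\<dots> = 1" using L1 by (simp add: l_def)
  finally have small: "2 * l * log_range (4 * \<alpha> * v / real n) \<le> 1" .
  note main = prob_misled_le_small[OF valid i \<eta>_pos \<eta>\<alpha> d v0 l small]
  have "exp (label_entropy \<eta> - v / 4) \<le> exp (- I / (40 * L\<^sup>2))"
  proof -
    have "real n + sqrt I \<le> 2 * (real n * sqrt I)"
    proof -
      have "real n * 1 \<le> real n * sqrt I" using Ige by (intro mult_left_mono) auto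
      moreover have "1 * sqrt I \<le> real n * sqrt I" using n_pos Ige by (intro mult_right_mono) auto
      ultimately show ?thesis by linarith
    qed
    moreover have "A * q\<^sup>2 \<le> A * 1" using q A_pos power_le_one[of q 2] by (intro mult_left_mono) auto
    ultimately have "A * q\<^sup>2 * (real n + sqrt I) \<le> A * 1 * (2 * (real n * sqrt I))"
      using A_pos Ige by (intro mult_mono) auto
    also have "\<dots> = (16 * A * L\<^sup>2) * (real n * sqrt I / (8 * L\<^sup>2))" using L1 by simp
    also have "\<dots> \<le> sqrt I * (real n * sqrt I / (8 * L\<^sup>2))"
      using I1 Ige L1 by (intro mult_right_mono) (auto simp: L_def)
    also have "\<dots> = v / 8"
      using Ige by (simp add: v_def mult_ac)
    finally have "label_entropy \<eta> - v / 4 \<le> - v / 8" using label_entropy_le by linarith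
    also have "\<dots> = - (real n * (I / L\<^sup>2)) / 8" by (simp add: v_def)
    also have "\<dots> \<le> - (1 * (I / L\<^sup>2)) / 8"
      using n_pos Ige by (intro divide_right_mono le_imp_neg_le mult_right_mono) auto
    also have "\<dots> \<le> - I / (40 * L\<^sup>2)" using Ige L1 by (simp add: field_simps)
    finally show ?thesis by simp
  qed
  moreover have "exp (- l / 2 * I + 240 * \<gamma>\<^sup>2 * (4 * \<alpha> * v / real n)
        + 192 * \<gamma>\<^sup>2 * bias_bound \<eta> * l) \<le> exp (- I / (40 * L\<^sup>2))"
  proof -
    \<comment> \<open>The thresholds in the hypotheses make each of the two error terms at most I /
      (80 L), a quarter of the gain: 76800 = 240 * 4 * 80 and 1536 = 192 * 80 / 10.\<close>
    have "240 * \<gamma>\<^sup>2 * (4 * \<alpha> * v / real n) = (76800 * \<gamma>\<^sup>2 * \<alpha>) * (I / (80 * L\<^sup>2))"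
      unfolding \<tau> by simp
    also have "\<dots> \<le> L * (I / (80 * L\<^sup>2))"
      using I3 Ige by (intro mult_right_mono) (auto simp: L_def)
    also have "\<dots> = I / (80 * L)" using L1 by (simp add: power2_eq_square)
    finally have 1: "240 * \<gamma>\<^sup>2 * (4 * \<alpha> * v / real n) \<le> I / (80 * L)" .
    have "192 * \<gamma>\<^sup>2 * bias_bound \<eta> * l
       \<le> 192 * \<gamma>\<^sup>2 * ((32 * \<alpha>\<^sup>2 + 4) * \<gamma>\<^sup>2 * (q ^ 4 * I)) * l"
      using l scale_bias by (intro mult_right_mono mult_left_mono) auto
    also have "\<dots> = (1536 * \<gamma>\<^sup>2 * ((32 * \<alpha>\<^sup>2 + 4) * \<gamma>\<^sup>2) * q ^ 4) * (I / (80 * L))"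
      by (simp add: l_def)
    also have "\<dots> \<le> 1 * (I / (80 * L))" using q1 Ige L1 by (intro mult_right_mono) auto
    finally have "- l / 2 * I + 240 * \<gamma>\<^sup>2 * (4 * \<alpha> * v / real n)
        + 192 * \<gamma>\<^sup>2 * bias_bound \<eta> * l \<le> - l / 2 * I + I / (80 * L) + I / (80 * L)"
      using 1 by linarith
    also have "\<dots> = - (I / (40 * L))" using L1 by (simp add: l_def field_simps)
    also have "\<dots> \<le> - I / (40 * L\<^sup>2)"
    proof -
      have "L \<le> L\<^sup>2" using L1 by (simp add: power2_eq_square)
      then have "I / (40 * L\<^sup>2) \<le> I / (40 * L)" using L1 Ige by (intro divide_left_mono) auto
      then show ?thesis by simp
    qed
    finally show ?thesis by simp
  qed
  ultimately show ?thesis using main unfolding L_def by linarith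
qed

end

section \<open>Asymptotics\<close>

lemma ln_square_div_sqrt_tendsto: "((\<lambda>x::real. (ln x)\<^sup>2 / sqrt x) \<longlongrightarrow> 0) at_top"
  by real_asymp

lemma exp_div_ln_tendsto: "((\<lambda>x::real. exp (- x / (2 * ln x))) \<longlongrightarrow> 0) at_top"
  by real_asymp

lemma square_exp_div_ln_square_tendsto:
  "((\<lambda>x::real. x\<^sup>2 * exp (- x / (40 * (ln x)\<^sup>2))) \<longlongrightarrow> 0) at_top"
  by real_asymp

lemma exp_div_ln_powr_tendsto:
  fixes \<epsilon> :: real
  assumes "0 < \<epsilon>" "\<epsilon> < 1"
  shows "((\<lambda>x::real. exp (- x / (2 * ln x) + x powr (1 - \<epsilon>))) \<longlongrightarrow> 0) at_top"
  using assms by real_asymp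

lemma exp_div_ln_square_powr_tendsto:
  fixes \<epsilon> :: real
  assumes "0 < \<epsilon>" "\<epsilon> < 1"
  shows "((\<lambda>x::real. x * exp (- x / (40 * (ln x)\<^sup>2) + x powr (1 - \<epsilon>))) \<longlongrightarrow> 0) at_top"
  using assms by real_asymp

lemma eventually_le_const:
  fixes f :: "'a \<Rightarrow> real"
  assumes "(f \<longlongrightarrow> 0) F" "0 < c"
  shows "\<forall>\<^sub>F x in F. f x \<le> c"
  using order_tendstoD(2)[OF assms] by (rule eventually_mono) simp

text \<open>The dummy entry 0 is never a class label, so run 1 has at least one error under every
  permutation.\<close>

lemma (in block_model) good_init_ge:
  assumes "good_init n d K z \<sigma> \<eta>z \<eta>\<sigma> Init x"
  shows "1 \<le> \<eta>z * real n"
proof -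
  have one: "1 \<in> {1..n}" using n by auto
  then obtain \<pi> where \<pi>: "\<pi> permutes {1, 2}" "mismatch n (ztil n d Init x 1) (\<pi> \<circ> z) \<le> \<eta>z"
    using assms unfolding good_init_def by blast
  have "\<pi> (z 1) \<in> {1, 2}" using permutes_in_image[OF \<pi>(1), of "z 1"] z_in[OF one] by simp
  then have "1 \<in> {i \<in> {1..n}. ztil n d Init x 1 i \<noteq> (\<pi> \<circ> z) i}" using one by (auto simp: ztil_def)
  then have "0 < card {i \<in> {1..n}. ztil n d Init x 1 i \<noteq> (\<pi> \<circ> z) i}" by (subst card_gt_0_iff) auto
  then have "1 \<le> real (card {i \<in> {1..n}. ztil n d Init x 1 i \<noteq> (\<pi> \<circ> z) i})" by linarith
  also have "\<dots> \<le> \<eta>z * real n" using \<pi>(2) n by (simp only: mismatch_le_iff)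
  finally show ?thesis .
qed

text \<open>
  Everything that depends on the index of the sequence only through \<open>I \<rightarrow> \<infinity>\<close>
  and \<open>q \<rightarrow> 0\<close>.
\<close>

definition admissible :: "real \<Rightarrow> real \<Rightarrow> real \<Rightarrow> real \<Rightarrow> real \<Rightarrow> bool" where
  "admissible \<alpha> \<gamma> C0 I q \<longleftrightarrow> q \<le> 1 / 4 \<and> 16 * entropy_coeff \<gamma> C0 * q \<le> 1 \<and> 8 * \<gamma> * q ^ 3 \<le> 1 \<and>
     256 * \<alpha> * entropy_coeff \<gamma> C0 * q\<^sup>2 * (1 / C0 + 1) \<le> 1 \<and>
     1536 * \<gamma>\<^sup>2 * ((32 * \<alpha>\<^sup>2 + 4) * \<gamma>\<^sup>2) * q ^ 4 \<le> 1 \<and>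
     1 \<le> I \<and> 1 \<le> ln I \<and> 16 * entropy_coeff \<gamma> C0 * (ln I)\<^sup>2 \<le> sqrt I \<and>
     256 * \<alpha> / C0 * (256 * \<alpha> / C0\<^sup>2) * (1 + 8 * \<alpha> + 512 * \<alpha> * \<gamma>) \<le> I \<and>
     76800 * \<gamma>\<^sup>2 * \<alpha> \<le> ln I \<and>
     3 * exp (- I / (2 * ln I)) \<le> 1 \<and> 3 * (256 * \<alpha> / C0)\<^sup>2 * (I\<^sup>2 * exp (- I / (40 * (ln I)\<^sup>2))) \<le> 1"

lemma eventually_admissible:
  assumes I: "filterlim I at_top F" and q: "(q \<longlongrightarrow> 0) F" and \<alpha>: "1 \<le> \<alpha>" and \<gamma>: "1 \<le> \<gamma>" and C0: "0 < C0"
  shows "\<forall>\<^sub>F t in F. admissible \<alpha> \<gamma> C0 (I t) (q t)"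
proof -
  have A: "0 < entropy_coeff \<gamma> C0" using \<gamma> C0 by (simp add: entropy_coeff_def add_pos_pos)
  have small: "\<forall>\<^sub>F t in F. c * q t ^ k \<le> 1" if "0 < k" for c k
  proof (rule eventually_le_const)
    have "((\<lambda>t. c * q t ^ k) \<longlongrightarrow> c * 0 ^ k) F" by (intro tendsto_intros q)
    then show "((\<lambda>t. c * q t ^ k) \<longlongrightarrow> 0) F" using that by (simp add: power_0_left)
  qed simp
  have lnI: "filterlim (\<lambda>t. ln (I t)) at_top F" using ln_at_top I by (rule filterlim_compose)
  have large: "\<forall>\<^sub>F t in F. c \<le> I t" "\<forall>\<^sub>F t in F. c \<le> ln (I t)" for c
    using I lnI by (auto simp: filterlim_at_top)
  have comp: "\<forall>\<^sub>F t in F. f (I t) \<le> c" if "(f \<longlongrightarrow> 0) at_top" "0 < c" for f :: "real \<Rightarrow> real" and c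
    using filterlim_compose[OF that(1) I] that(2) by (rule eventually_le_const)
  have e1: "\<forall>\<^sub>F t in F. (ln (I t))\<^sup>2 / sqrt (I t) \<le> 1 / (16 * entropy_coeff \<gamma> C0)"
    using A by (intro comp[OF ln_square_div_sqrt_tendsto]) simp
  have e2: "\<forall>\<^sub>F t in F. exp (- I t / (2 * ln (I t))) \<le> 1 / 3"
    by (intro comp[OF exp_div_ln_tendsto]) simp
  have e3: "\<forall>\<^sub>F t in F. (I t)\<^sup>2 * exp (- I t / (40 * (ln (I t))\<^sup>2)) \<le> 1 / (3 * (256 * \<alpha> / C0)\<^sup>2)"
    using \<alpha> C0 by (intro comp[OF square_exp_div_ln_square_tendsto]) simp
  show ?thesis
    using small[OF zero_less_one, of 4] small[OF zero_less_one, of "16 * entropy_coeff \<gamma> C0"] small[of 3, OF zero_less_numeral, of "8 * \<gamma>"]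
      small[of 2, OF zero_less_numeral, of "256 * \<alpha> * entropy_coeff \<gamma> C0 * (1 / C0 + 1)"]
      small[of 4, OF zero_less_numeral, of "1536 * \<gamma>\<^sup>2 * ((32 * \<alpha>\<^sup>2 + 4) * \<gamma>\<^sup>2)"]
      large(1)[of 1] large(2)[of 1] e1
      large(1)[of "256 * \<alpha> / C0 * (256 * \<alpha> / C0\<^sup>2) * (1 + 8 * \<alpha> + 512 * \<alpha> * \<gamma>)"]
      large(2)[of "76800 * \<gamma>\<^sup>2 * \<alpha>"] e2 e3
  proof eventually_elim
    case (elim t)
    have "0 < sqrt (I t)" using elim(6) by simp
    then have "16 * entropy_coeff \<gamma> C0 * (ln (I t))\<^sup>2 \<le> sqrt (I t)"
      using elim(8) A by (simp add: field_simps)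
    moreover have "3 * (256 * \<alpha> / C0)\<^sup>2 * ((I t)\<^sup>2 * exp (- I t / (40 * (ln (I t))\<^sup>2))) \<le> 1"
    proof -
      have c: "0 < 3 * (256 * \<alpha> / C0)\<^sup>2" using \<alpha> C0 by simp
      show ?thesis using mult_left_mono[OF elim(12) less_imp_le[OF c]] c by simp
    qed
    moreover have "256 * \<alpha> * entropy_coeff \<gamma> C0 * (q t)\<^sup>2 * (1 / C0 + 1) \<le> 1"
      using elim(4) by (simp only: mult_ac)
    ultimately show ?case unfolding admissible_def using elim by simp
  qed
qed

section \<open>Loss bounds covering both regimes\<close>

locale scaled_sampled_model = scaled_block_model +
  fixes M :: "'w measure" and X :: "nat \<Rightarrow> nat \<times> nat \<Rightarrow> 'w \<Rightarrow> nat"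
    and zhat :: "'w \<Rightarrow> nat \<Rightarrow> nat" and \<eta>z \<eta>\<sigma> :: real and E :: "'w \<Rightarrow> bool"
  assumes model: "poisson_block_model n d z B \<sigma> M X"
    and out: "\<And>w. w \<in> space M \<Longrightarrow> two_stage_output n d Init (\<lambda>i \<omega>. X i \<omega> w) (zhat w)"
    and zhat_measurable: "\<And>i. i \<in> {1..n} \<Longrightarrow> (\<lambda>w. zhat w i) \<in> measurable M (count_space UNIV)"
    and E: "\<And>w. E w = good_init n d K z \<sigma> \<eta>z \<eta>\<sigma> Init (\<lambda>i \<omega>. X i \<omega> w)"
    and \<eta>: "\<eta>z \<le> \<eta>" "\<eta>\<sigma> \<le> \<eta>" "8 * \<alpha> * \<eta> < 1"
    and admissible: "admissible \<alpha> \<gamma> C0 I q"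
    and half: "1 / 2 \<le> measure M {w \<in> space M. E w}"
begin

text \<open>The summand 1 / ln I leaves a factor exp (- I / (2 ln I)) between the error probability
  and the target rate. It absorbs the constant 3 and, through Markov's inequality, yields the
  conditional probability.\<close>

definition \<delta> :: real where "\<delta> = D * sqrt q + 1 / ln I"

lemma sampled:
  assumes "\<And>i. i \<in> {1..n} \<Longrightarrow> misled_prob \<eta> Init i \<le> p"
  shows "sampled_block_model n d K z B \<sigma> \<theta> \<alpha> \<beta> \<gamma> M X Init zhat \<eta>z \<eta>\<sigma> \<eta> p E"
  using model out zhat_measurable E \<eta> assms by unfold_locales

lemma few:
  assumes "256 * \<alpha> * I \<le> real n * \<theta>"
  shows "sampled_block_model n d K z B \<sigma> \<theta> \<alpha> \<beta> \<gamma> M X Init zhat \<eta>z \<eta>\<sigma> \<eta>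
    (3 * exp (- (1 - D * sqrt q) * I / 2)) E"
  using assms admissible unfolding admissible_def by (intro sampled prob_misled_few) auto

lemma many:
  assumes "\<not> 256 * \<alpha> * I \<le> real n * \<theta>"
  shows "sampled_block_model n d K z B \<sigma> \<theta> \<alpha> \<beta> \<gamma> M X Init zhat \<eta>z \<eta>\<sigma> \<eta>
    (3 * exp (- I / (40 * (ln I)\<^sup>2))) E"
  using assms admissible unfolding admissible_def by (intro sampled prob_misled_many) auto

lemma many_n_le:
  assumes "\<not> 256 * \<alpha> * I \<le> real n * \<theta>"
  shows "real n \<le> 256 * \<alpha> / C0 * I"
proof -
  have "real n * C0 \<le> real n * \<theta>" using C0 by (intro mult_left_mono) auto
  then have "real n * C0 \<le> 256 * \<alpha> * I" using assms by linarith
  then show ?thesis using C0 by (simp add: field_simps)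
qed

lemma few_rate:
  "3 * exp (- (1 - D * sqrt q) * I / 2) = (3 * exp (- I / (2 * ln I))) * exp (- (1 - \<delta>) * I / 2)"
proof -
  have "1 \<le> ln I" using admissible unfolding admissible_def by blast
  then have "0 < ln I" by linarith
  then have "- (1 - D * sqrt q) * I / 2 = - I / (2 * ln I) + - (1 - \<delta>) * I / 2"
    by (simp add: \<delta>_def field_simps)
  then show ?thesis by (simp only: exp_add mult.assoc)
qed

text \<open>If n \<theta> >= 256 \<alpha> I, the exponential term covers the error probability.
  Otherwise n = O(I), the error probability is below n^-2, and it enters the remainder.\<close>

lemma expectation_le:
  "(\<integral>w. hloss n 2 (zhat w) z \<partial>M) \<le> exp (- (1 - \<delta>) * I / 2)
     + ((1 - measure M {w \<in> space M. E w}) + real n powr (- 2))"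
proof (cases "256 * \<alpha> * I \<le> real n * \<theta>")
  case True
  interpret S: sampled_block_model n d K z B \<sigma> \<theta> \<alpha> \<beta> \<gamma> M X Init zhat \<eta>z \<eta>\<sigma> \<eta>
    "3 * exp (- (1 - D * sqrt q) * I / 2)" E
    by (rule few[OF True])
  have "3 * exp (- I / (2 * ln I)) * exp (- (1 - \<delta>) * I / 2) \<le> 1 * exp (- (1 - \<delta>) * I / 2)"
    using admissible unfolding admissible_def by (intro mult_right_mono) auto
  then show ?thesis using S.expectation_hloss_le unfolding few_rate by (smt (verit) powr_ge_zero)
next
  case False
  interpret S: sampled_block_model n d K z B \<sigma> \<theta> \<alpha> \<beta> \<gamma> M X Init zhat \<eta>z \<eta>\<sigma> \<eta>
    "3 * exp (- I / (40 * (ln I)\<^sup>2))" E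
    by (rule many[OF False])
  have "real n powr 2 * (3 * exp (- I / (40 * (ln I)\<^sup>2)))
      \<le> (256 * \<alpha> / C0 * I)\<^sup>2 * (3 * exp (- I / (40 * (ln I)\<^sup>2)))"
    using many_n_le[OF False] by (intro mult_right_mono) (auto simp: powr_numeral)
  also have "\<dots> = 3 * (256 * \<alpha> / C0)\<^sup>2 * (I\<^sup>2 * exp (- I / (40 * (ln I)\<^sup>2)))"
    by (simp add: power_mult_distrib power_divide)
  also have "\<dots> \<le> 1" using admissible by (simp add: admissible_def)
  finally have "3 * exp (- I / (40 * (ln I)\<^sup>2)) \<le> real n powr (- 2)"
    using n by (simp add: powr_minus field_simps)
  moreover have "0 \<le> exp (- (1 - \<delta>) * I / 2)" by simp
  ultimately show ?thesis using S.expectation_hloss_le by linarith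
qed

text \<open>In the first regime Markov's inequality is applied at the target level itself. In the
  second the absence of any misled layer is bounded instead, at the cost of a factor n =
  O(I).\<close>

lemma cond_prob_ge:
  assumes few': "6 * exp (- I / (2 * ln I) + I powr (1 - \<epsilon>)) \<le> 1"
    and many': "6 * (256 * \<alpha> / C0) * (I * exp (- I / (40 * (ln I)\<^sup>2) + I powr (1 - \<epsilon>))) \<le> 1"
  shows "1 - exp (- (I powr (1 - \<epsilon>))) \<le> \<P>(w in M. hloss n 2 (zhat w) z \<le> exp (- (1 - \<delta>) * I / 2) \<bar> E w)"
proof (cases "256 * \<alpha> * I \<le> real n * \<theta>")
  case True
  interpret S: sampled_block_model n d K z B \<sigma> \<theta> \<alpha> \<beta> \<gamma> M X Init zhat \<eta>z \<eta>\<sigma> \<eta>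
    "3 * exp (- (1 - D * sqrt q) * I / 2)" E
    by (rule few[OF True])
  have "2 * (3 * exp (- (1 - D * sqrt q) * I / 2)) / exp (- (1 - \<delta>) * I / 2) = 6 * exp (- I / (2 * ln I))"
    unfolding few_rate by simp
  also have "\<dots> \<le> exp (- (I powr (1 - \<epsilon>)))"
    using few' unfolding exp_add exp_minus by (simp add: field_simps)
  finally show ?thesis
    using S.cond_prob_hloss_ge[of "exp (- (1 - \<delta>) * I / 2)"] half by simp
next
  case False
  interpret S: sampled_block_model n d K z B \<sigma> \<theta> \<alpha> \<beta> \<gamma> M X Init zhat \<eta>z \<eta>\<sigma> \<eta>
    "3 * exp (- I / (40 * (ln I)\<^sup>2))" E
    by (rule many[OF False])
  have "2 * (3 * exp (- I / (40 * (ln I)\<^sup>2))) * real n \<le> 2 * (3 * exp (- I / (40 * (ln I)\<^sup>2))) * (256 * \<alpha> / C0 * I)"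
    using many_n_le[OF False] by (intro mult_left_mono) auto
  also have "\<dots> \<le> exp (- (I powr (1 - \<epsilon>)))"
    using many' unfolding exp_add exp_minus by (simp add: field_simps)
  finally show ?thesis
    using S.cond_prob_hloss_ge_count[of "exp (- (1 - \<delta>) * I / 2)"] half by simp
qed

end

theorem theorem5:
  fixes \<alpha> \<beta> \<gamma> C0 C1 :: real
  assumes "\<alpha> \<ge> 1" and "\<beta> \<ge> 1" and "\<gamma> \<ge> 1" and "C0 > 0" and "C1 > 0"
  shows "\<exists>C'>0. \<forall>(n :: nat \<Rightarrow> nat) (d :: nat \<Rightarrow> nat) (K :: nat \<Rightarrow> nat) (\<theta>0 :: nat \<Rightarrow> real)
      (z :: nat \<Rightarrow> nat \<Rightarrow> nat) (B :: nat \<Rightarrow> nat \<Rightarrow> nat \<Rightarrow> nat \<Rightarrow> real) (\<sigma> :: nat \<Rightarrow> nat \<Rightarrow> nat \<Rightarrow> nat)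
      (\<eta>z :: nat \<Rightarrow> real) (\<eta>\<sigma> :: nat \<Rightarrow> real) (Init :: nat \<Rightarrow> init_alg)
      (M :: nat \<Rightarrow> 'w measure) (X :: nat \<Rightarrow> nat \<Rightarrow> nat \<times> nat \<Rightarrow> 'w \<Rightarrow> nat)
      (zhat :: nat \<Rightarrow> 'w \<Rightarrow> nat \<Rightarrow> nat) (I :: nat \<Rightarrow> real) (E :: nat \<Rightarrow> 'w \<Rightarrow> bool).
    filterlim n at_top sequentially \<longrightarrow>
    filterlim d at_top sequentially \<longrightarrow>
    (\<forall>t. (z t, B t, \<sigma> t) \<in> Theta (n t) (d t) (K t) (\<theta>0 t) \<alpha> \<beta> \<gamma>) \<longrightarrow>
    (\<forall>t. poisson_block_model (n t) (d t) (z t) (B t) (\<sigma> t) (M t) (X t)) \<longrightarrow>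
    (\<forall>t. valid_init (d t) (K t) (Init t)) \<longrightarrow>
    (\<forall>t. \<forall>w\<in>space (M t).
       two_stage_output (n t) (d t) (Init t) (\<lambda>i \<omega>. X t i \<omega> w) (zhat t w)) \<longrightarrow>
    (\<forall>t. \<forall>i\<in>{1..n t}. (\<lambda>w. zhat t w i) \<in> measurable (M t) (count_space UNIV)) \<longrightarrow>
    I = (\<lambda>t. info (d t) (B t) (\<sigma> t)) \<longrightarrow>
    E = (\<lambda>t w. good_init (n t) (d t) (K t) (z t) (\<sigma> t) (\<eta>z t) (\<eta>\<sigma> t) (Init t)
                  (\<lambda>i \<omega>. X t i \<omega> w)) \<longrightarrow>
    (\<forall>t. \<P>(w in M t. E t w) \<ge> 1 - C1 * real (max (n t) (d t)) powr (-2)) \<longrightarrow>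
    \<eta>z \<longlonglongrightarrow> 0 \<longrightarrow>
    \<eta>\<sigma> \<longlonglongrightarrow> 0 \<longrightarrow>
    (\<lambda>t. \<eta>\<sigma> t * ln (1 / \<eta>\<sigma> t)) \<in>
      o(\<lambda>t. (I t)\<^sup>2 / ((real (K t))\<^sup>2 * (real (d t))\<^sup>2 * \<theta>0 t * (real (d t) / real (n t)))) \<longrightarrow>
    (\<lambda>t. max (\<eta>\<sigma> t) (\<eta>z t)) \<in>
      o(\<lambda>t. I t / ((real (K t))\<^sup>2 * (real (d t))\<^sup>2 * \<theta>0 t)) \<longrightarrow>
    (\<forall>t. \<theta>0 t \<ge> C0) \<longrightarrow>
    (\<lambda>t. (real (K t))\<^sup>2 * ln (real (n t))) \<in> o(\<lambda>t. real (n t)) \<longrightarrow>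
    filterlim I at_top sequentially \<longrightarrow>
    (\<exists>\<delta>. \<delta> \<longlonglongrightarrow> 0 \<and>
       (\<forall>\<epsilon>\<in>{0<..<1}. \<forall>\<^sub>F t in sequentially.
          \<P>(w in M t. hloss (n t) 2 (zhat t w) (z t) \<le> exp (- (1 - \<delta> t) * I t / 2) \<bar> E t w)
            \<ge> 1 - exp (- (I t powr (1 - \<epsilon>))))) \<and>
    (\<exists>\<delta> r. \<delta> \<longlonglongrightarrow> 0 \<and> r \<in> O(\<lambda>t. real (n t) powr (- C')) \<and>
       (\<forall>\<^sub>F t in sequentially.
          (\<integral>w. hloss (n t) 2 (zhat t w) (z t) \<partial>M t) \<le> exp (- (1 - \<delta> t) * I t / 2) + r t))"
\<comment> \<open>C' = 2 matches the power of n in the bound on the failure probability of the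
  initialization.\<close>
proof (intro exI[of _ "2 :: real"] conjI, simp, intro allI impI, goal_cases)
  case (1 n d K \<theta>0 z B \<sigma> \<eta>z \<eta>\<sigma> Init M X zhat I E)
  note n_lim = 1(1) and d_lim = 1(2) and Theta = 1(3) and model = 1(4) and valid = 1(5)
    and out = 1(6) and zhat_meas = 1(7) and I_eq = 1(8) and E_eq = 1(9) and PE = 1(10)
    and \<eta>_lim = 1(11,12) and \<eta>_o = 1(14) and C0_le = 1(15) and I_lim = 1(17)
  define S where "S t = (real (K t))\<^sup>2 * (real (d t))\<^sup>2 * \<theta>0 t" for t
  \<comment> \<open>The entry 1 / S makes \<eta>, and with it q, positive; to \<eta> S / I it
    contributes only 1 / I, which tends to 0.\<close>
  define \<eta> where "\<eta> t = max (max (\<eta>\<sigma> t) (\<eta>z t)) (1 / S t)" for t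
  \<comment> \<open>The fourth root leaves room for three uses: q^2 scales the entropy, q the
    deviation and sqrt q the loss in the rate.\<close>
  define q where "q t = sqrt (sqrt (\<eta> t * S t / I t))" for t
  define \<delta> where "\<delta> t = rate_coeff \<alpha> \<gamma> * sqrt (q t) + 1 / ln (I t)" for t

  have pos: "\<forall>\<^sub>F t in sequentially. 0 < n t \<and> 0 < d t \<and> 1 \<le> I t"
    using n_lim d_lim I_lim by (auto simp: filterlim_at_top eventually_conj_iff Suc_le_eq[symmetric])
  have K: "1 \<le> real (K t)" if "0 < d t" for t
  proof -
    have "\<sigma> t 1 1 \<in> {1..K t}" using Theta[rule_format, of t] that unfolding Theta_def by auto
    then show ?thesis by simp
  qed
  have \<theta>_pos: "0 < \<theta>0 t" for t using C0_le[rule_format, of t] \<open>C0 > 0\<close> by linarith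
  have S_ge: "C0 * real (d t) \<le> S t" "0 < S t" if "0 < d t" for t
  proof -
    have "1 * real (d t) * C0 \<le> (real (K t))\<^sup>2 * (real (d t))\<^sup>2 * \<theta>0 t"
      using K[OF that] that C0_le \<open>C0 > 0\<close>
      by (intro mult_mono self_le_power one_le_power) auto
    then show "C0 * real (d t) \<le> S t" by (simp add: S_def mult.commute)
    moreover have "0 < C0 * real (d t)" using that \<open>C0 > 0\<close> by simp
    ultimately show "0 < S t" by linarith
  qed
  have d_lim': "filterlim (\<lambda>t. real (d t)) at_top sequentially"
    using filterlim_real_sequentially d_lim by (rule filterlim_compose)
  have n_lim': "filterlim (\<lambda>t. real (n t)) at_top sequentially"
    using filterlim_real_sequentially n_lim by (rule filterlim_compose)
  have S_lim: "(\<lambda>t. 1 / S t) \<longlonglongrightarrow> 0"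
  proof (rule tendsto_sandwich[of "\<lambda>_. 0" _ _ "\<lambda>t. 1 / C0 * (1 / real (d t))"])
    show "\<forall>\<^sub>F t in sequentially. 0 \<le> 1 / S t"
      using pos by eventually_elim (use S_ge in \<open>auto simp: less_imp_le\<close>)
    show "\<forall>\<^sub>F t in sequentially. 1 / S t \<le> 1 / C0 * (1 / real (d t))"
      using pos
    proof eventually_elim
      case (elim t)
      then have "1 / S t \<le> 1 / (C0 * real (d t))"
        using S_ge[of t] \<open>C0 > 0\<close> by (intro divide_left_mono) auto
      then show ?case by simp
    qed
    have "(\<lambda>t. 1 / real (d t)) \<longlonglongrightarrow> 0"
      using tendsto_inverse_0_at_top[OF d_lim'] by (simp add: inverse_eq_divide)
    then show "(\<lambda>t. 1 / C0 * (1 / real (d t))) \<longlonglongrightarrow> 0" by (rule tendsto_mult_right_zero)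
  qed simp
  have \<eta>_lim': "\<eta> \<longlonglongrightarrow> 0"
    using tendsto_max[OF tendsto_max[OF \<eta>_lim(2,1)] S_lim] by (simp add: \<eta>_def[abs_def])
  have I_inv: "(\<lambda>t. 1 / I t) \<longlonglongrightarrow> 0"
    using tendsto_inverse_0_at_top[OF I_lim] by (simp add: inverse_eq_divide)
  have "(\<lambda>t. max (\<eta>\<sigma> t) (\<eta>z t) / (I t / S t)) \<longlonglongrightarrow> 0"
    using smalloD_tendsto[OF \<eta>_o] by (simp add: S_def)
  from tendsto_max[OF this I_inv]
  have "(\<lambda>t. max (max (\<eta>\<sigma> t) (\<eta>z t) / (I t / S t)) (1 / I t)) \<longlonglongrightarrow> 0" by simp
  then have \<rho>_lim: "(\<lambda>t. \<eta> t * S t / I t) \<longlonglongrightarrow> 0"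
  proof (rule Lim_transform_eventually)
    show "\<forall>\<^sub>F t in sequentially. max (max (\<eta>\<sigma> t) (\<eta>z t) / (I t / S t)) (1 / I t) = \<eta> t * S t / I t"
      using pos
    proof eventually_elim
      case (elim t)
      then have "0 < S t" "0 < I t" using S_ge by auto
      then have c: "0 \<le> S t / I t" by simp
      have "\<eta> t * (S t / I t) = max (max (\<eta>\<sigma> t) (\<eta>z t) * (S t / I t)) (1 / S t * (S t / I t))"
        unfolding \<eta>_def max_mult_distrib_right[of "max (\<eta>\<sigma> t) (\<eta>z t)" "1 / S t"]
        using c by (simp only: if_P)
      moreover have "1 / S t * (S t / I t) = 1 / I t" using \<open>0 < S t\<close> by simp
      moreover have "max (\<eta>\<sigma> t) (\<eta>z t) * (S t / I t) = max (\<eta>\<sigma> t) (\<eta>z t) / (I t / S t)" by simp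
      ultimately show ?case using \<open>0 < S t\<close> by simp
    qed
  qed
  have q_lim: "q \<longlonglongrightarrow> 0"
    using tendsto_real_sqrt[OF tendsto_real_sqrt[OF \<rho>_lim]] by (simp add: q_def[abs_def])
  have "filterlim (\<lambda>t. ln (I t)) at_top sequentially" using ln_at_top I_lim by (rule filterlim_compose)
  then have "(\<lambda>t. 1 / ln (I t)) \<longlonglongrightarrow> 0"
    using tendsto_inverse_0_at_top by (simp add: inverse_eq_divide)
  from tendsto_add[OF tendsto_mult_right_zero[OF tendsto_real_sqrt[OF q_lim, simplified]] this]
  have \<delta>_lim: "\<delta> \<longlonglongrightarrow> 0" by (simp add: \<delta>_def[abs_def])
  have n_powr: "(\<lambda>t. real (n t) powr (- 2)) \<longlonglongrightarrow> 0"
    using n_lim' by (intro tendsto_neg_powr) auto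
  have PE': "\<forall>\<^sub>F t in sequentially. 1 - \<P>(w in M t. E t w) \<le> C1 * real (n t) powr (- 2)"
    using pos
  proof eventually_elim
    case (elim t)
    then have "real (max (n t) (d t)) powr (- 2) \<le> real (n t) powr (- 2)"
      by (intro powr_mono2') auto
    then have "C1 * real (max (n t) (d t)) powr (- 2) \<le> C1 * real (n t) powr (- 2)"
      using \<open>C1 > 0\<close> by simp
    then show ?case using PE[rule_format, of t] by linarith
  qed
  have half: "\<forall>\<^sub>F t in sequentially. 1 / 2 \<le> \<P>(w in M t. E t w)"
    using PE' eventually_le_const[OF tendsto_mult_right_zero[OF n_powr, of C1], of "1 / 2", simplified]
    by eventually_elim linarith
  have \<eta>_small: "\<forall>\<^sub>F t in sequentially. \<eta> t < 1 / (8 * \<alpha>)"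
    using order_tendstoD(2)[OF \<eta>_lim'] \<open>\<alpha> \<ge> 1\<close> by simp
  have main: "\<forall>\<^sub>F t in sequentially. scaled_sampled_model (n t) (d t) (K t) (z t) (B t) (\<sigma> t) (\<theta>0 t) \<alpha> \<beta> \<gamma>
      (q t) (\<eta> t) C0 (Init t) (M t) (X t) (zhat t) (\<eta>z t) (\<eta>\<sigma> t) (E t)"
    using pos half \<eta>_small eventually_admissible[OF I_lim q_lim \<open>\<alpha> \<ge> 1\<close> \<open>\<gamma> \<ge> 1\<close> \<open>C0 > 0\<close>]
  proof eventually_elim
    case (elim t)
    interpret block_model "n t" "d t" "K t" "z t" "B t" "\<sigma> t" "\<theta>0 t" \<alpha> \<beta> \<gamma>
      using elim Theta \<theta>_pos \<open>\<alpha> \<ge> 1\<close> \<open>\<gamma> \<ge> 1\<close> by unfold_locales auto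
    have S: "0 < S t" and I: "1 \<le> I t" using elim S_ge by auto
    have "0 < \<eta> t" using S by (simp add: \<eta>_def less_max_iff_disj)
    then have \<rho>: "0 < \<eta> t * S t / I t" using S I by simp
    have "q t ^ 4 = ((q t)\<^sup>2)\<^sup>2" by simp
    also have "\<dots> = \<eta> t * S t / I t" unfolding q_def using \<rho> by (simp only: real_sqrt_pow2 real_sqrt_ge_0_iff less_imp_le)
    finally have q4: "\<eta> t * (real (K t))\<^sup>2 * (real (d t))\<^sup>2 * \<theta>0 t = q t ^ 4 * I t"
      using I by (simp add: S_def mult_ac)
    \<comment> \<open>The inequality 1 <= \<eta> n is deterministic, so a single outcome of the good
      event, which exists by its positive probability, suffices.\<close>
    have "{w \<in> space (M t). E t w} \<noteq> {}" using elim(2) by force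
    then obtain w where "E t w" by auto
    then have "1 \<le> \<eta>z t * real (n t)" unfolding E_eq by (rule good_init_ge)
    also have "\<dots> \<le> \<eta> t * real (n t)" by (intro mult_right_mono) (auto simp: \<eta>_def)
    finally have \<eta>n: "1 \<le> \<eta> t * real (n t)" .
    have \<eta>\<alpha>: "8 * \<alpha> * \<eta> t < 1" using elim(3) \<open>\<alpha> \<ge> 1\<close> by (simp add: field_simps)
    moreover have "4 * \<alpha> * \<eta> t \<le> 8 * \<alpha> * \<eta> t" using \<open>0 < \<eta> t\<close> \<open>\<alpha> \<ge> 1\<close> by simp
    ultimately have \<eta>\<alpha>': "4 * \<alpha> * \<eta> t \<le> 1" by linarith
    have "0 < q t" using \<rho> by (simp add: q_def)
    then show ?case
      using elim valid C0_le \<open>C0 > 0\<close> q4 \<eta>n \<eta>\<alpha> \<eta>\<alpha>' I model out zhat_meas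
      by unfold_locales (auto simp: I_eq E_eq \<eta>_def admissible_def)
  qed
  have \<delta>_eq: "scaled_sampled_model.\<delta> (d t) (B t) (\<sigma> t) \<alpha> \<gamma> (q t) = \<delta> t"
    if "scaled_sampled_model (n t) (d t) (K t) (z t) (B t) (\<sigma> t) (\<theta>0 t) \<alpha> \<beta> \<gamma>
      (q t) (\<eta> t) C0 (Init t) (M t) (X t) (zhat t) (\<eta>z t) (\<eta>\<sigma> t) (E t)" for t
    using scaled_sampled_model.\<delta>_def[OF that] by (simp add: \<delta>_def I_eq)
  have "\<forall>\<^sub>F t in sequentially.
      \<P>(w in M t. hloss (n t) 2 (zhat t w) (z t) \<le> exp (- (1 - \<delta> t) * I t / 2) \<bar> E t w)
        \<ge> 1 - exp (- (I t powr (1 - \<epsilon>)))" if \<epsilon>: "\<epsilon> \<in> {0<..<1}" for \<epsilon>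
  proof -
    have "\<forall>\<^sub>F t in sequentially. exp (- I t / (2 * ln (I t)) + I t powr (1 - \<epsilon>)) \<le> 1 / 6"
      using \<epsilon> by (intro eventually_le_const filterlim_compose[OF exp_div_ln_powr_tendsto I_lim]) auto
    moreover have "\<forall>\<^sub>F t in sequentially. I t * exp (- I t / (40 * (ln (I t))\<^sup>2) + I t powr (1 - \<epsilon>))
        \<le> 1 / (6 * (256 * \<alpha> / C0))"
      using \<epsilon> \<open>\<alpha> \<ge> 1\<close> \<open>C0 > 0\<close>
      by (intro eventually_le_const filterlim_compose[OF exp_div_ln_square_powr_tendsto I_lim]) auto
    ultimately show ?thesis using main
    proof eventually_elim
      case (elim t)
      have c: "0 < 6 * (256 * \<alpha> / C0)" using \<open>\<alpha> \<ge> 1\<close> \<open>C0 > 0\<close> by simp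
      have "6 * (256 * \<alpha> / C0) * (I t * exp (- I t / (40 * (ln (I t))\<^sup>2) + I t powr (1 - \<epsilon>))) \<le> 1"
        using iffD1[OF pos_le_divide_eq[OF c] elim(2)] by (subst mult.commute)
      then show ?case
        using scaled_sampled_model.cond_prob_ge[OF elim(3), of \<epsilon>] elim(1)
        unfolding \<delta>_eq[OF elim(3)] by (simp add: I_eq)
    qed
  qed
  moreover have "(\<lambda>t. (1 - \<P>(w in M t. E t w)) + real (n t) powr (- 2)) \<in> O(\<lambda>t. real (n t) powr (- 2))"
  \<comment> \<open>C1 for a failed initialization, 1 for the error probability of the second
    regime.\<close>
  proof (rule bigoI[where c = "C1 + 1"])
    show "\<forall>\<^sub>F t in sequentially. norm ((1 - \<P>(w in M t. E t w)) + real (n t) powr (- 2))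
        \<le> (C1 + 1) * norm (real (n t) powr (- 2))"
      using PE'
    proof eventually_elim
      case (elim t)
      interpret prob_space "M t" using model by (simp add: poisson_block_model_def)
      have "0 \<le> 1 - \<P>(w in M t. E t w)" by simp
      moreover have "0 \<le> real (n t) powr (- 2)" by simp
      ultimately show ?case using elim unfolding real_norm_def by (simp add: distrib_right)
    qed
  qed
  moreover have "\<forall>\<^sub>F t in sequentially. (\<integral>w. hloss (n t) 2 (zhat t w) (z t) \<partial>M t)
      \<le> exp (- (1 - \<delta> t) * I t / 2) + ((1 - \<P>(w in M t. E t w)) + real (n t) powr (- 2))"
    using main
  proof eventually_elim
    case (elim t)
    show ?case using scaled_sampled_model.expectation_le[OF elim] unfolding \<delta>_eq[OF elim] by (simp add: I_eq)
  qed
  ultimately show ?case using \<delta>_lim by blast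
qed

end
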